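(* Let $P$ be a probability measure on the space $\Omega$ of cookie environments satisfying (IID), (BD) and (WEL), let $\delta=E\left[\sum_{i=1}^\infty(2\omega(0,i)-1)\right]$, and let $k\ge1$ be such that the arrow environment $a$ is $\mathbb{P}$-a.s. $k$-right transient. Let $v^{(k-\min)}$ be the a.s. limit $\lim_{n\to\infty}X_n/n$ of the $k$-minimum walk $X$ (all particles started at $0$). Then $v^{(k-\min)}>0$ if and only if $\delta>k+1$.
   Context: $\mathbb{N}=\{1,2,\dots\}$. $\Omega=[0,1]^{\mathbb{Z}\times\mathbb{N}}$ with the product Borel $\sigma$-algebra; $E$ is expectation with respect to $P$. Conditions on $P$: (IID): the stacks $(\omega(x,\cdot))_{x\in\mathbb{Z}}$ are i.i.d. under $P$. (WEL): for all $x\in\mathbb{Z}$, $P(\omega(x,n)>0\ \forall n)>0$ and $P(\omega(x,n)<1\ \forall n)>0$. (BD): there is a deterministic $M$ such that $P$-a.s. $\omega(x,n)=\frac12$ for all $x\in\mathbb{Z}$ and $n>M$. Arrow environments: an arrow environment is $a\in\{-1,1\}^{\mathbb{Z}\times\mathbb{N}}$. Given $\omega\in\Omega$, $\mathbb{P}_\omega$ is the law on arrow environments under which the $a(x,n)$ are independent with $\mathbb{P}_\omega(a(x,n)=1)=\omega(x,n)$; $\mathbb{P}=E[\mathbb{P}_\omega]$ is the annealed law. The walk on $a$ started at $0$ takes, on its $i$-th visit to $y$, the step $a(y,i)$. If this walk has finite total local time $L(x)$ (number of visits) at every $x$, $a$ is called transient and its leftover is $LO(a)(x,n)=a(x,n+L(x))$.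 Put $a_0=a$, $a_j=LO(a_{j-1})$. $a$ is $k$-right transient if for $1\le i\le k$ the walk on $a_{i-1}$ started at $0$ tends to $+\infty$. $k$-minimum walk: $k$ particles start at $0$. At each time step the leftmost particle (ties broken by smallest index) moves; if it is at $y$ and this is the $i$-th time in total that some particle makes a move from $y$, it moves to $y+a(y,i)$. $X_t$ denotes the position of the leftmost particle at time $t$ (after $t$ moves). Under the stated assumptions $X_n/n$ converges a.s. to a deterministic constant. *)

theory Defs
  imports "HOL-Probability.Probability"
begin

type_synonym cookie_env = "int \<times> nat \<Rightarrow> real"
type_synonym arrow_env = "int \<times> nat \<Rightarrow> int"

text \<open>Sites carry stacks indexed from 1, so all environments live on
  \<open>UNIV \<times> {1..}\<close>, as extensional functions.\<close>

abbreviation stack_sites :: "(int \<times> nat) set" where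
  "stack_sites \<equiv> UNIV \<times> {1..}"

abbreviation unit_borel :: "real measure" where
  "unit_borel \<equiv> restrict_space borel {0..1}"

definition cookie_space :: "cookie_env measure" where
  "cookie_space = (\<Pi>\<^sub>M i\<in>stack_sites. unit_borel)"

definition cookie_stack :: "int \<Rightarrow> cookie_env \<Rightarrow> nat \<Rightarrow> real" where
  "cookie_stack x \<omega> = (\<lambda>n\<in>{1..}. \<omega> (x, n))"

definition IID :: "cookie_env measure \<Rightarrow> bool" where
  "IID P \<longleftrightarrow>
     prob_space.indep_vars P (\<lambda>_. \<Pi>\<^sub>M n\<in>{1..}. unit_borel) cookie_stack UNIV \<and>
     (\<forall>x y. distr P (\<Pi>\<^sub>M n\<in>{1..}. unit_borel) (cookie_stack x)
          = distr P (\<Pi>\<^sub>M n\<in>{1..}. unit_borel) (cookie_stack y))"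

definition WEL :: "cookie_env measure \<Rightarrow> bool" where
  "WEL P \<longleftrightarrow>
     (\<forall>x. \<P>(\<omega> in P. \<forall>n\<ge>1. \<omega> (x, n) > 0) > 0 \<and>
          \<P>(\<omega> in P. \<forall>n\<ge>1. \<omega> (x, n) < 1) > 0)"

definition BD :: "cookie_env measure \<Rightarrow> bool" where
  "BD P \<longleftrightarrow> (\<exists>M. AE \<omega> in P. \<forall>x. \<forall>n>M. \<omega> (x, n) = 1 / 2)"

definition total_drift :: "cookie_env measure \<Rightarrow> real" where
  "total_drift P = (\<integral>\<omega>. (\<Sum>i. 2 * \<omega> (0, Suc i) - 1) \<partial>P)"

definition arrow_law :: "real \<Rightarrow> int measure" where
  "arrow_law p = distr (measure_pmf (bernoulli_pmf p)) (count_space {-1, 1})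
                   (\<lambda>b. if b then 1 else -1)"

definition quenched :: "cookie_env \<Rightarrow> arrow_env measure" where
  "quenched \<omega> = (\<Pi>\<^sub>M i\<in>stack_sites. arrow_law (\<omega> i))"

definition annealed :: "cookie_env measure \<Rightarrow> arrow_env measure" where
  "annealed P = P \<bind> quenched"

text \<open>A state consists of the current position together with the number of steps taken so far
  from each site; the \<open>i\<close>-th visit to \<open>y\<close> is thus the one made when \<open>i - 1\<close> steps
  from \<open>y\<close> have been taken.\<close>

primrec walk_state :: "arrow_env \<Rightarrow> nat \<Rightarrow> int \<times> (int \<Rightarrow> nat)" where
  "walk_state a 0 = (0, \<lambda>_. 0)"
| "walk_state a (Suc t) =
     (let (y, c) = walk_state a t
      in (y + a (y, c y + 1), c(y := c y + 1)))"

definition walk :: "arrow_env \<Rightarrow> nat \<Rightarrow> int" where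
  "walk a t = fst (walk_state a t)"

text \<open>Only meaningful if the set is finite, i.e. for transient \<open>a\<close>.\<close>

definition local_time :: "arrow_env \<Rightarrow> int \<Rightarrow> nat" where
  "local_time a x = card {t. walk a t = x}"

definition leftover :: "arrow_env \<Rightarrow> arrow_env" where
  "leftover a = (\<lambda>(x, n)\<in>stack_sites. a (x, n + local_time a x))"

text \<open>If the first \<open>k - 1\<close> of these walks tend to infinity, then the environments they run on
  are transient, so every leftover occurring here is a genuine one.\<close>

definition k_right_transient :: "nat \<Rightarrow> arrow_env \<Rightarrow> bool" where
  "k_right_transient k a \<longleftrightarrow>
     (\<forall>i\<in>{1..k}. filterlim (walk ((leftover ^^ (i - 1)) a)) at_top sequentially)"

text \<open>The particles are indexed by \<open>{1..k}\<close>; a state of the \<open>k\<close>-minimum walk consists of their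
  positions together with the number of moves made so far, by any particle, from each site.\<close>

definition leftmost :: "nat \<Rightarrow> (nat \<Rightarrow> int) \<Rightarrow> int" where
  "leftmost k p = Min (p ` {1..k})"

primrec kmin_state :: "nat \<Rightarrow> arrow_env \<Rightarrow> nat \<Rightarrow> (nat \<Rightarrow> int) \<times> (int \<Rightarrow> nat)" where
  "kmin_state k a 0 = (\<lambda>_. 0, \<lambda>_. 0)"
| "kmin_state k a (Suc t) =
     (let (p, c) = kmin_state k a t;
          y = leftmost k p;
          j = (LEAST j. j \<in> {1..k} \<and> p j = y)
      in (p(j := y + a (y, c y + 1)), c(y := c y + 1)))"

definition kmin_walk :: "nat \<Rightarrow> arrow_env \<Rightarrow> nat \<Rightarrow> int" where
  "kmin_walk k a t = leftmost k (fst (kmin_state k a t))"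

end

theory Submission
  imports Defs
begin

text \<open>Write \<open>\<delta>\<close> for the total drift. When the leftmost particle first reaches level \<open>n\<close>, all \<open>k\<close>
  particles sit at \<open>n\<close>. Hence every edge between \<open>0\<close> and \<open>n\<close> has been crossed to the right exactly
  \<open>k\<close> times more often than to the left, and the number of left moves from a site is the number of
  left arrows that precede a certain right arrow of its stack. Read from level \<open>n\<close> downwards, the
  numbers of left moves (here called \<open>excursions\<close>) form a Markov chain \<open>Z\<close> with
  \<open>Z' = number of left arrows before right arrow number k + Z\<close> in a fresh stack, and the time to
  reach level \<open>n\<close> is comparable with the sum of the first \<open>n\<close> values of \<open>Z\<close>, plus the contribution
  of the negative sites, where no particles are added. Positive speed thus means that these sums grow
  linearly in \<open>n\<close>. Only two one-sided deterministic comparisons are used: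
  \<open>hitting_time_le_excursions\<close> (no site is used more often than the chain allows) and
  \<open>excursions_sum_le_time\<close> (reaching level \<open>n\<close> costs at least this many left moves).

  All but the first \<open>M\<close> arrows of a stack are fair coins, so given the first \<open>M\<close> arrows the offspring
  is negative binomial and its moments are explicit: \<open>Z\<close> has drift \<open>k - \<delta>\<close> and variance
  \<open>2 Z + O(1)\<close>. Consequently \<open>Z\<^sup>2\<close> has drift \<open>2 (k + 1 - \<delta>) Z + O(1)\<close>, which is where the threshold
  \<open>k + 1\<close> comes from.

  If \<open>\<delta> > k + 1\<close>, then \<open>Z\<^sup>2\<close> is a Lyapunov function: summing its drift bounds the expected sum of the
  first \<open>n\<close> values by a multiple of \<open>n\<close>. To control the negative half-line, where the chain dies out,
  a jump at \<open>0\<close> is added to the Lyapunov function; it makes use of the positive probability of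
  immediate extinction, which weak ellipticity provides. So level \<open>n\<close> is reached within time \<open>A n\<close> with probability at
  least \<open>1 / 2\<close>, for every \<open>n\<close>, and the speed is positive (\<open>positive_speed\<close>).

  If \<open>\<delta> \<le> k + 1\<close>, then a truncation of \<open>Z\<^sup>2\<close> at scale \<open>N\<close> gains a fixed amount \<open>p\<close> per step and loses at
  most \<open>K min (Z\<^sup>2 / N) N\<close> (\<open>truncated_quadratic_lyapunov\<close>). Being bounded, it cannot gain on
  average, so in the long run the mean time average of \<open>min (Z\<^sup>2 / N) N\<close> is at least \<open>p / K\<close> at every large scale.
  The sum of these functions over dyadic \<open>N < 2\<^sup>L\<close> is at most \<open>min (4 Z) (2\<^sup>L)\<close>, so the truncated
  time averages of \<open>Z\<close> grow at least linearly in \<open>L\<close>. This excludes linear growth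
  of the sums with probability tending to one, hence positive speed (\<open>positive_speed_imp_drift\<close>).\<close>

section \<open>Right and left arrows in a stack\<close>

definition rights :: "(nat \<Rightarrow> int) \<Rightarrow> nat \<Rightarrow> nat" where
  "rights s t = card {i \<in> {1..t}. s i = 1}"

text \<open>The number of left arrows that precede right arrow number \<open>m\<close>: that arrow has position \<open>m + j\<close>
  exactly when \<open>j\<close> left arrows come before it.\<close>

definition fails :: "(nat \<Rightarrow> int) \<Rightarrow> nat \<Rightarrow> nat" where
  "fails s m = (LEAST j. rights s (m + j) = m)"

abbreviation stack :: "arrow_env \<Rightarrow> int \<Rightarrow> nat \<Rightarrow> int" where
  "stack a x \<equiv> \<lambda>n. a (x, n)"

text \<open>The number of left moves from site \<open>n - i\<close> until level \<open>n\<close> is reached. The right moves from site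
  \<open>n - 1 - i\<close> are those which balance the left moves from \<open>n - i\<close>, and \<open>k\<close> more as long as the edge
  lies to the right of the starting point \<open>0\<close>, that is for \<open>i < n\<close>.\<close>

primrec excursions :: "nat \<Rightarrow> arrow_env \<Rightarrow> nat \<Rightarrow> nat \<Rightarrow> nat" where
  "excursions k a n 0 = 0"
| "excursions k a n (Suc i) =
     fails (stack a (int n - 1 - int i)) ((if i < n then k else 0) + excursions k a n i)"

lemma rights_0 [simp]: "rights s 0 = 0"
  by (simp add: rights_def)

lemma rights_Suc: "rights s (Suc t) = rights s t + (if s (Suc t) = 1 then 1 else 0)"
proof -
  have "{i \<in> {1..Suc t}. s i = 1} = {i \<in> {1..t}. s i = 1} \<union> (if s (Suc t) = 1 then {Suc t} else {})"
    by (auto simp: le_Suc_eq)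
  then show ?thesis by (auto simp: rights_def)
qed

lemma rights_le: "rights s t \<le> t"
  by (induction t) (auto simp: rights_Suc)

lemma rights_mono: "t \<le> u \<Longrightarrow> rights s t \<le> rights s u"
  by (induction rule: dec_induct) (auto simp: rights_Suc)

lemma rights_increment_le: "t \<le> u \<Longrightarrow> rights s u - rights s t \<le> u - t"
  by (induction rule: dec_induct) (auto simp: rights_Suc)

lemma lefts_mono: "t \<le> u \<Longrightarrow> t - rights s t \<le> u - rights s u"
  using rights_increment_le[of t u s] rights_le[of s t] rights_le[of s u] rights_mono[of t u s] by linarith

lemma rights_hit:
  assumes "m \<le> rights s t"
  shows "\<exists>j. m + j \<le> t \<and> rights s (m + j) = m"
  using assms
proof (induction t)
  case (Suc t)
  show ?case
  proof (cases "m \<le> rights s t")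
    case True
    with Suc.IH show ?thesis by (metis le_SucI)
  next
    case False
    with Suc.prems have "rights s (Suc t) = m" by (auto simp: rights_Suc split: if_splits)
    moreover have "m \<le> Suc t" using rights_le[of s "Suc t"] Suc.prems by linarith
    ultimately show ?thesis by (metis le_add_diff_inverse order_refl)
  qed
qed auto

lemma rights_fails:
  assumes "\<exists>t. m \<le> rights s t"
  shows "rights s (m + fails s m) = m"
  using assms rights_hit unfolding fails_def by (metis (mono_tags, lifting) LeastI)

lemma fails_0 [simp]: "fails s 0 = 0"
  unfolding fails_def by (rule Least_equality) auto

lemma fails_le_lefts:
  assumes "m \<le> rights s t"
  shows "fails s m \<le> t - rights s t"
proof -
  obtain j where j: "m + j \<le> t" "rights s (m + j) = m" using rights_hit[OF assms] by blast
  have "fails s m \<le> j" unfolding fails_def by (rule Least_le) (rule j)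
  also have "\<dots> = (m + j) - rights s (m + j)" using j by simp
  also have "\<dots> \<le> t - rights s t" by (rule lefts_mono[OF j(1)])
  finally show ?thesis .
qed

lemma fails_mono:
  assumes "m \<le> m'" "\<exists>t. m' \<le> rights s t"
  shows "fails s m \<le> fails s m'"
  using fails_le_lefts[of m s "m' + fails s m'"] rights_fails[OF assms(2)] assms by simp

lemma fails_Suc_eq:
  assumes "rights s (m + j) = m" "s (Suc (m + j)) = 1"
  shows "fails s (Suc m) = j"
  unfolding fails_def
proof (rule Least_equality)
  show "rights s (Suc m + j) = Suc m" using assms by (simp add: rights_Suc)
  fix y assume y: "rights s (Suc m + y) = Suc m"
  show "j \<le> y"
  proof (rule ccontr)
    assume "\<not> j \<le> y"
    then have "rights s (Suc m + y) \<le> rights s (m + j)" by (intro rights_mono) auto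
    with y assms show False by simp
  qed
qed

lemma rights_cong: "(\<And>i. i \<in> {1..t} \<Longrightarrow> s i = s' i) \<Longrightarrow> rights s t = rights s' t"
  unfolding rights_def by (rule arg_cong[where f = card]) auto

lemma fails_cong: "(\<And>i. i \<ge> 1 \<Longrightarrow> s i = s' i) \<Longrightarrow> fails s m = fails s' m"
  unfolding fails_def by (subst rights_cong[of _ s s']) auto

section \<open>Flow conservation and the time to reach a level\<close>

abbreviation "kpos k a t \<equiv> fst (kmin_state k a t)"
abbreviation "kcount k a t \<equiv> snd (kmin_state k a t)"

lemma leftmost_attained:
  assumes "k \<ge> 1"
  shows "\<exists>j. j \<in> {1..k} \<and> p j = leftmost k p"
proof -
  have "Min (p ` {1..k}) \<in> p ` {1..k}" using assms by (intro Min_in) auto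
  then show ?thesis by (auto simp: leftmost_def)
qed

lemma leftmost_le: "i \<in> {1..k} \<Longrightarrow> leftmost k p \<le> p i"
  by (auto simp: leftmost_def)

lemma kmin_step:
  assumes "k \<ge> 1"
  obtains j where "j \<in> {1..k}" "kpos k a t j = kmin_walk k a t"
    "kpos k a (Suc t) = (kpos k a t)(j := kmin_walk k a t + a (kmin_walk k a t, Suc (kcount k a t (kmin_walk k a t))))"
    "kcount k a (Suc t) = (kcount k a t)(kmin_walk k a t := Suc (kcount k a t (kmin_walk k a t)))"
proof -
  define j where "j = (LEAST j. j \<in> {1..k} \<and> kpos k a t j = kmin_walk k a t)"
  have "j \<in> {1..k} \<and> kpos k a t j = kmin_walk k a t"
    unfolding j_def by (rule LeastI_ex) (simp only: kmin_walk_def leftmost_attained[OF assms])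
  moreover have "kpos k a (Suc t) = (kpos k a t)(j := kmin_walk k a t + a (kmin_walk k a t, Suc (kcount k a t (kmin_walk k a t))))"
    "kcount k a (Suc t) = (kcount k a t)(kmin_walk k a t := Suc (kcount k a t (kmin_walk k a t)))"
    by (simp_all add: j_def kmin_walk_def split_beta Let_def)
  ultimately show ?thesis using that by blast
qed

definition proper :: "arrow_env \<Rightarrow> bool" where
  "proper a \<longleftrightarrow> (\<forall>x n. n \<ge> 1 \<longrightarrow> a (x, n) = 1 \<or> a (x, n) = -1)"

lemma card_fun_upd_ge:
  fixes p :: "nat \<Rightarrow> int"
  assumes "j \<in> I" "finite I"
  shows "int (card {i \<in> I. y \<le> (p(j := q)) i}) = int (card {i \<in> I. y \<le> p i}) + of_bool (y \<le> q) - of_bool (y \<le> p j)"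
proof -
  have *: "{i \<in> I. y \<le> f i} = {i \<in> I - {j}. y \<le> f i} \<union> (if y \<le> f j then {j} else {})" for f :: "nat \<Rightarrow> int"
    using assms by auto
  have c: "card {i \<in> I. y \<le> f i} = card {i \<in> I - {j}. y \<le> f i} + of_bool (y \<le> f j)" for f :: "nat \<Rightarrow> int"
    by (subst *) (use assms in \<open>auto simp: card_insert_if\<close>)
  have e: "{i \<in> I - {j}. y \<le> (p(j := q)) i} = {i \<in> I - {j}. y \<le> p i}" by auto
  show ?thesis unfolding c[of p] c[of "p(j := q)"] e by simp
qed

text \<open>The particles to the right of an edge are those which started there, plus those that crossed the
  edge to the right, minus those that crossed it to the left.\<close>

lemma flow_conservation:
  assumes "k \<ge> 1" "proper a"
  shows "int (card {i \<in> {1..k}. y \<le> kpos k a t i}) =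
    (if y \<le> 0 then int k else 0) + int (rights (stack a (y - 1)) (kcount k a t (y - 1)))
      - (int (kcount k a t y) - int (rights (stack a y) (kcount k a t y)))"
proof (induction t)
  case 0
  have "{i. Suc 0 \<le> i \<and> i \<le> k} = {1..k}" by auto
  then show ?case by (simp add: not_le)
next
  case (Suc t)
  let ?x = "kmin_walk k a t" and ?c = "kcount k a t"
  obtain j where j: "j \<in> {1..k}" "kpos k a t j = ?x"
    "kpos k a (Suc t) = (kpos k a t)(j := ?x + a (?x, Suc (?c ?x)))"
    "kcount k a (Suc t) = ?c(?x := Suc (?c ?x))"
    using kmin_step[OF assms(1)] by blast
  have a: "a (?x, Suc (?c ?x)) = 1 \<or> a (?x, Suc (?c ?x)) = -1"
    using assms(2) by (auto simp: proper_def)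
  show ?case
    unfolding j(3,4) card_fun_upd_ge[OF j(1) finite_atLeastAtMost] Suc.IH j(2)
    using a by (auto simp: rights_Suc)
qed

lemma kcount_sum:
  assumes "k \<ge> 1" "finite A"
  shows "(\<Sum>y\<in>A. kcount k a t y) = card {u. u < t \<and> kmin_walk k a u \<in> A}"
proof (induction t)
  case (Suc t)
  let ?x = "kmin_walk k a t"
  obtain j where j: "kcount k a (Suc t) = (kcount k a t)(?x := Suc (kcount k a t ?x))"
    using kmin_step[OF assms(1)] by blast
  have *: "{u. u < Suc t \<and> kmin_walk k a u \<in> A} =
      {u. u < t \<and> kmin_walk k a u \<in> A} \<union> (if ?x \<in> A then {t} else {})"
    by (auto simp: less_Suc_eq)
  have "(\<Sum>y\<in>A. kcount k a (Suc t) y) = (\<Sum>y\<in>A. kcount k a t y + (if y = ?x then 1 else 0))"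
    unfolding j by (intro sum.cong) auto
  also have "\<dots> = (\<Sum>y\<in>A. kcount k a t y) + (if ?x \<in> A then 1 else 0)"
    using assms(2) by (simp add: sum.distrib)
  finally show ?case unfolding * Suc.IH by auto
qed auto

lemma kmin_walk_bound:
  assumes "k \<ge> 1" "proper a"
  shows "\<bar>kmin_walk k a t\<bar> \<le> int t"
proof -
  have "\<forall>i\<in>{1..k}. \<bar>kpos k a t i\<bar> \<le> int t"
  proof (induction t)
    case (Suc t)
    obtain j where j: "j \<in> {1..k}" "kpos k a t j = kmin_walk k a t"
      "kpos k a (Suc t) = (kpos k a t)(j := kmin_walk k a t + a (kmin_walk k a t, Suc (kcount k a t (kmin_walk k a t))))"
      using kmin_step[OF assms(1)] by metis
    have "a (kmin_walk k a t, Suc (kcount k a t (kmin_walk k a t))) \<in> {1, -1}"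
      using assms(2) by (auto simp: proper_def)
    with Suc j show ?case by fastforce
  qed auto
  then show ?thesis using leftmost_attained[OF assms(1)] by (metis kmin_walk_def)
qed

text \<open>Once all particles are at or beyond level \<open>n\<close>, conservation on the edge below site \<open>n - i\<close> gives
  at least \<open>k\<close> plus the left moves from \<open>n - i\<close> as the number of right moves from \<open>n - 1 - i\<close>, and these
  right moves force the stated left moves from \<open>n - 1 - i\<close>.\<close>

lemma excursions_le_lefts:
  assumes "k \<ge> 1" "proper a" "int n \<le> kmin_walk k a t" "i \<le> n"
  shows "int (excursions k a n i) \<le>
    int (kcount k a t (int n - int i)) - int (rights (stack a (int n - int i)) (kcount k a t (int n - int i)))"
  using assms(4)
proof (induction i)
  case 0
  then show ?case using rights_le by (simp add: )
next
  case (Suc i)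
  define y where "y = int n - int i"
  have y: "1 \<le> y" "y \<le> int n" using Suc.prems by (auto simp: y_def)
  let ?c = "kcount k a t"
  have "{i \<in> {1..k}. y \<le> kpos k a t i} = {1..k}"
    using assms(3) y leftmost_le[of _ k "kpos k a t"] by (force simp: kmin_walk_def)
  then have "int k = int (rights (stack a (y - 1)) (?c (y - 1)))
      - (int (?c y) - int (rights (stack a y) (?c y)))"
    using flow_conservation[OF assms(1,2), of y t] y by simp
  then have "k + excursions k a n i \<le> rights (stack a (y - 1)) (?c (y - 1))"
    using Suc by (simp add: y_def)
  from fails_le_lefts[OF this]
  have "fails (stack a (y - 1)) (k + excursions k a n i) \<le> ?c (y - 1) - rights (stack a (y - 1)) (?c (y - 1))" .
  moreover have "int n - 1 - int i = y - 1" "int n - int (Suc i) = y - 1" by (auto simp: y_def)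
  moreover have "excursions k a n (Suc i) = fails (stack a (int n - 1 - int i)) (k + excursions k a n i)"
    using Suc.prems by simp
  ultimately show ?case
    using rights_le[of "stack a (y - 1)" "?c (y - 1)"] by (simp only: of_nat_diff[symmetric] of_nat_le_iff)
qed

lemma excursions_sum_le_time:
  assumes "k \<ge> 1" "proper a" "int n \<le> kmin_walk k a t"
  shows "(\<Sum>i\<le>n. excursions k a n i) \<le> t"
proof -
  let ?A = "(\<lambda>i. int n - int i) ` {..n}"
  have "(\<Sum>i\<le>n. excursions k a n i) \<le> (\<Sum>i\<le>n. kcount k a t (int n - int i))"
  proof (rule sum_mono)
    fix i assume "i \<in> {..n}"
    with excursions_le_lefts[OF assms, of i] show "excursions k a n i \<le> kcount k a t (int n - int i)" by simp
  qed
  also have "\<dots> = (\<Sum>y\<in>?A. kcount k a t y)"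
    by (subst sum.reindex) (auto simp: inj_on_def)
  also have "\<dots> = card {u. u < t \<and> kmin_walk k a u \<in> ?A}"
    by (rule kcount_sum[OF assms(1)]) simp
  also have "\<dots> \<le> card {u. u < t}" by (rule card_mono) auto
  finally show ?thesis by simp
qed

text \<open>A least action principle: if all sites have so far been used at most as often as the recursion
  allows, then a site that has used up its allowance has received no more particles than it has sent
  away, so no particle is left there to exceed the allowance.\<close>

lemma kcount_le_excursions:
  assumes "k \<ge> 1" "proper a" and good: "\<And>x m. \<exists>t. m \<le> rights (stack a x) t"
    and below: "\<And>u. u < t \<Longrightarrow> kmin_walk k a u < int n"
  shows "(\<forall>y\<ge>int n. kcount k a t y = 0) \<and>
    (\<forall>i. kcount k a t (int n - 1 - int i) \<le>
       (if i < n then k else 0) + excursions k a n i + excursions k a n (Suc i))"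
  using below
proof (induction t)
  case (Suc t)
  define R where "R i = (if i < n then k else 0) + excursions k a n i" for i
  define D where "D i = excursions k a n i" for i
  let ?x = "kmin_walk k a t" and ?c = "kcount k a t"
  have IH: "\<forall>y\<ge>int n. ?c y = 0" "\<And>i. ?c (int n - 1 - int i) \<le> R i + D (Suc i)"
    using Suc by (auto simp: R_def D_def)
  have x: "?x < int n" using Suc.prems by auto
  obtain j where j: "j \<in> {1..k}" "kpos k a t j = ?x"
    "kcount k a (Suc t) = ?c(?x := Suc (?c ?x))"
    using kmin_step[OF assms(1)] by metis
  define i where "i = nat (int n - 1 - ?x)"
  have i: "?x = int n - 1 - int i" using x by (simp add: i_def)
  have hit: "rights (stack a (int n - 1 - int i)) (R i + D (Suc i)) = R i" for i
    using rights_fails[of "R i" "stack a (int n - 1 - int i)", OF good] by (simp add: R_def D_def)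
  have rle: "rights (stack a (int n - 1 - int i)) (?c (int n - 1 - int i)) \<le> R i" for i
    using rights_mono[OF IH(2)[of i], of "stack a (int n - 1 - int i)"] hit[of i] by simp
  have lle: "?c (int n - 1 - int i) - rights (stack a (int n - 1 - int i)) (?c (int n - 1 - int i)) \<le> D (Suc i)" for i
    using lefts_mono[OF IH(2)[of i], of "stack a (int n - 1 - int i)"] hit[of i] by simp
  have "?c ?x < R i + D (Suc i)"
  proof (rule ccontr)
    assume "\<not> ?c ?x < R i + D (Suc i)"
    then have full: "?c ?x = R i + D (Suc i)" using IH(2)[of i] i by simp
    let ?N = "\<lambda>y. card {i \<in> {1..k}. y \<le> kpos k a t i}"
    have "?N (?x + 1) < ?N ?x"
    proof (rule psubset_card_mono)
      have "j \<in> {i \<in> {1..k}. ?x \<le> kpos k a t i} - {i \<in> {1..k}. ?x + 1 \<le> kpos k a t i}"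
        using j(1,2) by simp
      then show "{i \<in> {1..k}. ?x + 1 \<le> kpos k a t i} \<subset> {i \<in> {1..k}. ?x \<le> kpos k a t i}" by force
    qed simp
    moreover have "int (?N ?x) = (if ?x \<le> 0 then int k else 0) + int (rights (stack a (?x - 1)) (?c (?x - 1)))
      - (int (?c ?x) - int (rights (stack a ?x) (?c ?x)))"
      by (rule flow_conservation[OF assms(1,2)])
    moreover have "int (?N (?x + 1)) = (if ?x + 1 \<le> 0 then int k else 0) + int (rights (stack a ?x) (?c ?x))
      - (int (?c (?x + 1)) - int (rights (stack a (?x + 1)) (?c (?x + 1))))"
      using flow_conservation[OF assms(1,2), of "?x + 1" t] by simp
    moreover have "rights (stack a (?x - 1)) (?c (?x - 1)) \<le> (if Suc i < n then k else 0) + D (Suc i)"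
      using rle[of "Suc i"] unfolding i by (simp add: R_def D_def algebra_simps)
    moreover have "int (?c (?x + 1)) - int (rights (stack a (?x + 1)) (?c (?x + 1))) \<le> int (D i)"
    proof (cases i)
      case 0
      with i IH(1) show ?thesis by simp
    next
      case (Suc i')
      with lle[of i'] rights_le[of "stack a (?x + 1)" "?c (?x + 1)"] show ?thesis
        unfolding i by (simp add: algebra_simps)
    qed
    moreover have "R i = (if i < n then k else 0) + D i" by (simp add: R_def D_def)
    moreover have "(?x \<le> 0 \<longleftrightarrow> i \<ge> n - 1)" "?x + 1 \<le> 0 \<longleftrightarrow> i \<ge> n" using i x by auto
    ultimately show False using full by (cases "Suc i < n"; cases "i < n") auto
  qed
  then have "Suc (?c (int n - 1 - int i)) \<le> R i + D (Suc i)" using i by simp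
  with IH x i show ?case unfolding j(3) R_def D_def by auto
qed auto

text \<open>The time is the sum of all numbers of moves; as long as level \<open>n\<close> is not reached, these are bounded by
  the allowances, in which every excursion number occurs twice.\<close>

lemma hitting_time_le_excursions:
  assumes "k \<ge> 1" "proper a" and good: "\<And>x m. \<exists>t. m \<le> rights (stack a x) t"
    and S: "\<And>I. (\<Sum>i<I. excursions k a n i) \<le> S"
  shows "\<exists>t \<le> Suc (n * k + 2 * S). int n \<le> kmin_walk k a t"
proof (rule ccontr)
  define t where "t = Suc (n * k + 2 * S)"
  assume contra: "\<not> ?thesis"
  have below: "kmin_walk k a u < int n" if "u < t" for u
    using that contra unfolding t_def by (meson less_imp_le not_le)
  \<comment> \<open>up to time \<open>t\<close> the walk stays above \<open>- t\<close>\<close>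
  define I where "I = n + t"
  let ?A = "(\<lambda>i. int n - 1 - int i) ` {..<I}"
  have "kmin_walk k a u \<in> ?A" if "u < t" for u
  proof -
    have "- int t < kmin_walk k a u" using kmin_walk_bound[OF assms(1,2), of u] that by linarith
    with below[OF that] have "kmin_walk k a u = int n - 1 - int (nat (int n - 1 - kmin_walk k a u))"
      "nat (int n - 1 - kmin_walk k a u) < I" by (auto simp: I_def)
    then show ?thesis by blast
  qed
  then have "{u. u < t \<and> kmin_walk k a u \<in> ?A} = {..<t}" by auto
  then have "t = (\<Sum>y\<in>?A. kcount k a t y)"
    using kcount_sum[OF assms(1), of ?A a t] by simp
  also have "\<dots> = (\<Sum>i<I. kcount k a t (int n - 1 - int i))"
    by (subst sum.reindex) (auto simp: inj_on_def)
  also have "\<dots> \<le> (\<Sum>i<I. (if i < n then k else 0) + excursions k a n i + excursions k a n (Suc i))"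
    using kcount_le_excursions[OF assms(1,2) good below] by (intro sum_mono) simp
  also have "\<dots> = (\<Sum>i<I. if i < n then k else 0) + (\<Sum>i<I. excursions k a n i) + (\<Sum>i<I. excursions k a n (Suc i))"
    by (simp add: sum.distrib)
  also have "(\<Sum>i<I. if i < n then k else 0) = (\<Sum>i<n. k)"
    by (intro sum.mono_neutral_cong_right) (auto simp: I_def)
  also have "(\<Sum>i<I. excursions k a n (Suc i)) \<le> (\<Sum>i<Suc I. excursions k a n i)"
    by (subst sum.lessThan_Suc_shift) simp
  finally have "t \<le> n * k + S + S" using S[of I] S[of "Suc I"] by simp
  then show False by (simp add: t_def)
qed

section \<open>The stacks of arrows under the annealed law\<close>

abbreviation arrows :: "int measure" where
  "arrows \<equiv> count_space {-1, 1}"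

definition stack_space :: "(nat \<Rightarrow> int) measure" where
  "stack_space = (\<Pi>\<^sub>M n\<in>{1..}. arrows)"

definition stack_law :: "(nat \<Rightarrow> real) \<Rightarrow> (nat \<Rightarrow> int) measure" where
  "stack_law w = (\<Pi>\<^sub>M n\<in>{1..}. arrow_law (w n))"

definition arrow_stack :: "int \<Rightarrow> arrow_env \<Rightarrow> nat \<Rightarrow> int" where
  "arrow_stack x a = (\<lambda>n\<in>{1..}. a (x, n))"

lemma sets_arrow_law [simp, measurable_cong]: "sets (arrow_law p) = sets arrows"
  by (simp add: arrow_law_def)

lemma space_arrow_law [simp]: "space (arrow_law p) = {-1, 1}"
  by (simp add: arrow_law_def)

lemma prob_space_arrow_law: "prob_space (arrow_law p)"
  unfolding arrow_law_def by (rule prob_space.prob_space_distr) (auto intro: measure_pmf.prob_space_axioms)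

lemma measure_arrow_law:
  assumes "0 \<le> p" "p \<le> 1"
  shows "measure (arrow_law p) {1} = p" "measure (arrow_law p) {-1} = 1 - p"
proof -
  have 1: "measure (arrow_law p) A = measure (measure_pmf (bernoulli_pmf p)) ((\<lambda>b. if b then 1 else -1) -` A)"
    if "A \<subseteq> {-1, 1}" for A
    unfolding arrow_law_def using that by (subst measure_distr) auto
  have "((\<lambda>b. if b then 1 else (-1::int)) -` {1}) = {True}" "((\<lambda>b. if b then 1 else (-1::int)) -` {-1}) = {False}"
    by (auto split: if_splits)
  with 1[of "{1}"] 1[of "{-1}"] assms show "measure (arrow_law p) {1} = p" "measure (arrow_law p) {-1} = 1 - p"
    by (auto simp: measure_pmf_single)
qed

lemma emeasure_arrow_law_measurable:
  assumes "A \<in> sets arrows"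
  shows "(\<lambda>p. emeasure (arrow_law p) A) \<in> borel_measurable unit_borel"
proof -
  interpret prob_space "arrow_law p" for p by (rule prob_space_arrow_law)
  have A: "A \<subseteq> {-1, 1}" using assms by auto
  have "emeasure (arrow_law p) A = ennreal (of_bool (1 \<in> A) * p + of_bool (-1 \<in> A) * (1 - p))"
    if p: "p \<in> {0..1}" for p
  proof -
    have "measure (arrow_law p) A = (\<Sum>x\<in>A. measure (arrow_law p) {x})"
      using A by (intro finite_measure_eq_sum_singleton) (auto intro: finite_subset)
    also have "\<dots> = (\<Sum>x\<in>{-1, 1}. of_bool (x \<in> A) * measure (arrow_law p) {x})"
      using A by (intro sum.mono_neutral_cong_left) auto
    also have "\<dots> = of_bool (1 \<in> A) * p + of_bool (-1 \<in> A) * (1 - p)"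
      using p by (simp add: measure_arrow_law)
    finally show ?thesis by (simp add: emeasure_eq_measure)
  qed
  then show ?thesis
    by (subst measurable_cong[where g="\<lambda>p. ennreal (of_bool (1 \<in> A) * p + of_bool (-1 \<in> A) * (1 - p))"])
      (auto intro!: measurable_restrict_space1)
qed

lemma prob_space_PiM_arrow_law: "prob_space (\<Pi>\<^sub>M i\<in>I. arrow_law (w i))"
  by (intro prob_space_PiM prob_space_arrow_law)

text \<open>Cylinder events suffice: their probability is a finite product of measurable functions of the
  environment. Used for the whole environment and for a single stack.\<close>

lemma PiM_arrow_law_measurable:
  "(\<lambda>w. \<Pi>\<^sub>M i\<in>I. arrow_law (w i)) \<in>
     measurable (\<Pi>\<^sub>M i\<in>I. unit_borel) (prob_algebra (\<Pi>\<^sub>M i\<in>I. arrows))"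
proof (rule measurable_prob_algebra_generated[OF sets_PiM Int_stable_prod_algebra prod_algebra_sets_into_space])
  show "sets (\<Pi>\<^sub>M i\<in>I. arrow_law (w i)) = sets (\<Pi>\<^sub>M i\<in>I. arrows)" for w :: "'a \<Rightarrow> real"
    by (intro sets_PiM_cong) auto
  fix A :: "('a \<Rightarrow> int) set" assume "A \<in> prod_algebra I (\<lambda>i. arrows)"
  then obtain J E where A: "A = prod_emb I (\<lambda>i. arrows) J (Pi\<^sub>E J E)" "finite J" "J \<noteq> {} \<or> I = {}" "J \<subseteq> I"
    "\<And>i. i \<in> J \<Longrightarrow> E i \<in> sets arrows"
    by (rule prod_algebraE) (rule that)
  have "emeasure (\<Pi>\<^sub>M i\<in>I. arrow_law (w i)) A = (\<Prod>i\<in>J. emeasure (arrow_law (w i)) (E i))" for w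
  proof -
    have "A = prod_emb I (\<lambda>i. arrow_law (w i)) J (Pi\<^sub>E J E)"
      unfolding A(1) by (simp add: prod_emb_def)
    then show ?thesis using A(2,4,5) prob_space_arrow_law by (simp add: emeasure_PiM_emb)
  qed
  moreover have "(\<lambda>w. \<Prod>i\<in>J. emeasure (arrow_law (w i)) (E i)) \<in> borel_measurable (\<Pi>\<^sub>M i\<in>I. unit_borel)"
  proof (rule borel_measurable_prod_ennreal)
    fix i assume "i \<in> J"
    with A have "i \<in> I" "E i \<in> sets arrows" by auto
    then show "(\<lambda>w. emeasure (arrow_law (w i)) (E i)) \<in> borel_measurable (\<Pi>\<^sub>M i\<in>I. unit_borel)"
      using measurable_compose[OF measurable_component_singleton[of i I "\<lambda>_. unit_borel"], OF _ emeasure_arrow_law_measurable]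
      by simp
  qed
  ultimately show "(\<lambda>w. emeasure (\<Pi>\<^sub>M i\<in>I. arrow_law (w i)) A) \<in> borel_measurable (\<Pi>\<^sub>M i\<in>I. unit_borel)"
    by simp
qed (rule prob_space_PiM_arrow_law)

lemma indep_vars_PiM_coordinates:
  assumes "\<And>i. i \<in> I \<Longrightarrow> prob_space (M i)" "I \<noteq> {}"
  shows "prob_space.indep_vars (PiM I M) M (\<lambda>i \<omega>. \<omega> i) I"
proof -
  interpret prob_space "PiM I M" by (intro prob_space_PiM assms)
  have "distr (PiM I M) (M i) (\<lambda>\<omega>. \<omega> i) = M i" if "i \<in> I" for i
    by (rule distr_PiM_component[OF assms(1) that])
  then have "Pi\<^sub>M I (\<lambda>i. distr (PiM I M) (M i) (\<lambda>\<omega>. \<omega> i)) = PiM I M"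
    by (intro PiM_cong) auto
  moreover have "distr (PiM I M) (PiM I M) (\<lambda>x. \<lambda>i\<in>I. x i) = PiM I M"
    by (subst distr_cong[where g="\<lambda>x. x"]) (auto simp: space_PiM PiE_restrict distr_id)
  ultimately show ?thesis
    by (subst indep_vars_iff_distr_eq_PiM'[OF assms(2)]) (auto intro: measurable_component_singleton)
qed

lemma prob_space_quenched: "prob_space (quenched \<omega>)"
  unfolding quenched_def by (rule prob_space_PiM_arrow_law)

lemma sets_quenched [simp, measurable_cong]: "sets (quenched \<omega>) = sets (\<Pi>\<^sub>M i\<in>stack_sites. arrows)"
  unfolding quenched_def by (intro sets_PiM_cong) auto

lemma sets_stack_law [simp, measurable_cong]: "sets (stack_law w) = sets stack_space"
  unfolding stack_law_def stack_space_def by (intro sets_PiM_cong) auto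

lemma space_stack_law: "space (stack_law w) = space stack_space"
  by (rule sets_eq_imp_space_eq) simp

lemma prob_space_stack_law: "prob_space (stack_law w)"
  unfolding stack_law_def by (rule prob_space_PiM_arrow_law)

lemma stack_law_measurable: "stack_law \<in> measurable (\<Pi>\<^sub>M n\<in>{1..}. unit_borel) (prob_algebra stack_space)"
  using PiM_arrow_law_measurable[of "{1..}"] unfolding stack_law_def[abs_def] stack_space_def .

lemma emeasure_stack_law_measurable:
  "B \<in> sets stack_space \<Longrightarrow> (\<lambda>w. emeasure (stack_law w) B) \<in> borel_measurable (\<Pi>\<^sub>M n\<in>{1..}. unit_borel)"
  using measurable_compose[OF measurable_prob_algebraD[OF stack_law_measurable] measurable_emeasure_subprob_algebra] .

lemma arrow_stack_measurable [measurable]: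
  "arrow_stack x \<in> measurable (\<Pi>\<^sub>M i\<in>stack_sites. arrows) stack_space"
  unfolding arrow_stack_def[abs_def] stack_space_def by (intro measurable_restrict measurable_component_singleton) auto

lemma cookie_stack_measurable:
  "cookie_stack x \<in> measurable cookie_space (\<Pi>\<^sub>M n\<in>{1..}. unit_borel)"
  unfolding cookie_stack_def[abs_def] cookie_space_def
  by (intro measurable_restrict measurable_component_singleton) auto

lemma distr_quenched_stack:
  "distr (quenched \<omega>) stack_space (arrow_stack x) = stack_law (cookie_stack x \<omega>)"
proof -
  have "stack_law (cookie_stack x \<omega>) = (\<Pi>\<^sub>M n\<in>{1..}. arrow_law (\<omega> (x, n)))"
    unfolding stack_law_def by (intro PiM_cong) (auto simp: cookie_stack_def)
  moreover have "distr (quenched \<omega>) (\<Pi>\<^sub>M n\<in>{1..}. arrow_law (\<omega> (x, n))) (arrow_stack x) = (\<Pi>\<^sub>M n\<in>{1..}. arrow_law (\<omega> (x, n)))"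
    unfolding quenched_def arrow_stack_def[abs_def]
    by (rule distr_PiM_reindex) (auto simp: inj_on_def intro: prob_space_arrow_law)
  moreover have "distr (quenched \<omega>) stack_space (arrow_stack x) =
    distr (quenched \<omega>) (\<Pi>\<^sub>M n\<in>{1..}. arrow_law (\<omega> (x, n))) (arrow_stack x)"
    unfolding stack_space_def by (intro distr_cong sets_PiM_cong) auto
  ultimately show ?thesis by simp
qed

lemma quenched_stacks_indep:
  "prob_space.indep_vars (quenched \<omega>) (\<lambda>_. stack_space) arrow_stack UNIV"
proof -
  interpret prob_space "quenched \<omega>" by (rule prob_space_quenched)
  have "indep_vars (\<lambda>i. arrow_law (\<omega> i)) (\<lambda>i a. a i) stack_sites"
    unfolding quenched_def by (rule indep_vars_PiM_coordinates) (auto intro: prob_space_arrow_law)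
  then have "indep_vars (\<lambda>x. \<Pi>\<^sub>M i\<in>{x} \<times> {1..}. arrow_law (\<omega> i)) (\<lambda>x a. restrict (\<lambda>i. a i) ({x} \<times> {1..})) UNIV"
    by (rule indep_vars_restrict) (auto simp: disjoint_family_on_def)
  then have "indep_vars (\<lambda>_. stack_space) (\<lambda>x a. (\<lambda>b. \<lambda>n\<in>{1..}. b (x, n)) (restrict (\<lambda>i. a i) ({x} \<times> {1..}))) UNIV"
  proof (rule indep_vars_compose2)
    fix x :: int
    have "(\<lambda>b. b (x, n)) \<in> measurable (\<Pi>\<^sub>M i\<in>{x} \<times> {1..}. arrow_law (\<omega> i)) arrows" if "n \<in> {1..}" for n :: nat
      using measurable_component_singleton[of "(x, n)" "{x} \<times> {1..}" "\<lambda>i. arrow_law (\<omega> i)"] that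
        measurable_cong_sets[OF refl sets_arrow_law[of "\<omega> (x, n)"]] by auto
    then show "(\<lambda>b. \<lambda>n\<in>{1..}. b (x, n)) \<in> measurable (\<Pi>\<^sub>M i\<in>{x} \<times> {1..}. arrow_law (\<omega> i)) stack_space"
      unfolding stack_space_def by (intro measurable_restrict)
  qed
  then show ?thesis
    by (rule indep_vars_cong[THEN iffD1, rotated -1]) (auto simp: arrow_stack_def fun_eq_iff)
qed

locale iid_environment = prob_space P for P :: "cookie_env measure" +
  assumes sets_P: "sets P = sets cookie_space" and iid: "IID P"
begin

lemma cookie_stack_rv [measurable]: "cookie_stack x \<in> measurable P (\<Pi>\<^sub>M n\<in>{1..}. unit_borel)"
  using cookie_stack_measurable measurable_cong_sets[OF sets_P refl] by auto

lemma quenched_rv: "quenched \<in> measurable P (prob_algebra (\<Pi>\<^sub>M i\<in>stack_sites. arrows))"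
  using PiM_arrow_law_measurable[of stack_sites] measurable_cong_sets[OF sets_P refl]
  unfolding quenched_def[abs_def] cookie_space_def by auto

lemma quenched_rv' [measurable]: "quenched \<in> measurable P (subprob_algebra (\<Pi>\<^sub>M i\<in>stack_sites. arrows))"
  by (rule measurable_prob_algebraD[OF quenched_rv])

lemma sets_annealed [measurable_cong]: "sets (annealed P) = sets (\<Pi>\<^sub>M i\<in>stack_sites. arrows)"
  unfolding annealed_def by (rule sets_bind) (auto simp: not_empty)

lemma space_annealed: "space (annealed P) = space (\<Pi>\<^sub>M i\<in>stack_sites. arrows)"
  by (rule sets_eq_imp_space_eq) (rule sets_annealed)

lemma prob_space_annealed: "prob_space (annealed P)"
  unfolding annealed_def
  by (rule prob_space_bind[OF _ quenched_rv']) (auto intro!: AE_I2 prob_space_quenched)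

sublocale ann: prob_space "annealed P" by (rule prob_space_annealed)

lemma emeasure_annealed:
  "A \<in> sets (\<Pi>\<^sub>M i\<in>stack_sites. arrows) \<Longrightarrow> emeasure (annealed P) A = (\<integral>\<^sup>+\<omega>. emeasure (quenched \<omega>) A \<partial>P)"
  unfolding annealed_def by (rule emeasure_bind[OF not_empty quenched_rv'])

lemma arrow_stack_rv [measurable]: "arrow_stack x \<in> measurable (annealed P) stack_space"
  by measurable

lemma stack_law_rv: "B \<in> sets stack_space \<Longrightarrow> (\<lambda>\<omega>. emeasure (stack_law (cookie_stack x \<omega>)) B) \<in> borel_measurable P"
  using measurable_compose[OF cookie_stack_rv measurable_compose[OF measurable_prob_algebraD[OF stack_law_measurable] measurable_emeasure_subprob_algebra]] .

lemma stack_event: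
  "B \<in> sets stack_space \<Longrightarrow> arrow_stack x -` B \<inter> space (annealed P) \<in> sets (\<Pi>\<^sub>M i\<in>stack_sites. arrows)"
  using measurable_sets[OF arrow_stack_rv] by (simp only: sets_annealed)

lemma emeasure_annealed_stack:
  assumes B: "B \<in> sets stack_space"
  shows "emeasure (annealed P) (arrow_stack x -` B \<inter> space (annealed P)) =
    (\<integral>\<^sup>+\<omega>. emeasure (stack_law (cookie_stack x \<omega>)) B \<partial>P)"
proof -
  have "emeasure (annealed P) (arrow_stack x -` B \<inter> space (annealed P)) =
      (\<integral>\<^sup>+\<omega>. emeasure (quenched \<omega>) (arrow_stack x -` B \<inter> space (annealed P)) \<partial>P)"
    by (rule emeasure_annealed[OF stack_event[OF B]])
  also have "\<dots> = (\<integral>\<^sup>+\<omega>. emeasure (stack_law (cookie_stack x \<omega>)) B \<partial>P)"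
  proof (rule nn_integral_cong)
    fix \<omega>
    have "space (quenched \<omega>) = space (annealed P)" by (rule sets_eq_imp_space_eq) (simp add: sets_annealed)
    then show "emeasure (quenched \<omega>) (arrow_stack x -` B \<inter> space (annealed P)) = emeasure (stack_law (cookie_stack x \<omega>)) B"
      unfolding distr_quenched_stack[symmetric]
      using B emeasure_distr[of "arrow_stack x" "quenched \<omega>" stack_space B] arrow_stack_measurable[of x]
        measurable_cong_sets[OF sets_quenched refl] by simp
  qed
  finally show ?thesis .
qed

lemma stack_marginal:
  assumes B: "B \<in> sets stack_space"
  shows "emeasure (annealed P) (arrow_stack x -` B \<inter> space (annealed P)) =
    emeasure (annealed P) (arrow_stack 0 -` B \<inter> space (annealed P))"
proof -
  note f = emeasure_stack_law_measurable[OF B]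
  have "(\<integral>\<^sup>+\<omega>. emeasure (stack_law (cookie_stack x \<omega>)) B \<partial>P) =
    (\<integral>\<^sup>+w. emeasure (stack_law w) B \<partial>distr P (\<Pi>\<^sub>M n\<in>{1..}. unit_borel) (cookie_stack x))" for x
    using f by (subst nn_integral_distr[OF cookie_stack_rv]) simp_all
  moreover have "distr P (\<Pi>\<^sub>M n\<in>{1..}. unit_borel) (cookie_stack x) = distr P (\<Pi>\<^sub>M n\<in>{1..}. unit_borel) (cookie_stack 0)"
    using iid unfolding IID_def by blast
  ultimately show ?thesis unfolding emeasure_annealed_stack[OF B] by simp
qed

lemma distr_arrow_stack: "distr (annealed P) stack_space (arrow_stack x) = distr (annealed P) stack_space (arrow_stack 0)"
proof (rule measure_eqI)
  fix B assume "B \<in> sets (distr (annealed P) stack_space (arrow_stack x))"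
  then have B: "B \<in> sets stack_space" by simp
  show "emeasure (distr (annealed P) stack_space (arrow_stack x)) B = emeasure (distr (annealed P) stack_space (arrow_stack 0)) B"
    using stack_marginal[OF B, of x] by (simp add: emeasure_distr[OF arrow_stack_rv B])
qed simp

text \<open>Given the environment the stacks of arrows are independent, and their joint probabilities are
  products of functions of the individual stacks of cookies; independence of the latter turns the
  expectation of the product into a product of expectations.\<close>

lemma stacks_indep: "ann.indep_vars (\<lambda>_. stack_space) arrow_stack UNIV"
proof -
  let ?N = "\<lambda>x B. arrow_stack x -` B \<inter> space (annealed P)"
  have "ann.indep_sets (\<lambda>x. {?N x B |B. B \<in> sets stack_space}) UNIV"
  proof (rule ann.indep_setsI)
    fix A J assume J: "J \<noteq> {}" "finite J" and A: "\<forall>j\<in>J. A j \<in> {?N j B |B. B \<in> sets stack_space}"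
    then have "\<forall>j\<in>J. \<exists>B. B \<in> sets stack_space \<and> A j = ?N j B" by blast
    from bchoice[OF this] obtain B where "\<forall>j\<in>J. B j \<in> sets stack_space \<and> A j = ?N j (B j)" ..
    then have B: "\<And>j. j \<in> J \<Longrightarrow> B j \<in> sets stack_space" "\<And>j. j \<in> J \<Longrightarrow> A j = ?N j (B j)"
      by blast+
    have Aj: "A j \<in> sets (\<Pi>\<^sub>M i\<in>stack_sites. arrows)" if "j \<in> J" for j
      using B[OF that] stack_event by simp
    have q: "emeasure (quenched \<omega>) (\<Inter>j\<in>J. A j) = (\<Prod>j\<in>J. emeasure (stack_law (cookie_stack j \<omega>)) (B j))" for \<omega>
    proof -
      interpret Q: prob_space "quenched \<omega>" by (rule prob_space_quenched)
      interpret S: prob_space "stack_law w" for w by (rule prob_space_stack_law)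
      have sp: "space (quenched \<omega>) = space (annealed P)" by (rule sets_eq_imp_space_eq) (simp add: sets_annealed)
      have "Q.indep_sets (\<lambda>x. {?N x B |B. B \<in> sets stack_space}) UNIV"
        using quenched_stacks_indep[of \<omega>] unfolding Q.indep_vars_def2 sp by simp
      from Q.indep_setsD[OF this _ J A]
      have "Q.prob (\<Inter>j\<in>J. A j) = (\<Prod>j\<in>J. Q.prob (A j))" by simp
      moreover have "Q.prob (A j) = S.prob (cookie_stack j \<omega>) (B j)" if "j \<in> J" for j
        unfolding distr_quenched_stack[symmetric] using B[OF that] measure_distr[of "arrow_stack j" "quenched \<omega>" stack_space "B j"] arrow_stack_measurable[of j] measurable_cong_sets[OF sets_quenched refl] by (simp add: sp)
      ultimately show ?thesis
        by (simp add: Q.emeasure_eq_measure S.emeasure_eq_measure prod_ennreal)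
    qed
    have "emeasure (annealed P) (\<Inter>j\<in>J. A j) = (\<integral>\<^sup>+\<omega>. (\<Prod>j\<in>J. emeasure (stack_law (cookie_stack j \<omega>)) (B j)) \<partial>P)"
      using J Aj sets.finite_INT[of J A] by (subst emeasure_annealed) (simp_all add: q)
    also have "\<dots> = (\<Prod>j\<in>J. \<integral>\<^sup>+\<omega>. emeasure (stack_law (cookie_stack j \<omega>)) (B j) \<partial>P)"
    proof (rule indep_vars_nn_integral[OF J(2)])
      have "indep_vars (\<lambda>_. \<Pi>\<^sub>M n\<in>{1..}. unit_borel) cookie_stack J"
        using indep_vars_subset[OF conjunct1[OF iid[unfolded IID_def]]] by simp
      then show "indep_vars (\<lambda>_. borel) (\<lambda>j \<omega>. emeasure (stack_law (cookie_stack j \<omega>)) (B j)) J"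
        by (rule indep_vars_compose2) (rule emeasure_stack_law_measurable[OF B(1)])
    qed auto
    also have "\<dots> = (\<Prod>j\<in>J. emeasure (annealed P) (A j))"
      using B by (intro prod.cong refl) (simp add: emeasure_annealed_stack)
    finally show "ann.prob (\<Inter>j\<in>J. A j) = (\<Prod>j\<in>J. ann.prob (A j))"
      by (simp add: ann.emeasure_eq_measure prod_ennreal prod_nonneg)
  next
    fix x show "{?N x B |B. B \<in> sets stack_space} \<subseteq> ann.events"
      unfolding sets_annealed using stack_event by blast
  qed
  then show ?thesis unfolding ann.indep_vars_def2 by (intro conjI ballI arrow_stack_rv)
qed

end

section \<open>Moments of the negative binomial distribution\<close>

text \<open>The probability that \<open>i\<close> failures precede success number \<open>n + 1\<close> for a fair coin.\<close>

definition negbin :: "nat \<Rightarrow> nat \<Rightarrow> real" where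
  "negbin n i = real ((n + i) choose n) / 2 ^ (n + i + 1)"

lemma negbin_sums: "negbin n sums 1"
proof -
  let ?p = "neg_binomial_pmf (Suc n) (1/2)"
  have "(\<lambda>i. measure_pmf.prob ?p {i}) sums measure_pmf.prob ?p (\<Union>i. {i})"
    by (rule measure_pmf.finite_measure_UNION) (auto simp: disjoint_family_on_def)
  moreover have "measure_pmf.prob ?p {i} = negbin n i" for i
    using binomial_symmetric[of i "n + i"]
    by (simp add: measure_pmf_single pmf_neg_binomial negbin_def power_add add_ac field_simps power_divide)
  moreover have "(\<Union>i::nat. {i}) = UNIV" by auto
  ultimately show ?thesis by simp
qed

text \<open>Weighting with \<open>i\<close> leads to the same family with one more success; this turns moments of order
  \<open>j + 1\<close> into moments of order \<open>j\<close>.\<close>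

lemma negbin_shift: "real (Suc i) * negbin n (Suc i) = real (Suc n) * negbin (Suc n) i"
proof -
  have "Suc i * ((n + Suc i) choose Suc i) = Suc (n + i) * ((n + i) choose i)"
    using Suc_times_binomial[of i "n + i"] by simp
  also have "((n + i) choose i) = ((n + i) choose n)"
    using binomial_symmetric[of i "n + i"] by simp
  also have "Suc (n + i) * ((n + i) choose n) = Suc n * (Suc (n + i) choose Suc n)"
    using Suc_times_binomial[of n "n + i"] by simp
  finally have "Suc i * ((n + Suc i) choose n) = Suc n * (Suc (n + i) choose Suc n)"
    using binomial_symmetric[of "Suc i" "n + Suc i"] by simp
  then have "real (Suc i) * real ((n + Suc i) choose n) = real (Suc n) * real (Suc (n + i) choose Suc n)"
    by (metis of_nat_mult)
  then show ?thesis by (simp add: negbin_def field_simps)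
qed

lemma negbin_shift_sums:
  assumes "(\<lambda>i. negbin (Suc n) i * f i) sums s"
  shows "(\<lambda>i. negbin n i * (real i * f (i - 1))) sums (real (Suc n) * s)"
proof -
  have "(\<lambda>i. real (Suc n) * (negbin (Suc n) i * f i)) sums (real (Suc n) * s)"
    by (rule sums_mult[OF assms])
  moreover have "real (Suc n) * (negbin (Suc n) i * f i) = negbin n (Suc i) * (real (Suc i) * f (Suc i - 1))" for i
    using arg_cong[OF negbin_shift[of i n], of "\<lambda>z. z * f i"] by (simp only: mult_ac diff_Suc_1)
  ultimately have "(\<lambda>i. negbin n (Suc i) * (real (Suc i) * f (Suc i - 1))) sums (real (Suc n) * s)"
    by (simp only:)
  then show ?thesis by (subst (asm) sums_Suc_iff) simp
qed

lemma negbin_mean: "(\<lambda>i. negbin n i * real i) sums real (Suc n)"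
  using negbin_shift_sums[of n "\<lambda>_. 1" 1] negbin_sums by simp

lemma negbin_second: "(\<lambda>i. negbin n i * real i ^ 2) sums (real (Suc n) ^ 2 + 2 * real (Suc n))"
proof -
  have "(\<lambda>i. negbin (Suc n) i * (real i + 1)) sums (real (Suc (Suc n)) + 1)"
    using sums_add[OF negbin_mean[of "Suc n"] negbin_sums[of "Suc n"]] by (simp add: algebra_simps)
  from negbin_shift_sums[OF this] have "(\<lambda>i. negbin n i * (real i * (real (i - 1) + 1))) sums (real (Suc n) * (real (Suc (Suc n)) + 1))" .
  moreover have "real i * (real (i - 1) + 1) = real i ^ 2" for i
    by (cases i) (auto simp: power2_eq_square algebra_simps)
  moreover have "real (Suc n) * (real (Suc (Suc n)) + 1) = real (Suc n) ^ 2 + 2 * real (Suc n)"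
    by (simp add: power2_eq_square algebra_simps)
  ultimately show ?thesis by (simp only:)
qed

lemma negbin_third: "(\<lambda>i. negbin n i * real i ^ 3) sums (real (Suc n) ^ 3 + 6 * real (Suc n) ^ 2 + 6 * real (Suc n))"
proof -
  have "(\<lambda>i. negbin (Suc n) i * real i ^ 2 + 2 * (negbin (Suc n) i * real i) + negbin (Suc n) i) sums
      ((real (Suc (Suc n)) ^ 2 + 2 * real (Suc (Suc n))) + 2 * real (Suc (Suc n)) + 1)"
    by (intro sums_add sums_mult negbin_mean negbin_second negbin_sums)
  then have "(\<lambda>i. negbin (Suc n) i * (real i + 1) ^ 2) sums
      ((real (Suc (Suc n)) ^ 2 + 2 * real (Suc (Suc n))) + 2 * real (Suc (Suc n)) + 1)"
    by (simp add: power2_eq_square algebra_simps)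
  from negbin_shift_sums[OF this] have "(\<lambda>i. negbin n i * (real i * (real (i - 1) + 1) ^ 2)) sums
      (real (Suc n) * ((real (Suc (Suc n)) ^ 2 + 2 * real (Suc (Suc n))) + 2 * real (Suc (Suc n)) + 1))" .
  moreover have "real i * (real (i - 1) + 1) ^ 2 = real i ^ 3" for i
    by (cases i) (auto simp: power2_eq_square power3_eq_cube algebra_simps)
  moreover have "real (Suc n) * ((real (Suc (Suc n)) ^ 2 + 2 * real (Suc (Suc n))) + 2 * real (Suc (Suc n)) + 1) =
      real (Suc n) ^ 3 + 6 * real (Suc n) ^ 2 + 6 * real (Suc n)"
    by (simp add: power2_eq_square power3_eq_cube algebra_simps)
  ultimately show ?thesis by (simp only:)
qed

section \<open>Left arrows before a given right arrow\<close>

lemma component_measurable: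
  "n \<ge> 1 \<Longrightarrow> (\<lambda>s. s n) \<in> measurable stack_space (count_space UNIV)"
proof -
  assume n: "n \<ge> 1"
  have "(\<lambda>s. s n) \<in> measurable stack_space arrows"
    unfolding stack_space_def by (rule measurable_component_singleton) (use n in simp)
  then show ?thesis by (rule measurable_compose) simp
qed

lemma rights_measurable [measurable]: "(\<lambda>s. rights s t) \<in> measurable stack_space (count_space UNIV)"
proof (induction t)
  case (Suc t)
  note [measurable] = Suc component_measurable[of "Suc t", simplified]
  show ?case unfolding rights_Suc by measurable
qed auto

lemma fails_measurable [measurable]: "(\<lambda>s. fails s m) \<in> measurable stack_space (count_space UNIV)"
  unfolding fails_def by measurable

text \<open>Arrow number \<open>t + 1\<close> is independent of the number of right arrows among the first \<open>t\<close>.\<close>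

lemma stack_law_next:
  assumes w: "0 \<le> w (Suc t)" "w (Suc t) \<le> 1"
  shows "measure (stack_law w) {s \<in> space stack_space. rights s t = i \<and> s (Suc t) = 1} =
      w (Suc t) * measure (stack_law w) {s \<in> space stack_space. rights s t = i}" (is ?A)
    and "measure (stack_law w) {s \<in> space stack_space. rights s t = i \<and> s (Suc t) = -1} =
      (1 - w (Suc t)) * measure (stack_law w) {s \<in> space stack_space. rights s t = i}" (is ?B)
proof -
  interpret prob_space "stack_law w" by (rule prob_space_stack_law)
  let ?L = "\<lambda>n. arrow_law (w n)"
  have "indep_vars ?L (\<lambda>n s. s n) {1..}"
    unfolding stack_law_def by (rule indep_vars_PiM_coordinates) (auto intro: prob_space_arrow_law)
  then have "indep_var (PiM {1..t} ?L) (\<lambda>s. restrict (\<lambda>n. s n) {1..t}) (PiM {Suc t} ?L) (\<lambda>s. restrict (\<lambda>n. s n) {Suc t})"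
    by (rule indep_var_restrict) auto
  moreover have "(\<lambda>b. int (rights b t)) \<in> measurable (PiM {1..t} ?L) (count_space UNIV)"
  proof -
    have "(\<lambda>b. rights b u) \<in> measurable (PiM {1..t} ?L) (count_space UNIV)" if "u \<le> t" for u
      using that
    proof (induction u)
      case (Suc u)
      then have [measurable]: "(\<lambda>b. rights b u) \<in> measurable (PiM {1..t} ?L) (count_space UNIV)" by simp
      have "(\<lambda>b. b (Suc u)) \<in> measurable (PiM {1..t} ?L) (?L (Suc u))"
        by (rule measurable_component_singleton) (use Suc in auto)
      then have [measurable]: "(\<lambda>b. b (Suc u)) \<in> measurable (PiM {1..t} ?L) (count_space UNIV)"
        by (rule measurable_compose) (simp add: measurable_cong_sets[OF sets_arrow_law refl])
      show ?case unfolding rights_Suc by measurable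
    qed simp
    from this[OF order_refl] show ?thesis by (rule measurable_compose) simp
  qed
  moreover have "(\<lambda>b. b (Suc t)) \<in> measurable (PiM {Suc t} ?L) (?L (Suc t))"
    by (rule measurable_component_singleton) simp
  ultimately have "indep_var (count_space UNIV) ((\<lambda>b. int (rights b t)) \<circ> (\<lambda>s. restrict (\<lambda>n. s n) {1..t}))
      (?L (Suc t)) ((\<lambda>b. b (Suc t)) \<circ> (\<lambda>s. restrict (\<lambda>n. s n) {Suc t}))"
    by (rule indep_var_compose)
  moreover have "((\<lambda>b. int (rights b t)) \<circ> (\<lambda>s. restrict (\<lambda>n. s n) {1..t})) = (\<lambda>s. int (rights s t))"
    by (auto simp: fun_eq_iff intro!: rights_cong)
  moreover have "((\<lambda>b. b (Suc t)) \<circ> (\<lambda>s. restrict (\<lambda>n. s n) {Suc t})) = (\<lambda>s::nat \<Rightarrow> int. s (Suc t))"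
    by (auto simp: fun_eq_iff)
  ultimately have iv: "indep_var (count_space UNIV) (\<lambda>s. int (rights s t)) (?L (Suc t)) (\<lambda>s. s (Suc t))" by (simp only:)
  have marg: "prob ((\<lambda>s. s (Suc t)) -` {x} \<inter> space (stack_law w)) = measure (?L (Suc t)) {x}" if "x \<in> {1,-1}" for x
  proof -
    have "distr (stack_law w) (?L (Suc t)) (\<lambda>s. s (Suc t)) = ?L (Suc t)"
      unfolding stack_law_def by (rule distr_PiM_component) (auto intro: prob_space_arrow_law)
    then have "measure (?L (Suc t)) {x} = measure (distr (stack_law w) (?L (Suc t)) (\<lambda>s. s (Suc t))) {x}" by simp
    also have "\<dots> = prob ((\<lambda>s. s (Suc t)) -` {x} \<inter> space (stack_law w))"
      by (rule measure_distr[OF indep_var_rv2[OF iv]]) (use that in auto)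
    finally show ?thesis ..
  qed
  have "prob ((\<lambda>s. (int (rights s t), s (Suc t))) -` ({int i} \<times> {x}) \<inter> space (stack_law w)) =
      prob ((\<lambda>s. int (rights s t)) -` {int i} \<inter> space (stack_law w)) * measure (?L (Suc t)) {x}" if "x \<in> {1,-1}" for x
    unfolding marg[OF that, symmetric] by (rule indep_varD[OF iv]) (use that in auto)
  moreover have "(\<lambda>s. (int (rights s t), s (Suc t))) -` ({int i} \<times> {x}) \<inter> space (stack_law w) = {s \<in> space stack_space. rights s t = i \<and> s (Suc t) = x}" for x
    by (auto simp: space_stack_law)
  moreover have "(\<lambda>s. int (rights s t)) -` {int i} \<inter> space (stack_law w) = {s \<in> space stack_space. rights s t = i}"
    by (auto simp: space_stack_law)
  ultimately have "prob {s \<in> space stack_space. rights s t = i \<and> s (Suc t) = x} = prob {s \<in> space stack_space. rights s t = i} * measure (?L (Suc t)) {x}"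
    if "x \<in> {1,-1}" for x using that by (simp only:)
  from this[of 1] this[of "-1"] w show ?A ?B by (simp_all add: measure_arrow_law)
qed

lemma stack_law_marginal:
  assumes n: "n \<ge> 1" and w: "0 \<le> w n" "w n \<le> 1"
  shows "measure (stack_law w) {s \<in> space stack_space. s n = 1} = w n"
proof -
  have "distr (stack_law w) (arrow_law (w n)) (\<lambda>s. s n) = arrow_law (w n)"
    unfolding stack_law_def by (rule distr_PiM_component) (use n in \<open>auto intro: prob_space_arrow_law\<close>)
  then have "w n = measure (distr (stack_law w) (arrow_law (w n)) (\<lambda>s. s n)) {1}"
    using w by (simp add: measure_arrow_law)
  also have "\<dots> = measure (stack_law w) ((\<lambda>s. s n) -` {1} \<inter> space (stack_law w))"
    unfolding stack_law_def by (rule measure_distr[OF measurable_component_singleton]) (use n in auto)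
  also have "(\<lambda>s. s n) -` {1} \<inter> space (stack_law w) = {s \<in> space stack_space. s n = 1}"
    by (auto simp: space_stack_law)
  finally show ?thesis by simp
qed

locale bounded_environment = iid_environment P for P :: "cookie_env measure" +
  fixes M :: nat
  assumes bounded: "AE \<omega> in P. \<forall>x. \<forall>n>M. \<omega> (x, n) = 1 / 2"
    and elliptic: "WEL P"
begin

lemma cookie_range: "\<omega> \<in> space P \<Longrightarrow> n \<ge> 1 \<Longrightarrow> 0 \<le> \<omega> (x, n) \<and> \<omega> (x, n) \<le> 1"
proof -
  assume \<omega>: "\<omega> \<in> space P" and n: "n \<ge> 1"
  have "\<omega> \<in> space cookie_space" using \<omega> sets_eq_imp_space_eq[OF sets_P] by simp
  then have "\<omega> (x, n) \<in> space unit_borel"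
    unfolding cookie_space_def space_PiM by (rule PiE_mem) (use n in simp)
  then show ?thesis by (simp add: space_restrict_space)
qed

lemma cookie_rv [measurable]: "n \<ge> 1 \<Longrightarrow> (\<lambda>\<omega>. \<omega> (x, n)) \<in> borel_measurable P"
proof -
  assume n: "n \<ge> 1"
  have "(\<lambda>\<omega>. \<omega> (x, n)) \<in> measurable cookie_space unit_borel"
    unfolding cookie_space_def by (rule measurable_component_singleton) (use n in simp)
  then have "(\<lambda>\<omega>. \<omega> (x, n)) \<in> measurable P unit_borel"
    using measurable_cong_sets[OF sets_P refl] by blast
  from measurable_restrict_space2_iff[THEN iffD1, OF this] show ?thesis by simp
qed

lemma cookie_stack_apply: "n \<ge> 1 \<Longrightarrow> cookie_stack x \<omega> n = \<omega> (x, n)"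
  by (simp add: cookie_stack_def)

lemma
  assumes B: "B \<in> sets stack_space"
  shows integrable_stack_law: "integrable P (\<lambda>\<omega>. measure (stack_law (cookie_stack x \<omega>)) B)"
    and annealed_prob_stack: "ann.prob {a \<in> space (annealed P). arrow_stack x a \<in> B} =
      (\<integral>\<omega>. measure (stack_law (cookie_stack x \<omega>)) B \<partial>P)"
proof -
  interpret S: prob_space "stack_law w" for w by (rule prob_space_stack_law)
  have m: "(\<lambda>\<omega>. measure (stack_law (cookie_stack x \<omega>)) B) \<in> borel_measurable P"
    unfolding measure_def using stack_law_rv[OF B] by measurable
  then show *: "integrable P (\<lambda>\<omega>. measure (stack_law (cookie_stack x \<omega>)) B)"
    by (intro integrable_const_bound[of _ 1]) (auto simp: S.prob_le_1)
  have "ennreal (ann.prob (arrow_stack x -` B \<inter> space (annealed P))) =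
      (\<integral>\<^sup>+\<omega>. ennreal (measure (stack_law (cookie_stack x \<omega>)) B) \<partial>P)"
    using emeasure_annealed_stack[OF B, of x] by (simp add: ann.emeasure_eq_measure S.emeasure_eq_measure)
  also have "\<dots> = ennreal (\<integral>\<omega>. measure (stack_law (cookie_stack x \<omega>)) B \<partial>P)"
    by (rule nn_integral_eq_integral[OF *]) auto
  finally have "ann.prob (arrow_stack x -` B \<inter> space (annealed P)) = (\<integral>\<omega>. measure (stack_law (cookie_stack x \<omega>)) B \<partial>P)"
    by (simp add: integral_nonneg_AE)
  moreover have "arrow_stack x -` B \<inter> space (annealed P) = {a \<in> space (annealed P). arrow_stack x a \<in> B}" by auto
  ultimately show "ann.prob {a \<in> space (annealed P). arrow_stack x a \<in> B} =
      (\<integral>\<omega>. measure (stack_law (cookie_stack x \<omega>)) B \<partial>P)" by simp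
qed

lemma arrow_stack_in_space: "a \<in> space (annealed P) \<Longrightarrow> arrow_stack x a \<in> space stack_space"
  using measurable_space[OF arrow_stack_rv] .

lemma stack_space_values: "s \<in> space stack_space \<Longrightarrow> n \<ge> 1 \<Longrightarrow> s n = 1 \<or> s n = -1"
proof -
  assume s: "s \<in> space stack_space" and n: "n \<ge> 1"
  from s have "s n \<in> space arrows" unfolding stack_space_def space_PiM by (rule PiE_mem) (use n in simp)
  then show ?thesis by auto
qed

text \<open>The law of the number of right arrows among the first \<open>t\<close> arrows of a stack. For \<open>t = M\<close> these are
  the weights of the mixture of negative binomial laws below.\<close>

definition rights_prob :: "nat \<Rightarrow> nat \<Rightarrow> real" where
  "rights_prob t i = ann.prob {a \<in> space (annealed P). rights (arrow_stack 0 a) t = i}"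

lemma rights_prob_nonneg: "0 \<le> rights_prob t i"
  by (simp add: rights_prob_def)

lemma rights_event_sets [measurable]: "{s \<in> space stack_space. rights s t = i} \<in> sets stack_space"
  by measurable

lemma rights_next_sets:
  "{s \<in> space stack_space. rights s t = i \<and> s (Suc t) = x} \<in> sets stack_space"
proof -
  note [measurable] = component_measurable[of "Suc t", simplified]
  show ?thesis by measurable
qed

lemma rights_prob_eq:
  "rights_prob t i = (\<integral>\<omega>. measure (stack_law (cookie_stack 0 \<omega>)) {s \<in> space stack_space. rights s t = i} \<partial>P)"
  unfolding rights_prob_def annealed_prob_stack[OF rights_event_sets, symmetric]
  by (rule arg_cong[where f = ann.prob]) (auto simp: arrow_stack_in_space)

lemma fair_next:
  assumes t: "t \<ge> M" and x: "x = 1 \<or> x = -1"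
  shows "ann.prob {a \<in> space (annealed P). rights (arrow_stack 0 a) t = i \<and> arrow_stack 0 a (Suc t) = x} = rights_prob t i / 2"
proof -
  have "{a \<in> space (annealed P). rights (arrow_stack 0 a) t = i \<and> arrow_stack 0 a (Suc t) = x} =
      {a \<in> space (annealed P). arrow_stack 0 a \<in> {s \<in> space stack_space. rights s t = i \<and> s (Suc t) = x}}"
    by (auto simp: arrow_stack_in_space)
  then have "ann.prob {a \<in> space (annealed P). rights (arrow_stack 0 a) t = i \<and> arrow_stack 0 a (Suc t) = x} =
     (\<integral>\<omega>. measure (stack_law (cookie_stack 0 \<omega>)) {s \<in> space stack_space. rights s t = i \<and> s (Suc t) = x} \<partial>P)"
    by (simp only: annealed_prob_stack[OF rights_next_sets])
  also have "\<dots> = (\<integral>\<omega>. measure (stack_law (cookie_stack 0 \<omega>)) {s \<in> space stack_space. rights s t = i} / 2 \<partial>P)"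
  proof (rule integral_cong_AE)
    show "AE \<omega> in P. measure (stack_law (cookie_stack 0 \<omega>)) {s \<in> space stack_space. rights s t = i \<and> s (Suc t) = x} =
      measure (stack_law (cookie_stack 0 \<omega>)) {s \<in> space stack_space. rights s t = i} / 2"
      using bounded
    proof eventually_elim
      case (elim \<omega>)
      then have "cookie_stack 0 \<omega> (Suc t) = 1 / 2" using t by (simp add: cookie_stack_apply)
      with stack_law_next[of "cookie_stack 0 \<omega>" t i] x show ?case by auto
    qed
  qed (auto intro!: borel_measurable_integrable integrable_stack_law rights_next_sets rights_event_sets)
  also have "\<dots> = rights_prob t i / 2" by (simp add: rights_prob_eq)
  finally show ?thesis .
qed

lemma rights_next_event [measurable]:
  "{a \<in> space (annealed P). rights (arrow_stack 0 a) t = i \<and> arrow_stack 0 a (Suc t) = x} \<in> ann.events"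
  using measurable_sets[OF arrow_stack_rv rights_next_sets, of 0 t i x]
  by (rule back_subst[of "\<lambda>A. A \<in> ann.events"]) (auto simp: arrow_stack_in_space)

lemma rights_prob_Suc:
  assumes t: "t \<ge> M"
  shows "rights_prob (Suc t) i = ((if i = 0 then 0 else rights_prob t (i - 1)) + rights_prob t i) / 2"
proof -
  let ?E = "\<lambda>i x. {a \<in> space (annealed P). rights (arrow_stack 0 a) t = i \<and> arrow_stack 0 a (Suc t) = x}"
  have "{a \<in> space (annealed P). rights (arrow_stack 0 a) (Suc t) = i} =
      (if i = 0 then {} else ?E (i - 1) 1) \<union> ?E i (-1)"
    using stack_space_values[OF arrow_stack_in_space, of _ "Suc t" 0] by (fastforce simp: rights_Suc split: if_splits)
  then have "rights_prob (Suc t) i = ann.prob ((if i = 0 then {} else ?E (i - 1) 1) \<union> ?E i (-1))"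
    by (simp only: rights_prob_def)
  also have "\<dots> = ann.prob (if i = 0 then {} else ?E (i - 1) 1) + ann.prob (?E i (-1))"
    by (rule ann.finite_measure_Union) (auto simp: rights_next_event)
  finally show ?thesis by (simp add: fair_next[OF t] add_divide_distrib)
qed

lemma rights_prob_zero: "i > t \<Longrightarrow> rights_prob t i = 0"
proof -
  assume "i > t"
  then have "{a \<in> space (annealed P). rights (arrow_stack 0 a) t = i} = {}" using rights_le by (auto simp: not_le[symmetric])
  then show ?thesis unfolding rights_prob_def by (simp only: measure_empty)
qed

lemma rights_prob_sum: "(\<Sum>i\<le>t. rights_prob t i) = 1"
proof -
  have "(\<Sum>i\<le>t. rights_prob t i) = ann.prob (\<Union>i\<in>{..t}. {a \<in> space (annealed P). rights (arrow_stack 0 a) t = i})"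
    unfolding rights_prob_def
    by (rule ann.finite_measure_finite_Union[symmetric]) (auto simp: disjoint_family_on_def)
  also have "(\<Union>i\<in>{..t}. {a \<in> space (annealed P). rights (arrow_stack 0 a) t = i}) = space (annealed P)"
    using rights_le by auto
  finally show ?thesis by (simp add: ann.prob_space)
qed

text \<open>Beyond position \<open>M\<close> the coins are fair, so the number of right arrows grows by an independent
  binomial variable.\<close>

lemma rights_prob_add:
  "rights_prob (M + u) i = (\<Sum>r\<le>M. rights_prob M r * (if r \<le> i then real (u choose (i - r)) else 0) / 2 ^ u)"
proof (induction u arbitrary: i)
  case 0
  have "(\<Sum>r\<le>M. rights_prob M r * (if r \<le> i then real (0 choose (i - r)) else 0) / 2 ^ 0) =
      (\<Sum>r\<in>{..M}. if r = i then rights_prob M r else 0)"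
    by (intro sum.cong refl) (auto simp: binomial_eq_0)
  then show ?case by (simp add: rights_prob_zero)
next
  case (Suc u)
  let ?c = "\<lambda>u i r. if r \<le> i then real (u choose (i - r)) else 0"
  have c: "?c (Suc u) i r = (if i = 0 then 0 else ?c u (i - 1) r) + ?c u i r" for r
  proof (cases "i - r")
    case 0
    then show ?thesis by (cases "r = i") (auto simp: binomial_eq_0)
  next
    case (Suc d)
    then have "r \<le> i" "i \<noteq> 0" "r \<le> i - 1" "i - 1 - r = d" by auto
    then show ?thesis using Suc by simp
  qed
  have "rights_prob (M + Suc u) i = ((if i = 0 then 0 else rights_prob (M + u) (i - 1)) + rights_prob (M + u) i) / 2"
    using rights_prob_Suc[of "M + u" i] by simp
  also have "\<dots> = (\<Sum>r\<le>M. rights_prob M r * ((if i = 0 then 0 else ?c u (i - 1) r) + ?c u i r) / 2 ^ Suc u)"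
    unfolding Suc.IH by (cases "i = 0") (simp_all add: sum.distrib[symmetric] sum_divide_distrib field_simps)
  finally show ?case unfolding c .
qed

text \<open>The event that exactly \<open>j\<close> left arrows precede right arrow number \<open>m + 1\<close>, expressed by the arrow at
  position \<open>m + j + 1\<close> and the number of right arrows before it.\<close>

definition hit_event :: "nat \<Rightarrow> nat \<Rightarrow> arrow_env set" where
  "hit_event m j = {a \<in> space (annealed P). rights (arrow_stack 0 a) (m + j) = m \<and> arrow_stack 0 a (Suc (m + j)) = 1}"

lemma hit_event_sets [measurable]: "hit_event m j \<in> ann.events"
  unfolding hit_event_def by measurable

lemma hit_event_fails: "a \<in> hit_event m j \<Longrightarrow> fails (arrow_stack 0 a) (Suc m) = j"
  unfolding hit_event_def by (auto intro: fails_Suc_eq)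

lemma hit_event_disjoint: "disjoint_family (hit_event m)"
  unfolding disjoint_family_on_def using hit_event_fails by blast

text \<open>If \<open>r\<close> of the first \<open>M\<close> arrows point to the right, then \<open>M - r\<close> failures are already there, and the
  remaining \<open>m + 1 - r\<close> successes come from fair coins.\<close>

lemma prob_hit_event:
  assumes m: "m \<ge> M"
  shows "ann.prob (hit_event m j) =
    (\<Sum>r\<le>M. rights_prob M r * (if M - r \<le> j then negbin (m - r) (j - (M - r)) else 0))"
proof -
  have "ann.prob (hit_event m j) = rights_prob (m + j) m / 2"
    unfolding hit_event_def by (rule fair_next) (use m in auto)
  also have "m + j = M + (m + j - M)" using m by simp
  also have "rights_prob (M + (m + j - M)) m / 2 =
    (\<Sum>r\<le>M. rights_prob M r * (if r \<le> m then real ((m + j - M) choose (m - r)) else 0) / 2 ^ Suc (m + j - M))"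
    unfolding rights_prob_add by (simp add: sum_divide_distrib mult_ac)
  also have "\<dots> = (\<Sum>r\<le>M. rights_prob M r * (if M - r \<le> j then negbin (m - r) (j - (M - r)) else 0))"
  proof (rule sum.cong[OF refl])
    fix r assume r: "r \<in> {..M}"
    show "rights_prob M r * (if r \<le> m then real ((m + j - M) choose (m - r)) else 0) / 2 ^ Suc (m + j - M) =
      rights_prob M r * (if M - r \<le> j then negbin (m - r) (j - (M - r)) else 0)"
    proof (cases "M - r \<le> j")
      case True
      then have "m - r + (j - (M - r)) = m + j - M" using r m by auto
      then show ?thesis using True r m by (simp add: negbin_def)
    next
      case False
      then have "m + j - M < m - r" using r m by auto
      then show ?thesis using False by (simp add: binomial_eq_0)
    qed
  qed
  finally show ?thesis .
qed

lemma hit_event_sums: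
  assumes m: "m \<ge> M"
    and s: "\<And>r. r \<le> M \<Longrightarrow> (\<lambda>i. negbin (m - r) i * g (i + (M - r))) sums \<sigma> r"
  shows "(\<lambda>j. ann.prob (hit_event m j) * g j) sums (\<Sum>r\<le>M. rights_prob M r * \<sigma> r)"
proof -
  have "(\<lambda>j. \<Sum>r\<le>M. rights_prob M r * ((if M - r \<le> j then negbin (m - r) (j - (M - r)) else 0) * g j)) sums
      (\<Sum>r\<le>M. rights_prob M r * \<sigma> r)"
  proof (intro sums_sum sums_mult)
    fix r assume "r \<in> {..M}"
    let ?f = "\<lambda>j. (if M - r \<le> j then negbin (m - r) (j - (M - r)) else 0) * g j"
    have "?f (i + (M - r)) = negbin (m - r) i * g (i + (M - r))" for i
      by (simp del: add_diff_assoc add_diff_assoc2)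
    then have "(\<lambda>i. ?f (i + (M - r))) sums \<sigma> r" using s[of r] \<open>r \<in> {..M}\<close> by (simp only: atMost_iff)
    moreover have "(\<Sum>i<M - r. ?f i) = 0" by (intro sum.neutral) auto
    ultimately show "?f sums \<sigma> r" using sums_iff_shift[of ?f "M - r" "\<sigma> r"] by simp
  qed
  then show ?thesis unfolding prob_hit_event[OF m] by (simp add: sum_distrib_left mult_ac)
qed

text \<open>The probabilities of these disjoint events add up to one because those of the negative binomial
  laws do. This is also why a stack almost surely contains infinitely many right arrows.\<close>

lemma hit_event_AE:
  assumes m: "m \<ge> M"
  shows "AE a in annealed P. a \<in> (\<Union>j. hit_event m j)"
proof -
  have "(\<lambda>j. ann.prob (hit_event m j)) sums (\<Sum>r\<le>M. rights_prob M r * 1)"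
    using hit_event_sums[OF m, of "\<lambda>_. 1" "\<lambda>_. 1"] negbin_sums by simp
  moreover have "(\<lambda>j. ann.prob (hit_event m j)) sums ann.prob (\<Union>j. hit_event m j)"
    by (rule ann.finite_measure_UNION) (use hit_event_disjoint in auto)
  ultimately have "ann.prob (\<Union>j. hit_event m j) = 1"
    using rights_prob_sum sums_unique2 by fastforce
  then show ?thesis by (intro ann.AE_prob_1)
qed

lemma rights_unbounded_AE_0: "AE a in annealed P. \<forall>m. \<exists>t. m \<le> rights (arrow_stack 0 a) t"
proof -
  have "AE a in annealed P. \<forall>m. a \<in> (\<Union>j. hit_event (M + m) j)"
    using hit_event_AE by (simp add: AE_all_countable)
  then show ?thesis
  proof eventually_elim
    case (elim a)
    show ?case
    proof
      fix m
      from elim obtain j where "a \<in> hit_event (M + m) j" by blast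
      then have "m \<le> rights (arrow_stack 0 a) (M + m + j)" by (auto simp: hit_event_def)
      then show "\<exists>t. m \<le> rights (arrow_stack 0 a) t" ..
    qed
  qed
qed

lemma nn_integral_fails:
  assumes m: "m \<ge> M" and g: "\<And>j. 0 \<le> g j"
    and s: "\<And>r. r \<le> M \<Longrightarrow> (\<lambda>i. negbin (m - r) i * g (i + (M - r))) sums \<sigma> r"
  shows "(\<integral>\<^sup>+a. ennreal (g (fails (arrow_stack 0 a) (Suc m))) \<partial>annealed P) = ennreal (\<Sum>r\<le>M. rights_prob M r * \<sigma> r)"
proof -
  have "(\<integral>\<^sup>+a. ennreal (g (fails (arrow_stack 0 a) (Suc m))) \<partial>annealed P) =
      (\<integral>\<^sup>+a. (\<Sum>j. ennreal (g j) * indicator (hit_event m j) a) \<partial>annealed P)"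
  proof (rule nn_integral_cong_AE)
    show "AE a in annealed P. ennreal (g (fails (arrow_stack 0 a) (Suc m))) = (\<Sum>j. ennreal (g j) * indicator (hit_event m j) a)"
      using hit_event_AE[OF m]
    proof eventually_elim
      case (elim a)
      then obtain j where j: "a \<in> hit_event m j" by blast
      then have "(\<Sum>j. ennreal (g j) * indicator (hit_event m j) a) = (\<Sum>i\<in>{j}. ennreal (g i) * indicator (hit_event m i) a)"
        by (intro suminf_finite) (auto dest: hit_event_fails simp: indicator_def)
      with j show ?case by (simp add: hit_event_fails)
    qed
  qed
  also have "\<dots> = (\<Sum>j. \<integral>\<^sup>+a. ennreal (g j) * indicator (hit_event m j) a \<partial>annealed P)"
    by (rule nn_integral_suminf) auto
  also have "\<dots> = (\<Sum>j. ennreal (ann.prob (hit_event m j) * g j))"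
    by (simp add: nn_integral_cmult_indicator ann.emeasure_eq_measure g ennreal_mult' mult.commute)
  also have "\<dots> = ennreal (\<Sum>j. ann.prob (hit_event m j) * g j)"
    using hit_event_sums[of m g \<sigma>] m s g by (intro suminf_ennreal2) (auto simp: sums_iff)
  also have "(\<Sum>j. ann.prob (hit_event m j) * g j) = (\<Sum>r\<le>M. rights_prob M r * \<sigma> r)"
    using hit_event_sums[OF m, of g \<sigma>, OF s] by (simp add: sums_iff)
  finally show ?thesis .
qed

section \<open>Moments and positivity of the offspring\<close>

lemma prob_right_arrow:
  assumes n: "n \<ge> 1"
  shows "ann.prob {a \<in> space (annealed P). arrow_stack 0 a n = 1} = (\<integral>\<omega>. \<omega> (0, n) \<partial>P)"
proof -
  have B: "{s \<in> space stack_space. s n = 1} \<in> sets stack_space"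
  proof -
    note [measurable] = component_measurable[OF n]
    show ?thesis by measurable
  qed
  have "{a \<in> space (annealed P). arrow_stack 0 a n = 1} =
      {a \<in> space (annealed P). arrow_stack 0 a \<in> {s \<in> space stack_space. s n = 1}}"
    by (auto simp: arrow_stack_in_space)
  then have "ann.prob {a \<in> space (annealed P). arrow_stack 0 a n = 1} =
      (\<integral>\<omega>. measure (stack_law (cookie_stack 0 \<omega>)) {s \<in> space stack_space. s n = 1} \<partial>P)"
    by (simp only: annealed_prob_stack[OF B])
  also have "\<dots> = (\<integral>\<omega>. \<omega> (0, n) \<partial>P)"
    by (intro Bochner_Integration.integral_cong refl)
      (use n cookie_range in \<open>simp add: stack_law_marginal cookie_stack_apply\<close>)
  finally show ?thesis .
qed

lemma integrable_cookie: "n \<ge> 1 \<Longrightarrow> integrable P (\<lambda>\<omega>. \<omega> (x, n))"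
  by (rule integrable_const_bound[of _ 1]) (use cookie_range in \<open>auto intro!: AE_I2\<close>)

lemma right_arrow_event [measurable]:
  assumes "n \<ge> 1"
  shows "{a \<in> space (annealed P). arrow_stack 0 a n = 1} \<in> ann.events"
proof -
  note [measurable] = component_measurable[OF assms]
  show ?thesis by measurable
qed

lemma mean_rights: "(\<Sum>i\<le>t. rights_prob t i * real i) = (\<Sum>n=1..t. \<integral>\<omega>. \<omega> (0, n) \<partial>P)"
proof -
  have "(\<Sum>i\<le>t. rights_prob t i * real i) =
      (\<Sum>i\<le>t. \<integral>a. real i * indicator {a \<in> space (annealed P). rights (arrow_stack 0 a) t = i} a \<partial>annealed P)"
    unfolding rights_prob_def by (simp add: mult.commute)
  also have "\<dots> = (\<integral>a. (\<Sum>i\<le>t. real i * indicator {a \<in> space (annealed P). rights (arrow_stack 0 a) t = i} a) \<partial>annealed P)"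
    by (rule Bochner_Integration.integral_sum[symmetric])
      (intro integrable_mult_right integrable_real_indicator; simp add: less_top[symmetric])
  also have "\<dots> = (\<integral>a. (\<Sum>n=1..t. indicator {a \<in> space (annealed P). arrow_stack 0 a n = 1} a) \<partial>annealed P)"
  proof (rule Bochner_Integration.integral_cong[OF refl])
    fix a assume a: "a \<in> space (annealed P)"
    have "(\<Sum>i\<le>t. real i * indicator {a \<in> space (annealed P). rights (arrow_stack 0 a) t = i} a) =
        (\<Sum>i\<in>{..t}. if i = rights (arrow_stack 0 a) t then real i else 0)"
      using a by (intro sum.cong) (auto simp: indicator_def)
    also have "\<dots> = real (rights (arrow_stack 0 a) t)"
      using rights_le[of "arrow_stack 0 a" t] by simp
    also have "\<dots> = (\<Sum>n=1..t. if arrow_stack 0 a n = 1 then 1 else 0)"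
      unfolding rights_def by (simp add: sum.If_cases Int_def)
    also have "\<dots> = (\<Sum>n=1..t. indicator {a \<in> space (annealed P). arrow_stack 0 a n = 1} a)"
      using a by (intro sum.cong) (auto simp: indicator_def)
    finally show "(\<Sum>i\<le>t. real i * indicator {a \<in> space (annealed P). rights (arrow_stack 0 a) t = i} a) =
        (\<Sum>n=1..t. indicator {a \<in> space (annealed P). arrow_stack 0 a n = 1} a :: real)" .
  qed
  also have "\<dots> = (\<Sum>n=1..t. \<integral>a. indicator {a \<in> space (annealed P). arrow_stack 0 a n = 1} a \<partial>annealed P)"
    by (rule Bochner_Integration.integral_sum)
      (intro integrable_real_indicator; simp add: less_top[symmetric] right_arrow_event)
  also have "\<dots> = (\<Sum>n=1..t. \<integral>\<omega>. \<omega> (0, n) \<partial>P)"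
    by (intro sum.cong refl) (simp add: prob_right_arrow right_arrow_event)
  finally show ?thesis .
qed

text \<open>Fair cookies do not contribute, so only the surplus of right arrows among the first \<open>M\<close> arrows counts.\<close>

lemma total_drift_eq: "total_drift P = (\<Sum>r\<le>M. rights_prob M r * (2 * real r - real M))"
proof -
  have "total_drift P = (\<integral>\<omega>. (\<Sum>i<M. 2 * \<omega> (0, Suc i) - 1) \<partial>P)"
    unfolding total_drift_def
  proof (rule integral_cong_AE)
    show "AE \<omega> in P. (\<Sum>i. 2 * \<omega> (0, Suc i) - 1) = (\<Sum>i<M. 2 * \<omega> (0, Suc i) - 1)"
      using bounded
    proof eventually_elim
      case (elim \<omega>)
      then have "\<omega> (0, Suc i) = 1 / 2" if "i \<notin> {..<M}" for i using that by auto
      then show ?case by (intro suminf_finite) (simp_all add: mult.commute)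
    qed
    have [measurable]: "(\<lambda>\<omega>. \<omega> (0, Suc i)) \<in> borel_measurable P" for i by (rule cookie_rv) simp
    show "(\<lambda>\<omega>. \<Sum>i. 2 * \<omega> (0, Suc i) - 1) \<in> borel_measurable P"
      "(\<lambda>\<omega>. \<Sum>i<M. 2 * \<omega> (0, Suc i) - 1) \<in> borel_measurable P" by measurable
  qed
  also have "\<dots> = (\<Sum>i<M. 2 * (\<integral>\<omega>. \<omega> (0, Suc i) \<partial>P) - 1)"
    by (subst Bochner_Integration.integral_sum) (simp_all add: integrable_cookie prob_space)
  also have "\<dots> = 2 * (\<Sum>n=1..M. \<integral>\<omega>. \<omega> (0, n) \<partial>P) - real M"
    by (simp add: sum_subtractf sum_distrib_left[symmetric] sum.atLeast1_atMost_eq)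
  also have "\<dots> = 2 * (\<Sum>r\<le>M. rights_prob M r * real r) - (\<Sum>r\<le>M. rights_prob M r) * real M"
    by (simp add: mean_rights rights_prob_sum)
  also have "\<dots> = (\<Sum>r\<le>M. rights_prob M r * (2 * real r - real M))"
    by (simp add: sum_distrib_left sum_distrib_right sum_subtractf[symmetric] algebra_simps)
  finally show ?thesis .
qed

text \<open>The transition operator of the chain of excursion numbers: \<open>m\<close> is the number of right moves from a
  site and \<open>g\<close> is applied to the number of left moves which they entail.\<close>

definition offspring :: "(nat \<Rightarrow> ennreal) \<Rightarrow> nat \<Rightarrow> ennreal" where
  "offspring g m = (\<integral>\<^sup>+a. g (fails (arrow_stack 0 a) m) \<partial>annealed P)"

lemma offspring_mean:
  assumes m: "m > M"
  shows "offspring (\<lambda>z. ennreal (real z)) m = ennreal (real m - total_drift P)"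
proof -
  obtain m' where m': "m = Suc m'" "m' \<ge> M" using m by (cases m) auto
  have "(\<lambda>i. negbin (m' - r) i * real (i + (M - r))) sums (real m - (2 * real r - real M))" if "r \<le> M" for r
  proof -
    have "(\<lambda>i. negbin (m' - r) i * real i + real (M - r) * negbin (m' - r) i) sums (real (Suc (m' - r)) + real (M - r) * 1)"
      by (intro sums_add sums_mult negbin_mean negbin_sums)
    moreover have "real (Suc (m' - r)) + real (M - r) * 1 = real m - (2 * real r - real M)"
      using that m' by (simp add: of_nat_diff)
    moreover have "negbin (m' - r) i * real i + real (M - r) * negbin (m' - r) i = negbin (m' - r) i * real (i + (M - r))" for i
      by (simp add: algebra_simps)
    ultimately show ?thesis by (simp only:)
  qed
  from nn_integral_fails[OF m'(2) _ this]
  have "offspring (\<lambda>z. ennreal (real z)) m = ennreal (\<Sum>r\<le>M. rights_prob M r * (real m - (2 * real r - real M)))"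
    by (simp add: offspring_def m'(1))
  also have "(\<Sum>r\<le>M. rights_prob M r * (real m - (2 * real r - real M))) = real m - total_drift P"
    unfolding total_drift_eq right_diff_distrib[of _ "real m"] sum_subtractf sum_distrib_right[symmetric] rights_prob_sum by simp
  finally show ?thesis .
qed

text \<open>The constant term of the second moment, so that its leading terms show the drift and the variance.\<close>

definition var_defect :: real where
  "var_defect = (\<Sum>r\<le>M. rights_prob M r * ((2 * real r - real M) ^ 2 - 2 * real r))"

lemma second_moment_sum:
  "(\<Sum>r\<le>M. rights_prob M r *
      (real m ^ 2 + 2 * real m - 2 * real m * (2 * real r - real M) + ((2 * real r - real M) ^ 2 - 2 * real r))) =
    real m ^ 2 + 2 * real m * (1 - total_drift P) + var_defect"
proof -
  have "(\<Sum>r\<le>M. rights_prob M r *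
      (real m ^ 2 + 2 * real m - 2 * real m * (2 * real r - real M) + ((2 * real r - real M) ^ 2 - 2 * real r))) =
      (\<Sum>r\<le>M. rights_prob M r) * (real m ^ 2 + 2 * real m)
        - 2 * real m * (\<Sum>r\<le>M. rights_prob M r * (2 * real r - real M)) + var_defect"
    unfolding var_defect_def sum_distrib_left sum_distrib_right sum_subtractf[symmetric] sum.distrib[symmetric]
    by (intro sum.cong refl) (simp add: algebra_simps)
  also have "\<dots> = real m ^ 2 + 2 * real m * (1 - total_drift P) + var_defect"
    unfolding total_drift_eq[symmetric] rights_prob_sum by (simp add: algebra_simps)
  finally show ?thesis .
qed

lemma offspring_second:
  assumes m: "m > M"
  shows "offspring (\<lambda>z. ennreal (real z ^ 2)) m =
    ennreal (real m ^ 2 + 2 * real m * (1 - total_drift P) + var_defect)"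
proof -
  obtain m' where m': "m = Suc m'" "m' \<ge> M" using m by (cases m) auto
  have "(\<lambda>i. negbin (m' - r) i * real (i + (M - r)) ^ 2) sums
      (real m ^ 2 + 2 * real m - 2 * real m * (2 * real r - real M) + ((2 * real r - real M) ^ 2 - 2 * real r))" if "r \<le> M" for r
  proof -
    define c where "c = real (M - r)"
    define N where "N = real (Suc (m' - r))"
    have "(\<lambda>i. negbin (m' - r) i * real i ^ 2 + 2 * c * (negbin (m' - r) i * real i) + c ^ 2 * negbin (m' - r) i) sums
        ((N ^ 2 + 2 * N) + 2 * c * N + c ^ 2 * 1)"
      unfolding N_def by (intro sums_add sums_mult negbin_second negbin_mean negbin_sums)
    moreover have "negbin (m' - r) i * real i ^ 2 + 2 * c * (negbin (m' - r) i * real i) + c ^ 2 * negbin (m' - r) i =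
        negbin (m' - r) i * real (i + (M - r)) ^ 2" for i
      by (simp add: c_def power2_eq_square algebra_simps)
    moreover have Nc: "N = real m - real r" "c = real M - real r"
      using that m' by (auto simp: N_def c_def of_nat_diff)
    have "(N ^ 2 + 2 * N) + 2 * c * N + c ^ 2 * 1 =
      real m ^ 2 + 2 * real m - 2 * real m * (2 * real r - real M) + ((2 * real r - real M) ^ 2 - 2 * real r)"
      unfolding Nc by (simp add: power2_eq_square algebra_simps)
    ultimately show ?thesis by (simp only:)
  qed
  from nn_integral_fails[OF m'(2) _ this]
  have "offspring (\<lambda>z. ennreal (real z ^ 2)) m = ennreal (\<Sum>r\<le>M. rights_prob M r *
      (real m ^ 2 + 2 * real m - 2 * real m * (2 * real r - real M) + ((2 * real r - real M) ^ 2 - 2 * real r)))"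
    by (simp add: offspring_def m'(1))
  then show ?thesis unfolding second_moment_sum .
qed

lemma second_moment_nonneg:
  assumes m: "m > M"
  shows "0 \<le> real m ^ 2 + 2 * real m * (1 - total_drift P) + var_defect"
  unfolding second_moment_sum[symmetric]
proof (intro sum_nonneg mult_nonneg_nonneg rights_prob_nonneg)
  fix r assume "r \<in> {..M}"
  then have "0 \<le> (real m - (2 * real r - real M)) ^ 2 + 2 * (real m - real r)" using m by simp
  also have "\<dots> = real m ^ 2 + 2 * real m - 2 * real m * (2 * real r - real M) + ((2 * real r - real M) ^ 2 - 2 * real r)"
    by (simp add: power2_eq_square algebra_simps)
  finally show "0 \<le> real m ^ 2 + 2 * real m - 2 * real m * (2 * real r - real M) + ((2 * real r - real M) ^ 2 - 2 * real r)" .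
qed

lemma offspring_third:
  obtains K where "K \<ge> 0" "\<And>m. m > M \<Longrightarrow>
    offspring (\<lambda>z. ennreal (real z ^ 3)) m \<le> ennreal (real m ^ 3 + K * real m ^ 2)"
proof -
  define K where "K = 12 + 9 * real M + 3 * real M ^ 2 + real M ^ 3"
  have "offspring (\<lambda>z. ennreal (real z ^ 3)) m \<le> ennreal (real m ^ 3 + K * real m ^ 2)" if m: "m > M" for m
  proof -
    obtain m' where m': "m = Suc m'" "m' \<ge> M" using m by (cases m) auto
    define \<sigma> where "\<sigma> r = (let N = real m - real r; c = real M - real r in
        (N ^ 3 + 6 * N ^ 2 + 6 * N) + 3 * c * (N ^ 2 + 2 * N) + 3 * c ^ 2 * N + c ^ 3 * 1)" for r
    have s: "(\<lambda>i. negbin (m' - r) i * real (i + (M - r)) ^ 3) sums \<sigma> r" if "r \<le> M" for r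
    proof -
      define c where "c = real (M - r)"
      define N where "N = real (Suc (m' - r))"
      have "(\<lambda>i. negbin (m' - r) i * real i ^ 3 + 3 * c * (negbin (m' - r) i * real i ^ 2) + 3 * c ^ 2 * (negbin (m' - r) i * real i)
            + c ^ 3 * negbin (m' - r) i) sums
          ((N ^ 3 + 6 * N ^ 2 + 6 * N) + 3 * c * (N ^ 2 + 2 * N) + 3 * c ^ 2 * N + c ^ 3 * 1)"
        unfolding N_def by (intro sums_add sums_mult negbin_third negbin_second negbin_mean negbin_sums)
      moreover have "negbin (m' - r) i * real i ^ 3 + 3 * c * (negbin (m' - r) i * real i ^ 2) + 3 * c ^ 2 * (negbin (m' - r) i * real i)
            + c ^ 3 * negbin (m' - r) i = negbin (m' - r) i * real (i + (M - r)) ^ 3" for i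
        by (simp add: c_def power2_eq_square power3_eq_cube algebra_simps)
      moreover have "N = real m - real r" "c = real M - real r"
        using that m' by (auto simp: N_def c_def of_nat_diff)
      ultimately show ?thesis by (simp only: \<sigma>_def Let_def)
    qed
    have le: "\<sigma> r \<le> real m ^ 3 + K * real m ^ 2" if "r \<le> M" for r
    proof -
      define N where "N = real m - real r"
      define c where "c = real M - real r"
      have N: "0 \<le> N" "N \<le> real m" and c: "0 \<le> c" "c \<le> real M" and m1: "1 \<le> real m"
        using that m by (auto simp: N_def c_def)
      have m2: "real m \<le> real m ^ 2" "1 \<le> real m ^ 2" using m1 by (auto simp: power2_eq_square mult_ge1_I)
      have "\<sigma> r = (N ^ 3 + 6 * N ^ 2 + 6 * N) + 3 * c * (N ^ 2 + 2 * N) + 3 * c ^ 2 * N + c ^ 3"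
        by (simp add: \<sigma>_def N_def c_def Let_def)
      also have "\<dots> \<le> (real m ^ 3 + 6 * real m ^ 2 + 6 * real m) + 3 * real M * (real m ^ 2 + 2 * real m)
          + 3 * real M ^ 2 * real m + real M ^ 3"
        using N c by (intro add_mono mult_mono power_mono) auto
      also have "\<dots> \<le> (real m ^ 3 + 6 * real m ^ 2 + 6 * real m ^ 2) + 3 * real M * (real m ^ 2 + 2 * real m ^ 2)
          + 3 * real M ^ 2 * real m ^ 2 + real M ^ 3 * real m ^ 2"
        using m2 mult_left_mono[OF m2(2), of "real M ^ 3"] by (intro add_mono mult_mono) auto
      also have "\<dots> = real m ^ 3 + K * real m ^ 2" by (simp add: K_def algebra_simps)
      finally show ?thesis .
    qed
    have "offspring (\<lambda>z. ennreal (real z ^ 3)) m = ennreal (\<Sum>r\<le>M. rights_prob M r * \<sigma> r)"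
      using nn_integral_fails[OF m'(2) _ s] by (simp add: offspring_def m'(1))
    also have "\<dots> \<le> ennreal (\<Sum>r\<le>M. rights_prob M r * (real m ^ 3 + K * real m ^ 2))"
      using le rights_prob_nonneg by (intro ennreal_leI sum_mono mult_left_mono) auto
    also have "\<dots> = ennreal (real m ^ 3 + K * real m ^ 2)"
      unfolding sum_distrib_right[symmetric] rights_prob_sum by simp
    finally show ?thesis .
  qed
  moreover have "K \<ge> 0" by (simp add: K_def)
  ultimately show ?thesis using that by blast
qed

lemma stack_law_all_right:
  assumes "\<And>n. n \<ge> 1 \<Longrightarrow> 0 \<le> w n \<and> w n \<le> 1"
  shows "measure (stack_law w) {s \<in> space stack_space. rights s t = t} = (\<Prod>n<t. w (Suc n))"
proof (induction t)
  case 0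
  interpret S: prob_space "stack_law w" by (rule prob_space_stack_law)
  show ?case using S.prob_space by (simp add: space_stack_law)
next
  case (Suc t)
  have "rights s t \<noteq> Suc t" for s using rights_le[of s t] by simp
  then have "{s \<in> space stack_space. rights s (Suc t) = Suc t} = {s \<in> space stack_space. rights s t = t \<and> s (Suc t) = 1}"
    by (auto simp: rights_Suc)
  then show ?case using stack_law_next(1)[of w t t] assms[of "Suc t"] Suc.IH by simp
qed

lemma stack_law_all_left:
  assumes "\<And>n. n \<ge> 1 \<Longrightarrow> 0 \<le> w n \<and> w n \<le> 1"
  shows "measure (stack_law w) {s \<in> space stack_space. rights s t = 0} = (\<Prod>n<t. 1 - w (Suc n))"
proof (induction t)
  case 0
  interpret S: prob_space "stack_law w" by (rule prob_space_stack_law)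
  show ?case using S.prob_space by (simp add: space_stack_law)
next
  case (Suc t)
  have "{s \<in> space stack_space. rights s (Suc t) = 0} = {s \<in> space stack_space. rights s t = 0 \<and> s (Suc t) = -1}"
    using stack_space_values[of _ "Suc t"] by (fastforce simp: rights_Suc)
  then show ?case using stack_law_next(2)[of w t 0] assms[of "Suc t"] Suc.IH by simp
qed

lemma integral_pos_of_event:
  fixes f :: "cookie_env \<Rightarrow> real"
  assumes f: "integrable P f" "\<And>\<omega>. \<omega> \<in> space P \<Longrightarrow> 0 \<le> f \<omega>"
    and Q: "\<P>(\<omega> in P. Q \<omega>) > 0" "\<And>\<omega>. \<omega> \<in> space P \<Longrightarrow> Q \<omega> \<Longrightarrow> f \<omega> > 0"
  shows "(\<integral>\<omega>. f \<omega> \<partial>P) > 0"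
proof (rule ccontr)
  assume "\<not> ?thesis"
  moreover have "(\<integral>\<omega>. f \<omega> \<partial>P) \<ge> 0" by (rule Bochner_Integration.integral_nonneg) (rule f(2))
  ultimately have "(\<integral>\<omega>. f \<omega> \<partial>P) = 0" by simp
  then have "AE \<omega> in P. f \<omega> = 0" using integral_nonneg_eq_0_iff_AE[OF f(1)] f(2) by (simp add: AE_I2)
  from this AE_space have "AE \<omega> in P. \<not> Q \<omega>"
  proof eventually_elim
    case (elim \<omega>)
    with Q(2)[of \<omega>] show ?case by auto
  qed
  then have "\<P>(\<omega> in P. Q \<omega>) = 0"
    by (rule prob_eq_0_AE)
  with Q(1) show False by simp
qed

lemma all_right_positive: "rights_prob t t > 0"
  unfolding rights_prob_eq
proof (rule integral_pos_of_event[where Q = "\<lambda>\<omega>. \<forall>n\<ge>1. \<omega> (0, n) > 0"])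
  show "integrable P (\<lambda>\<omega>. measure (stack_law (cookie_stack 0 \<omega>)) {s \<in> space stack_space. rights s t = t})"
    by (rule integrable_stack_law[OF rights_event_sets])
  show "\<P>(\<omega> in P. \<forall>n\<ge>1. \<omega> (0, n) > 0) > 0" using elliptic unfolding WEL_def by blast
  fix \<omega> assume "\<omega> \<in> space P" "\<forall>n\<ge>1. \<omega> (0, n) > 0"
  then show "measure (stack_law (cookie_stack 0 \<omega>)) {s \<in> space stack_space. rights s t = t} > 0"
    by (subst stack_law_all_right) (auto simp: cookie_stack_apply cookie_range intro!: prod_pos)
qed simp

lemma all_left_positive: "rights_prob t 0 > 0"
  unfolding rights_prob_eq
proof (rule integral_pos_of_event[where Q = "\<lambda>\<omega>. \<forall>n\<ge>1. \<omega> (0, n) < 1"])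
  show "integrable P (\<lambda>\<omega>. measure (stack_law (cookie_stack 0 \<omega>)) {s \<in> space stack_space. rights s t = 0})"
    by (rule integrable_stack_law[OF rights_event_sets])
  show "\<P>(\<omega> in P. \<forall>n\<ge>1. \<omega> (0, n) < 1) > 0" using elliptic unfolding WEL_def by blast
  fix \<omega> assume "\<omega> \<in> space P" "\<forall>n\<ge>1. \<omega> (0, n) < 1"
  then show "measure (stack_law (cookie_stack 0 \<omega>)) {s \<in> space stack_space. rights s t = 0} > 0"
    by (subst stack_law_all_left) (auto simp: cookie_stack_apply cookie_range intro!: prod_pos)
qed simp

lemma fails_event [measurable]: "{a \<in> space (annealed P). fails (arrow_stack x a) m = y} \<in> ann.events"
  by measurable

text \<open>A stack that starts with enough right arrows admits no left move; weak ellipticity gives this event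
  positive probability.\<close>

lemma extinction_positive:
  "\<exists>\<epsilon>>0. \<forall>z\<le>B. \<epsilon> \<le> ann.prob {a \<in> space (annealed P). fails (arrow_stack 0 a) z = 0}"
proof (intro exI conjI allI impI)
  show "rights_prob B B > 0" by (rule all_right_positive)
  fix z assume "z \<le> B"
  have "rights s z = z" if "rights s B = B" for s
    using rights_increment_le[OF \<open>z \<le> B\<close>, of s] rights_le[of s z] that \<open>z \<le> B\<close> by linarith
  then have "fails s z = 0" if "rights s B = B" for s
    using fails_le_lefts[of z s z] that by simp
  then have "{a \<in> space (annealed P). rights (arrow_stack 0 a) B = B} \<subseteq> {a \<in> space (annealed P). fails (arrow_stack 0 a) z = 0}"
    by blast
  then show "rights_prob B B \<le> ann.prob {a \<in> space (annealed P). fails (arrow_stack 0 a) z = 0}"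
    unfolding rights_prob_def by (rule ann.finite_measure_mono) (rule fails_event)
qed

text \<open>A stack that starts with \<open>R\<close> left arrows forces at least \<open>R\<close> left moves as soon as one right move has
  to be made, hence some value of at least \<open>R\<close> has positive probability.\<close>

lemma large_jump_positive:
  assumes m: "m \<ge> 1"
  shows "\<exists>y\<ge>R. ann.prob {a \<in> space (annealed P). fails (arrow_stack 0 a) m = y} > 0"
proof (rule ccontr)
  let ?E = "\<lambda>y. {a \<in> space (annealed P). fails (arrow_stack 0 a) m = y}"
  assume contra: "\<not> ?thesis"
  have "ann.prob (?E y) = 0" if "y \<ge> R" for y
  proof -
    have "\<not> 0 < ann.prob (?E y)" using contra that by blast
    moreover have "0 \<le> ann.prob (?E y)" by (rule measure_nonneg)
    ultimately show ?thesis by linarith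
  qed
  then have "AE a in annealed P. y \<ge> R \<longrightarrow> fails (arrow_stack 0 a) m \<noteq> y" for y
    using ann.prob_eq_0[OF fails_event, of 0 m y] by (cases "y \<ge> R") simp_all
  then have "AE a in annealed P. \<forall>y. y \<ge> R \<longrightarrow> fails (arrow_stack 0 a) m \<noteq> y"
    unfolding AE_all_countable by (intro allI)
  moreover note rights_unbounded_AE_0
  ultimately have "AE a in annealed P. \<not> rights (arrow_stack 0 a) R = 0"
  proof eventually_elim
    case (elim a)
    let ?s = "arrow_stack 0 a"
    have "fails ?s m < R" using elim(1)[rule_format, of "fails ?s m"] by (cases "R \<le> fails ?s m") auto
    show ?case
    proof
      assume z: "rights ?s R = 0"
      have h: "rights ?s (m + fails ?s m) = m" using elim(2) by (intro rights_fails) blast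
      show False
      proof (cases "R \<le> m + fails ?s m")
        case True
        from rights_increment_le[OF True, of ?s] z h \<open>fails ?s m < R\<close> True show False by linarith
      next
        case False
        then have "rights ?s (m + fails ?s m) \<le> rights ?s R" by (intro rights_mono) simp
        with z h m show False by simp
      qed
    qed
  qed
  then have "rights_prob R 0 = 0"
    unfolding rights_prob_def by (intro ann.prob_eq_0_AE)
  with all_left_positive[of R] show False by simp
qed

section \<open>The Markov property of the excursion numbers\<close>

lemma fails_arrow_stack: "fails (arrow_stack x a) m = fails (stack a x) m"
  by (rule fails_cong) (simp add: arrow_stack_def)

lemma nn_integral_arrow_stack:
  assumes "h \<in> borel_measurable stack_space"
  shows "(\<integral>\<^sup>+a. h (arrow_stack x a) \<partial>annealed P) = (\<integral>\<^sup>+a. h (arrow_stack 0 a) \<partial>annealed P)"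
proof -
  have "(\<integral>\<^sup>+a. h (arrow_stack x a) \<partial>annealed P) = (\<integral>\<^sup>+s. h s \<partial>distr (annealed P) stack_space (arrow_stack x))" for x
    using assms by (subst nn_integral_distr[OF arrow_stack_rv]) simp_all
  from this[of x] this[of 0] show ?thesis unfolding distr_arrow_stack[of x] by (rule trans[OF _ sym])
qed

lemma AE_arrow_stack:
  assumes "Measurable.pred stack_space Q" "AE a in annealed P. Q (arrow_stack 0 a)"
  shows "AE a in annealed P. Q (arrow_stack x a)"
proof -
  have "(AE s in distr (annealed P) stack_space (arrow_stack x). Q s) \<longleftrightarrow> (AE a in annealed P. Q (arrow_stack x a))" for x
    by (rule AE_distr_iff[OF arrow_stack_rv]) (use assms(1) in simp)
  from this[of x] this[of 0] assms(2) show ?thesis unfolding distr_arrow_stack[of x] by blast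
qed

lemma rights_unbounded_AE: "AE a in annealed P. \<forall>x m. \<exists>t. m \<le> rights (stack a x) t"
proof -
  have "AE a in annealed P. \<forall>m. \<exists>t. m \<le> rights (arrow_stack x a) t" for x
    by (rule AE_arrow_stack[OF _ rights_unbounded_AE_0]) measurable
  moreover have "rights (arrow_stack x a) t = rights (stack a x) t" for x a t
    by (rule rights_cong) (simp add: arrow_stack_def)
  ultimately show ?thesis by (simp add: AE_all_countable)
qed

lemma proper_AE: "AE a in annealed P. proper a"
proof (rule AE_I2)
  fix a assume a: "a \<in> space (annealed P)"
  show "proper a" unfolding proper_def
  proof (intro allI impI)
    fix x n assume n: "(n::nat) \<ge> 1"
    have "a (x, n) \<in> space arrows"
      using a unfolding space_annealed space_PiM by (rule PiE_mem) (use n in simp)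
    then show "a (x, n) = 1 \<or> a (x, n) = -1" by auto
  qed
qed

text \<open>Rebuilds an environment from its stacks, so that excursion numbers become functions of a restricted
  family of stacks.\<close>

abbreviation unstack :: "(int \<Rightarrow> nat \<Rightarrow> int) \<Rightarrow> arrow_env" where
  "unstack \<sigma> \<equiv> \<lambda>(x, n). \<sigma> x n"

lemma excursions_stacks:
  assumes "\<And>j. j < i \<Longrightarrow> int n - 1 - int j \<in> A"
  shows "excursions k a n i = excursions k (unstack (\<lambda>x\<in>A. arrow_stack x a)) n i"
  using assms
proof (induction i)
  case (Suc i)
  then have "int n - 1 - int i \<in> A" by auto
  then have "stack (unstack (\<lambda>x\<in>A. arrow_stack x a)) (int n - 1 - int i) = arrow_stack (int n - 1 - int i) a"
    by (simp only: case_prod_conv restrict_apply')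
  then have "fails (stack a (int n - 1 - int i)) m = fails (stack (unstack (\<lambda>x\<in>A. arrow_stack x a)) (int n - 1 - int i)) m" for m
    by (simp only: fails_arrow_stack)
  then show ?case using Suc by simp
qed simp

lemma excursions_measurable:
  assumes "\<And>j. j < i \<Longrightarrow> int n - 1 - int j \<in> A"
  shows "(\<lambda>\<sigma>. excursions k (unstack \<sigma>) n i) \<in> measurable (PiM A (\<lambda>_. stack_space)) (count_space UNIV)"
  using assms
proof (induction i)
  case (Suc i)
  then have x: "int n - 1 - int i \<in> A" and [measurable]: "(\<lambda>\<sigma>. excursions k (unstack \<sigma>) n i) \<in> measurable (PiM A (\<lambda>_. stack_space)) (count_space UNIV)"
    by auto
  have "(\<lambda>\<sigma>. fails (\<sigma> (int n - 1 - int i)) m) \<in> measurable (PiM A (\<lambda>_. stack_space)) (count_space UNIV)" for m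
    using measurable_compose[OF measurable_component_singleton[OF x] fails_measurable] .
  from measurable_compose_countable[of "\<lambda>m \<sigma>. fails (\<sigma> (int n - 1 - int i)) m", OF this,
      of "\<lambda>\<sigma>. (if i < n then k else 0) + excursions k (unstack \<sigma>) n i"]
  show ?case by simp
qed simp

lemma excursions_rv [measurable]: "(\<lambda>a. excursions k a n i) \<in> measurable (annealed P) (count_space UNIV)"
proof -
  have "(\<lambda>a. \<lambda>x\<in>UNIV. arrow_stack x a) \<in> measurable (annealed P) (PiM UNIV (\<lambda>_. stack_space))"
    by (intro measurable_restrict arrow_stack_rv)
  from measurable_compose[OF this excursions_measurable[of i n UNIV k]]
  have "(\<lambda>a. excursions k (unstack (\<lambda>x\<in>UNIV. arrow_stack x a)) n i) \<in> measurable (annealed P) (count_space UNIV)"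
    by blast
  moreover have "(\<lambda>a. excursions k (unstack (\<lambda>x\<in>UNIV. arrow_stack x a)) n i) = (\<lambda>a. excursions k a n i)"
    by (rule ext, rule excursions_stacks[symmetric]) simp
  ultimately show ?thesis by (simp only:)
qed

lemma case_bool_same: "case_bool c c = (\<lambda>_. c)"
  by (simp add: fun_eq_iff split: bool.split)

text \<open>The first \<open>i\<close> excursion numbers depend only on sites to the right of \<open>n - 1 - i\<close>, whose stacks
  are independent of the stack at \<open>n - 1 - i\<close>.\<close>

lemma excursions_indep:
  fixes g :: "nat \<Rightarrow> ennreal"
  shows "(\<integral>\<^sup>+a. indicator {z} (excursions k a n i) * g (fails (arrow_stack (int n - 1 - int i) a) m) \<partial>annealed P) =
    (\<integral>\<^sup>+a. indicator {z} (excursions k a n i) \<partial>annealed P) * offspring g m"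
proof -
  define A where "A = {x. int n - 1 - int i < x}"
  define y where "y = int n - 1 - int i"
  have jA: "int n - 1 - int j \<in> A" if "j < i" for j using that by (simp add: A_def)
  have y: "y \<notin> A" by (simp add: A_def y_def)
  let ?f = "\<lambda>\<sigma>. indicator {z} (excursions k (unstack \<sigma>) n i) :: ennreal"
  let ?h = "\<lambda>\<sigma>. g (fails (\<sigma> y) m)"
  have f: "?f \<in> borel_measurable (PiM A (\<lambda>_. stack_space))"
    by (rule measurable_compose[OF excursions_measurable]) (auto simp: jA)
  have "(\<lambda>\<sigma>. fails (\<sigma> y) m) \<in> measurable (PiM {y} (\<lambda>_. stack_space)) (count_space UNIV)"
    using measurable_compose[OF measurable_component_singleton[of y "{y}" "\<lambda>_. stack_space"] fails_measurable] by blast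
  then have h: "?h \<in> borel_measurable (PiM {y} (\<lambda>_. stack_space))"
    by (rule measurable_compose) simp
  have "ann.indep_var (PiM A (\<lambda>_. stack_space)) (\<lambda>a. \<lambda>x\<in>A. arrow_stack x a) (PiM {y} (\<lambda>_. stack_space)) (\<lambda>a. \<lambda>x\<in>{y}. arrow_stack x a)"
    by (rule ann.indep_var_restrict[OF stacks_indep]) (use y in auto)
  from ann.indep_var_compose[OF this f h]
  have "ann.indep_vars (\<lambda>_. borel) (case_bool (?f \<circ> (\<lambda>a. \<lambda>x\<in>A. arrow_stack x a)) (?h \<circ> (\<lambda>a. \<lambda>x\<in>{y}. arrow_stack x a))) UNIV"
    unfolding ann.indep_var_def case_bool_same .
  from ann.indep_vars_nn_integral[OF _ this]
  have "(\<integral>\<^sup>+a. ?f (\<lambda>x\<in>A. arrow_stack x a) * ?h (\<lambda>x\<in>{y}. arrow_stack x a) \<partial>annealed P) =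
      (\<integral>\<^sup>+a. ?f (\<lambda>x\<in>A. arrow_stack x a) \<partial>annealed P) * (\<integral>\<^sup>+a. ?h (\<lambda>x\<in>{y}. arrow_stack x a) \<partial>annealed P)"
    by (simp add: UNIV_bool mult.commute comp_def del: restrict_apply)
  moreover have "?f (\<lambda>x\<in>A. arrow_stack x a) = indicator {z} (excursions k a n i)" for a
    using excursions_stacks[of i n A k a] jA by simp
  moreover have "?h (\<lambda>x\<in>{y}. arrow_stack x a) = g (fails (arrow_stack y a) m)" for a by simp
  moreover have "(\<integral>\<^sup>+a. g (fails (arrow_stack y a) m) \<partial>annealed P) = offspring g m"
    unfolding offspring_def by (rule nn_integral_arrow_stack[of "\<lambda>s. g (fails s m)"]) simp
  ultimately show ?thesis unfolding y_def by simp
qed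

lemma markov_step:
  fixes g :: "nat \<Rightarrow> ennreal"
  shows "(\<integral>\<^sup>+a. g (excursions k a n (Suc i)) \<partial>annealed P) =
    (\<integral>\<^sup>+a. offspring g ((if i < n then k else 0) + excursions k a n i) \<partial>annealed P)"
proof -
  define c where "c = (if i < n then k else 0)"
  let ?X = "\<lambda>a. excursions k a n i" and ?s = "\<lambda>a. arrow_stack (int n - 1 - int i) a"
  have decomp: "(\<Sum>z. indicator {z} x * f z) = f x" for x and f :: "nat \<Rightarrow> ennreal"
  proof -
    have "(\<Sum>z. indicator {z} x * f z) = (\<Sum>z\<in>{x}. indicator {z} x * f z)"
      by (intro suminf_finite) auto
    then show ?thesis by simp
  qed
  have fm: "(\<lambda>a. fails (?s a) m) \<in> measurable (annealed P) (count_space UNIV)" for m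
    by (rule measurable_compose[OF arrow_stack_rv fails_measurable])
  have m1 [measurable]: "(\<lambda>a. g (fails (?s a) m)) \<in> borel_measurable (annealed P)" for m
    by (rule measurable_compose[OF fm]) simp
  have m2 [measurable]: "(\<lambda>a. indicator {z} (?X a) :: ennreal) \<in> borel_measurable (annealed P)" for z
    by (rule measurable_compose[OF excursions_rv]) simp
  have step: "(\<integral>\<^sup>+a. indicator {z} (?X a) * g (fails (?s a) m) \<partial>annealed P) =
      (\<integral>\<^sup>+a. indicator {z} (?X a) * offspring g m \<partial>annealed P)" for z m
    by (simp only: excursions_indep nn_integral_multc[OF m2])
  have "(\<integral>\<^sup>+a. g (excursions k a n (Suc i)) \<partial>annealed P) = (\<integral>\<^sup>+a. (\<Sum>z. indicator {z} (?X a) * g (fails (?s a) (c + z))) \<partial>annealed P)"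
    unfolding decomp by (simp add: c_def fails_arrow_stack)
  also have "\<dots> = (\<Sum>z. \<integral>\<^sup>+a. indicator {z} (?X a) * g (fails (?s a) (c + z)) \<partial>annealed P)"
    by (rule nn_integral_suminf) measurable
  also have "\<dots> = (\<Sum>z. \<integral>\<^sup>+a. indicator {z} (?X a) * offspring g (c + z) \<partial>annealed P)"
    by (simp only: step)
  also have "\<dots> = (\<integral>\<^sup>+a. (\<Sum>z. indicator {z} (?X a) * offspring g (c + z)) \<partial>annealed P)"
    by (rule nn_integral_suminf[symmetric]) measurable
  also have "\<dots> = (\<integral>\<^sup>+a. offspring g (c + ?X a) \<partial>annealed P)"
    unfolding decomp ..
  finally show ?thesis by (simp add: c_def)
qed

section \<open>Linear growth for a total drift above k + 1\<close>

lemma fails_comp_measurable: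
  fixes g :: "nat \<Rightarrow> ennreal"
  shows "(\<lambda>a. g (fails (arrow_stack x a) m)) \<in> borel_measurable (annealed P)"
proof (rule measurable_compose[where f = "\<lambda>a. fails (arrow_stack x a) m" and g = g])
  show "(\<lambda>a. fails (arrow_stack x a) m) \<in> measurable (annealed P) (count_space UNIV)"
    by (rule measurable_compose[OF arrow_stack_rv fails_measurable])
qed simp

lemma excursions_comp_measurable:
  fixes g :: "nat \<Rightarrow> ennreal"
  shows "(\<lambda>a. g (excursions k a n i)) \<in> borel_measurable (annealed P)"
proof (rule measurable_compose[where f = "\<lambda>a. excursions k a n i" and g = g])
  show "(\<lambda>a. excursions k a n i) \<in> measurable (annealed P) (count_space UNIV)"
    by (rule excursions_rv)
qed simp

lemma offspring_add: "offspring (\<lambda>z. f z + g z) m = offspring f m + offspring g m"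
  unfolding offspring_def by (rule nn_integral_add) (rule fails_comp_measurable)+

lemma offspring_cmult: "offspring (\<lambda>z. c * f z) m = c * offspring f m"
  unfolding offspring_def by (rule nn_integral_cmult) (rule fails_comp_measurable)

lemma offspring_const: "offspring (\<lambda>z. c) m = c"
  unfolding offspring_def by (simp add: ann.emeasure_space_1)

lemma offspring_le: "(\<And>z. f z \<le> g z) \<Longrightarrow> offspring f m \<le> offspring g m"
  unfolding offspring_def by (rule nn_integral_mono) simp

lemma offspring_mono:
  assumes "m \<le> m'" and "\<And>z z'. z \<le> z' \<Longrightarrow> g z \<le> g z'"
  shows "offspring g m \<le> offspring g m'"
  unfolding offspring_def
proof (rule nn_integral_mono_AE)
  show "AE a in annealed P. g (fails (arrow_stack 0 a) m) \<le> g (fails (arrow_stack 0 a) m')"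
    using rights_unbounded_AE_0
  proof eventually_elim
    case (elim a)
    then have "\<exists>t. m' \<le> rights (arrow_stack 0 a) t" by blast
    from fails_mono[OF assms(1) this] show ?case by (rule assms(2))
  qed
qed

definition extinction :: "nat \<Rightarrow> real" where
  "extinction m = ann.prob {a \<in> space (annealed P). fails (arrow_stack 0 a) m = 0}"

lemma offspring_nonzero: "offspring (\<lambda>z. of_bool (z > 0)) m = ennreal (1 - extinction m)"
proof -
  have *: "{a \<in> space (annealed P). fails (arrow_stack 0 a) m = 0} \<in> ann.events" by measurable
  have "offspring (\<lambda>z. of_bool (z > 0)) m =
      (\<integral>\<^sup>+a. indicator (space (annealed P) - {a \<in> space (annealed P). fails (arrow_stack 0 a) m = 0}) a \<partial>annealed P)"
    unfolding offspring_def by (rule nn_integral_cong) (auto simp: indicator_def)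
  also have "\<dots> = ennreal (ann.prob (space (annealed P) - {a \<in> space (annealed P). fails (arrow_stack 0 a) m = 0}))"
    using * by (simp add: ann.emeasure_eq_measure)
  finally show ?thesis unfolding extinction_def using ann.prob_compl[OF *] by simp
qed

abbreviation "sq \<equiv> \<lambda>z::nat. ennreal (real z ^ 2)"

text \<open>For large values this is the explicit second moment, in which \<open>2 z (j + 1 - \<delta>)\<close> is the only term
  linear in \<open>z\<close>. The finitely many small values are dominated by monotonicity. The case \<open>j = k\<close> serves the
  sites to the right of \<open>0\<close>, the case \<open>j = 0\<close> those to the left.\<close>

lemma offspring_second_drift:
  assumes d: "total_drift P > real k + 1"
  shows "\<exists>C\<ge>0. \<forall>j z. j \<le> k \<longrightarrow>
    offspring sq (j + z) + ennreal (2 * (total_drift P - real k - 1) * real z) \<le> ennreal (real z ^ 2 + C)"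
proof -
  define \<delta> where "\<delta> = total_drift P"
  define c where "c = \<delta> - real k - 1"
  define E where "E = real (Suc M) ^ 2 + 2 * real (Suc M) * (1 - \<delta>) + var_defect"
  define C where "C = real k ^ 2 + \<bar>var_defect\<bar> + \<bar>E\<bar> + 2 * c * real M"
  have c: "c > 0" and d1: "\<delta> > 1" using d by (auto simp: c_def \<delta>_def)
  have C: "C \<ge> 0" using c by (simp add: C_def)
  have "offspring sq (j + z) + ennreal (2 * c * real z) \<le> ennreal (real z ^ 2 + C)" if j: "j \<le> k" for j z
  proof (cases "j + z > M")
    case True
    define x where "x = real (j + z) ^ 2 + 2 * real (j + z) * (1 - \<delta>) + var_defect"
    have "x + 2 * c * real z = real z ^ 2 + 2 * real z * (real j - real k) + real j ^ 2 + 2 * real j * (1 - \<delta>) + var_defect"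
      by (simp add: x_def c_def power2_eq_square algebra_simps)
    moreover have "2 * real z * (real j - real k) \<le> 0" using j by (simp add: mult_nonneg_nonpos)
    moreover have "2 * real j * (1 - \<delta>) \<le> 0" using d1 by (simp add: mult_nonneg_nonpos)
    moreover have "real j ^ 2 \<le> real k ^ 2" using j by (simp add: power_mono)
    moreover have "0 \<le> 2 * c * real M" using c by simp
    ultimately have le: "x + 2 * c * real z \<le> real z ^ 2 + C" unfolding C_def by linarith
    have x: "0 \<le> x" using second_moment_nonneg[OF True] by (simp only: x_def \<delta>_def)
    have "offspring sq (j + z) + ennreal (2 * c * real z) = ennreal (x + 2 * c * real z)"
      unfolding offspring_second[OF True] x_def[symmetric] \<delta>_def[symmetric] using x c by (simp add: ennreal_plus)
    then show ?thesis using le by (simp add: ennreal_leI)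
  next
    case False
    have "offspring sq (j + z) \<le> offspring sq (Suc M)"
      using False by (intro offspring_mono) (auto intro!: ennreal_leI power_mono)
    also have "\<dots> \<le> ennreal \<bar>E\<bar>"
      unfolding offspring_second[of "Suc M", simplified] E_def \<delta>_def by (rule ennreal_leI) simp
    finally have "offspring sq (j + z) + ennreal (2 * c * real z) \<le> ennreal \<bar>E\<bar> + ennreal (2 * c * real z)"
      by (rule add_right_mono)
    also have "\<dots> = ennreal (\<bar>E\<bar> + 2 * c * real z)" using c by (simp add: ennreal_plus)
    also have "\<dots> \<le> ennreal (real z ^ 2 + C)"
    proof (rule ennreal_leI)
      have "2 * c * real z \<le> 2 * c * real M" using False c by (intro mult_left_mono) auto
      moreover have "0 \<le> real z ^ 2" "0 \<le> real k ^ 2" by simp_all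
      ultimately show "\<bar>E\<bar> + 2 * c * real z \<le> real z ^ 2 + C" unfolding C_def by linarith
    qed
    finally show ?thesis .
  qed
  then show ?thesis using C unfolding c_def \<delta>_def by blast
qed

text \<open>Where no particles are added, the drift must not contain a constant, since there are infinitely many
  such sites. The reward \<open>K\<close> for hitting
  \<open>0\<close>, weighted with the extinction probability, pays for the constant term of the drift at small \<open>z\<close>; at large
  \<open>z\<close> the linear term pays for it.\<close>

lemma excursion_lyapunov:
  assumes d: "total_drift P > real k + 1"
  shows "\<exists>c K C. c > 0 \<and> K \<ge> 0 \<and> C \<ge> 0 \<and>
    (\<forall>z. offspring (\<lambda>z. sq z + ennreal K * of_bool (z > 0)) (k + z) + ennreal (c * real z)
      \<le> (sq z + ennreal K * of_bool (z > 0)) + ennreal C) \<and>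
    (\<forall>z. offspring (\<lambda>z. sq z + ennreal K * of_bool (z > 0)) z + ennreal (c * real z)
      \<le> sq z + ennreal K * of_bool (z > 0))"
proof -
  obtain C0 where C0: "C0 \<ge> 0" and drift: "\<And>j z. j \<le> k \<Longrightarrow>
      offspring sq (j + z) + ennreal (2 * (total_drift P - real k - 1) * real z) \<le> ennreal (real z ^ 2 + C0)"
    using offspring_second_drift[OF d] by blast
  define c where "c = total_drift P - real k - 1"
  have c: "c > 0" using d by (simp add: c_def)
  obtain B :: nat where B: "C0 / c \<le> real B" using real_arch_simple by blast
  obtain \<epsilon> where \<epsilon>: "\<epsilon> > 0" "\<And>z. z \<le> B \<Longrightarrow> \<epsilon> \<le> extinction z"
    using extinction_positive[of B] unfolding extinction_def by blast
  \<comment> \<open>extinction has probability at least \<open>\<epsilon>\<close> up to \<open>B\<close>, so the expected reward there is at least \<open>C0\<close>\<close>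
  define K where "K = C0 / \<epsilon>"
  have K: "K \<ge> 0" using C0 \<epsilon> by (simp add: K_def)
  let ?V = "\<lambda>z. sq z + ennreal K * of_bool (z > 0)"
  have ext: "0 \<le> extinction m" "extinction m \<le> 1" for m
    by (auto simp: extinction_def ann.prob_le_1)
  have step: "\<exists>x\<ge>0. x + 2 * c * real z \<le> real z ^ 2 + C0 \<and> offspring ?V (j + z) = ennreal (x + K * (1 - extinction (j + z)))"
    if "j \<le> k" for j z
  proof -
    have le: "offspring sq (j + z) + ennreal (2 * c * real z) \<le> ennreal (real z ^ 2 + C0)"
      using drift[OF that] by (simp add: c_def)
    then have "offspring sq (j + z) < top"
      by (metis ennreal_add_eq_top ennreal_less_top le_less_trans less_top)
    then obtain x where x: "x \<ge> 0" "offspring sq (j + z) = ennreal x"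
      by (cases "offspring sq (j + z)") auto
    have "ennreal (x + 2 * c * real z) \<le> ennreal (real z ^ 2 + C0)"
      using le x c by (simp add: ennreal_plus)
    then have "x + 2 * c * real z \<le> real z ^ 2 + C0"
      using C0 by (subst (asm) ennreal_le_iff) auto
    moreover have "offspring ?V (j + z) = ennreal (x + K * (1 - extinction (j + z)))"
      unfolding offspring_add offspring_cmult offspring_nonzero x(2)
      using x(1) K ext by (simp add: ennreal_plus ennreal_mult)
    ultimately show ?thesis using x(1) by blast
  qed
  have V: "?V z = ennreal (real z ^ 2 + K * of_bool (z > 0))" for z
    using K by (simp add: ennreal_plus)
  have "offspring ?V (k + z) + ennreal (c * real z) \<le> ?V z + ennreal (C0 + K)" for z
  proof -
    obtain x where x: "x \<ge> 0" "x + 2 * c * real z \<le> real z ^ 2 + C0" "offspring ?V (k + z) = ennreal (x + K * (1 - extinction (k + z)))"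
      using step[of k z] by blast
    have 0: "0 \<le> c * real z" "0 \<le> K * (1 - extinction (k + z))" "K * (1 - extinction (k + z)) \<le> K" "0 \<le> K * of_bool (z > 0)"
      using c K ext by (auto intro: mult_left_le)
    have "offspring ?V (k + z) + ennreal (c * real z) = ennreal (x + K * (1 - extinction (k + z)) + c * real z)"
      unfolding x(3) using 0 x(1) by (simp add: ennreal_plus)
    also have "\<dots> \<le> ennreal (real z ^ 2 + K * of_bool (z > 0) + (C0 + K))"
      using x(2) 0 by (intro ennreal_leI) linarith
    also have "\<dots> = ?V z + ennreal (C0 + K)"
      unfolding V using K C0 by (intro ennreal_plus) auto
    finally show ?thesis .
  qed
  moreover have "offspring ?V z + ennreal (c * real z) \<le> ?V z" for z
  proof (cases "z = 0")
    case True
    have "offspring ?V 0 = 0" unfolding offspring_def by simp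
    then show ?thesis using True by simp
  next
    case False
    obtain x where x: "x \<ge> 0" "x + 2 * c * real z \<le> real z ^ 2 + C0" "offspring ?V z = ennreal (x + K * (1 - extinction z))"
      using step[of 0 z] by auto
    have 0: "0 \<le> c * real z" "0 \<le> K * (1 - extinction z)" "K * (1 - extinction z) \<le> K"
      using c K ext by (auto intro: mult_left_le)
    have "x + K * (1 - extinction z) + c * real z \<le> real z ^ 2 + K"
    proof (cases "z \<le> B")
      case True
      have "C0 = K * \<epsilon>" using \<epsilon> by (simp add: K_def)
      also have "\<dots> \<le> K * extinction z" using \<epsilon>(2)[OF True] K by (intro mult_left_mono) auto
      finally have "K * (1 - extinction z) \<le> K - C0" by (simp add: algebra_simps)
      then show ?thesis using x(2) 0 by linarith
    next
      case False
      then have "C0 / c \<le> real z" using B by linarith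
      then have "C0 \<le> c * real z" using c by (simp add: field_simps)
      then show ?thesis using x(2) 0 by linarith
    qed
    then have "ennreal (x + K * (1 - extinction z) + c * real z) \<le> ennreal (real z ^ 2 + K * of_bool (z > 0))"
      using False by (intro ennreal_leI) simp
    moreover have "offspring ?V z + ennreal (c * real z) = ennreal (x + K * (1 - extinction z) + c * real z)"
      unfolding x(3) using 0 x(1) by (simp add: ennreal_plus)
    ultimately show ?thesis using V[of z] by (simp only:)
  qed
  moreover have "0 \<le> C0 + K" using C0 K by simp
  ultimately show ?thesis using c K by (intro exI[of _ c] exI[of _ K] exI[of _ "C0 + K"] conjI allI)
qed

text \<open>Only the first \<open>n\<close> steps contribute the constant of the Lyapunov inequality, so summing it gives a
  bound that does not depend on the number \<open>I\<close> of sites taken into account.\<close>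

lemma expected_excursions:
  assumes d: "total_drift P > real k + 1"
  shows "\<exists>A\<ge>0. \<forall>n I. (\<integral>\<^sup>+a. ennreal (real (\<Sum>i<I. excursions k a n i)) \<partial>annealed P) \<le> ennreal (A * real n)"
proof -
  from excursion_lyapunov[OF d] obtain c K C where lyapunov: "c > 0 \<and> K \<ge> 0 \<and> C \<ge> 0 \<and>
    (\<forall>z. offspring (\<lambda>z. sq z + ennreal K * of_bool (z > 0)) (k + z) + ennreal (c * real z)
      \<le> (sq z + ennreal K * of_bool (z > 0)) + ennreal C) \<and>
    (\<forall>z. offspring (\<lambda>z. sq z + ennreal K * of_bool (z > 0)) z + ennreal (c * real z)
      \<le> sq z + ennreal K * of_bool (z > 0))"
    by (elim exE) (rule that)
  let ?V = "\<lambda>z. sq z + ennreal K * of_bool (z > 0)"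
  have c: "c > 0" and K: "K \<ge> 0" and C: "C \<ge> 0"
    and with_immigration: "\<And>z. offspring ?V (k + z) + ennreal (c * real z) \<le> ?V z + ennreal C"
    and without_immigration: "\<And>z. offspring ?V z + ennreal (c * real z) \<le> ?V z"
    using lyapunov by blast+
  have main: "(\<integral>\<^sup>+a. ?V (excursions k a n I) \<partial>annealed P) + (\<Sum>i<I. \<integral>\<^sup>+a. ennreal (c * real (excursions k a n i)) \<partial>annealed P)
      \<le> ennreal (C * real (min I n))" for n I
  proof (induction I)
    case 0
    then show ?case by simp
  next
    case (Suc I)
    let ?k = "if I < n then k else 0" and ?C = "if I < n then C else 0"
    have "(\<integral>\<^sup>+a. ?V (excursions k a n (Suc I)) \<partial>annealed P) + (\<integral>\<^sup>+a. ennreal (c * real (excursions k a n I)) \<partial>annealed P)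
      = (\<integral>\<^sup>+a. offspring ?V (?k + excursions k a n I) + ennreal (c * real (excursions k a n I)) \<partial>annealed P)"
      unfolding markov_step[of ?V] by (rule nn_integral_add[symmetric]) (rule excursions_comp_measurable[of "\<lambda>z. offspring ?V (?k + z)"] excursions_comp_measurable[of "\<lambda>z. ennreal (c * real z)"])+
    also have "\<dots> \<le> (\<integral>\<^sup>+a. ?V (excursions k a n I) + ennreal ?C \<partial>annealed P)"
    proof (rule nn_integral_mono)
      fix a
      show "offspring ?V (?k + excursions k a n I) + ennreal (c * real (excursions k a n I)) \<le> ?V (excursions k a n I) + ennreal ?C"
      proof (cases "I < n")
        case True
        then show ?thesis using with_immigration[of "excursions k a n I"] by (simp only: if_True)
      next
        case False
        then show ?thesis using without_immigration[of "excursions k a n I"] by (simp only: if_False ennreal_0 add_0 add_0_right)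
      qed
    qed
    also have "\<dots> = (\<integral>\<^sup>+a. ?V (excursions k a n I) \<partial>annealed P) + ennreal ?C"
      by (subst nn_integral_add) (simp_all add: ann.emeasure_space_1 excursions_comp_measurable[of ?V])
    finally have le: "(\<integral>\<^sup>+a. ?V (excursions k a n (Suc I)) \<partial>annealed P) + (\<integral>\<^sup>+a. ennreal (c * real (excursions k a n I)) \<partial>annealed P)
      \<le> (\<integral>\<^sup>+a. ?V (excursions k a n I) \<partial>annealed P) + ennreal ?C" .
    have arith: "W1 + (s + t) \<le> (W0 + s) + C'" if "W1 + t \<le> W0 + C'" for W1 W0 s t C' :: ennreal
    proof -
      have "W1 + (s + t) = (W1 + t) + s" by (simp only: ac_simps)
      also have "\<dots> \<le> (W0 + C') + s" by (rule add_right_mono[OF that])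
      also have "\<dots> = (W0 + s) + C'" by (simp only: ac_simps)
      finally show ?thesis .
    qed
    have "(\<integral>\<^sup>+a. ?V (excursions k a n (Suc I)) \<partial>annealed P) + (\<Sum>i<Suc I. \<integral>\<^sup>+a. ennreal (c * real (excursions k a n i)) \<partial>annealed P)
      \<le> ((\<integral>\<^sup>+a. ?V (excursions k a n I) \<partial>annealed P) + (\<Sum>i<I. \<integral>\<^sup>+a. ennreal (c * real (excursions k a n i)) \<partial>annealed P)) + ennreal ?C"
      unfolding sum.lessThan_Suc by (rule arith[OF le])
    also have "\<dots> \<le> ennreal (C * real (min I n)) + ennreal ?C"
      by (rule add_right_mono[OF Suc.IH])
    also have "\<dots> = ennreal (C * real (min (Suc I) n))"
      using C by (subst ennreal_plus[symmetric]) (auto simp: algebra_simps min_def)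
    finally show ?case .
  qed
  have "(\<integral>\<^sup>+a. ennreal (real (\<Sum>i<I. excursions k a n i)) \<partial>annealed P) \<le> ennreal (C / c * real n)" for n I
  proof -
    have "(\<Sum>i<I. \<integral>\<^sup>+a. ennreal (c * real (excursions k a n i)) \<partial>annealed P) \<le>
        (\<integral>\<^sup>+a. ?V (excursions k a n I) \<partial>annealed P) + (\<Sum>i<I. \<integral>\<^sup>+a. ennreal (c * real (excursions k a n i)) \<partial>annealed P)"
      by (rule add_increasing) simp_all
    also have "\<dots> \<le> ennreal (C * real (min I n))" by (rule main)
    also have "\<dots> \<le> ennreal (C * real n)" using C by (intro ennreal_leI mult_left_mono) auto
    finally have le: "(\<Sum>i<I. \<integral>\<^sup>+a. ennreal (c * real (excursions k a n i)) \<partial>annealed P) \<le> ennreal (C * real n)" .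
    have "ennreal (real (\<Sum>i<I. excursions k a n i)) = ennreal (1 / c) * (\<Sum>i<I. ennreal (c * real (excursions k a n i)))" for a
      using c by (subst sum_ennreal) (auto simp: ennreal_mult'[symmetric] sum_distrib_left[symmetric])
    then have "(\<integral>\<^sup>+a. ennreal (real (\<Sum>i<I. excursions k a n i)) \<partial>annealed P) =
        (\<integral>\<^sup>+a. ennreal (1 / c) * (\<Sum>i<I. ennreal (c * real (excursions k a n i))) \<partial>annealed P)"
      by (simp only:)
    also have "\<dots> = ennreal (1 / c) * (\<Sum>i<I. \<integral>\<^sup>+a. ennreal (c * real (excursions k a n i)) \<partial>annealed P)"
      by (subst nn_integral_cmult) (simp_all add: nn_integral_sum excursions_comp_measurable[of "\<lambda>z. ennreal (c * real z)"] borel_measurable_sum)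
    also have "\<dots> \<le> ennreal (1 / c) * ennreal (C * real n)" by (rule mult_left_mono[OF le]) simp
    also have "\<dots> = ennreal (C / c * real n)" using c C by (simp add: ennreal_mult[symmetric])
    finally show ?thesis .
  qed
  moreover have "C / c \<ge> 0" using c C by simp
  ultimately show ?thesis by (intro exI[of _ "C / c"] conjI allI)
qed

text \<open>Markov's inequality for the partial sums with a bound uniform in their length, followed by
  continuity from above.\<close>

lemma linear_excursions_likely:
  assumes d: "total_drift P > real k + 1"
  shows "\<exists>A. \<forall>n. {a \<in> space (annealed P). \<forall>I. (\<Sum>i<I. excursions k a n i) \<le> A * n} \<in> ann.events \<and>
    (n \<ge> 1 \<longrightarrow> ann.prob {a \<in> space (annealed P). \<forall>I. (\<Sum>i<I. excursions k a n i) \<le> A * n} \<ge> 1 / 2)"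
proof -
  from expected_excursions[OF d] obtain A0 where "A0 \<ge> 0 \<and> (\<forall>n I. (\<integral>\<^sup>+a. ennreal (real (\<Sum>i<I. excursions k a n i)) \<partial>annealed P) \<le> ennreal (A0 * real n))" ..
  then have A0: "A0 \<ge> 0" "\<And>n I. (\<integral>\<^sup>+a. ennreal (real (\<Sum>i<I. excursions k a n i)) \<partial>annealed P) \<le> ennreal (A0 * real n)"
    by simp_all
  obtain A :: nat where A: "2 * A0 + 1 \<le> real A" using real_arch_simple by blast
  let ?X = "\<lambda>n I a. (\<Sum>i<I. excursions k a n i)"
  let ?E = "\<lambda>n I. {a \<in> space (annealed P). ?X n I a \<le> A * n}"
  have X [measurable]: "(\<lambda>a. ?X n I a) \<in> measurable (annealed P) (count_space UNIV)" for n I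
    by (induction I) (simp_all, measurable)
  have E [measurable]: "?E n I \<in> ann.events" for n I by measurable
  have half: "ann.prob (?E n I) \<ge> 1 / 2" if n: "n \<ge> 1" for n I
  proof -
    have An: "real A * real n > 0" using A A0(1) n by simp
    have "emeasure (annealed P) {a \<in> space (annealed P). 1 \<le> ennreal (1 / (real A * real n)) * ennreal (real (?X n I a))}
        \<le> ennreal (1 / (real A * real n)) * (\<integral>\<^sup>+a. ennreal (real (?X n I a)) \<partial>annealed P)"
    proof -
      have "(\<lambda>a. ennreal (real (?X n I a))) \<in> borel_measurable (annealed P)"
        by (rule measurable_compose[OF X, where g = "\<lambda>z. ennreal (real z)"]) simp
      then have m: "(\<lambda>a. ennreal (real (?X n I a)) * indicator (space (annealed P)) a) \<in> borel_measurable (annealed P)"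
        by measurable
      have "(\<integral>\<^sup>+a. ennreal (real (?X n I a)) * indicator (space (annealed P)) a \<partial>annealed P) =
          (\<integral>\<^sup>+a. ennreal (real (?X n I a)) \<partial>annealed P)"
        by (rule nn_integral_cong) simp
      with nn_integral_Markov_inequality[OF m sets.top, of "ennreal (1 / (real A * real n))"]
      show ?thesis by (simp only:)
    qed
    also have "\<dots> \<le> ennreal (1 / (real A * real n)) * ennreal (A0 * real n)"
      by (rule mult_left_mono[OF A0(2)]) simp
    also have "\<dots> = ennreal (A0 / real A)" using An A0(1) n by (simp add: ennreal_mult[symmetric])
    also have "\<dots> \<le> ennreal (1 / 2)" using A A0(1) by (intro ennreal_leI) (simp add: field_simps)
    finally have "emeasure (annealed P) {a \<in> space (annealed P). 1 \<le> ennreal (1 / (real A * real n)) * ennreal (real (?X n I a))} \<le> ennreal (1 / 2)" .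
    moreover have "space (annealed P) - ?E n I \<subseteq> {a \<in> space (annealed P). 1 \<le> ennreal (1 / (real A * real n)) * ennreal (real (?X n I a))}"
    proof clarsimp
      fix a assume "\<not> ?X n I a \<le> A * n"
      then have "real A * real n \<le> real (?X n I a)" by (metis nle_le of_nat_le_iff of_nat_mult)
      then have "1 \<le> 1 / (real A * real n) * real (?X n I a)" using An by (simp add: field_simps)
      then have "ennreal 1 \<le> ennreal (1 / (real A * real n) * real (?X n I a))" by (rule ennreal_leI)
      also have "\<dots> = ennreal (1 / (real A * real n)) * ennreal (real (?X n I a))" using An by (intro ennreal_mult) (simp_all add: sum_nonneg)
      finally show "1 \<le> ennreal (1 / (real A * real n)) * ennreal (\<Sum>i<I. real (excursions k a n i))" by simp
    qed
    then have "emeasure (annealed P) (space (annealed P) - ?E n I) \<le> emeasure (annealed P) {a \<in> space (annealed P). 1 \<le> ennreal (1 / (real A * real n)) * ennreal (real (?X n I a))}"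
      by (rule emeasure_mono) measurable
    ultimately have "ennreal (ann.prob (space (annealed P) - ?E n I)) \<le> ennreal (1 / 2)"
      unfolding ann.emeasure_eq_measure by (rule order_trans[rotated])
    then have "ann.prob (space (annealed P) - ?E n I) \<le> 1 / 2" by (subst (asm) ennreal_le_iff) simp_all
    then show ?thesis using ann.prob_compl[OF E[of n I]] by linarith
  qed
  have eq: "{a \<in> space (annealed P). \<forall>I. ?X n I a \<le> A * n} = (\<Inter>I. ?E n I)" for n by auto
  have "{a \<in> space (annealed P). \<forall>I. ?X n I a \<le> A * n} \<in> ann.events" for n
    unfolding eq by (rule sets.countable_INT) (use E in auto)
  moreover have "ann.prob {a \<in> space (annealed P). \<forall>I. ?X n I a \<le> A * n} \<ge> 1 / 2" if "n \<ge> 1" for n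
  proof -
    have "decseq (?E n)"
    proof (rule decseq_SucI)
      fix I show "?E n (Suc I) \<subseteq> ?E n I" by auto
    qed
    then have "(\<lambda>I. ann.prob (?E n I)) \<longlonglongrightarrow> ann.prob (\<Inter>I. ?E n I)"
      by (intro ann.finite_Lim_measure_decseq) (use E in auto)
    then show ?thesis unfolding eq by (rule LIMSEQ_le_const) (use half[OF that] in auto)
  qed
  ultimately show ?thesis by (intro exI[of _ A] allI conjI impI)
qed

text \<open>With probability at least \<open>1 / 2\<close> there are infinitely many \<open>n\<close> for which level \<open>n\<close> is reached in
  time at most \<open>Q n\<close>, and a single such environment where the limit is \<open>v\<close> bounds \<open>v\<close> from
  below by \<open>1 / Q\<close>.\<close>

lemma positive_speed:
  assumes k: "k \<ge> 1" and d: "total_drift P > real k + 1"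
    and v: "AE a in annealed P. (\<lambda>n. real_of_int (kmin_walk k a n) / real n) \<longlonglongrightarrow> v"
  shows "v > 0"
proof -
  from linear_excursions_likely[OF d] obtain A where A:
    "\<forall>n. {a \<in> space (annealed P). \<forall>I. (\<Sum>i<I. excursions k a n i) \<le> A * n} \<in> ann.events \<and>
    (n \<ge> 1 \<longrightarrow> ann.prob {a \<in> space (annealed P). \<forall>I. (\<Sum>i<I. excursions k a n i) \<le> A * n} \<ge> 1 / 2)" ..
  note E = conjunct1[OF spec[OF A]] and half = mp[OF conjunct2[OF spec[OF A]]]
  let ?E = "\<lambda>n. {a \<in> space (annealed P). \<forall>I. (\<Sum>i<I. excursions k a n i) \<le> A * n}"
  let ?U = "\<lambda>N. \<Union>n\<in>{Suc N..}. ?E n"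
  have U: "?U N \<in> ann.events" for N by (rule sets.countable_UN') (use E in auto)
  have "1 / 2 \<le> ann.prob (?U N)" for N
  proof -
    have "1 / 2 \<le> ann.prob (?E (Suc N))" by (rule half) simp
    also have "\<dots> \<le> ann.prob (?U N)" by (rule ann.finite_measure_mono[OF _ U]) auto
    finally show ?thesis .
  qed
  moreover have "(\<lambda>N. ann.prob (?U N)) \<longlonglongrightarrow> ann.prob (\<Inter>N. ?U N)"
  proof (rule ann.finite_Lim_measure_decseq)
    show "range ?U \<subseteq> ann.events" using U by blast
    show "decseq ?U" by (intro decseq_SucI UN_mono) auto
  qed
  ultimately have pos: "1 / 2 \<le> ann.prob (\<Inter>N. ?U N)" by (intro LIMSEQ_le_const) auto
  have "(\<Inter>N. ?U N) \<in> ann.events" by (rule sets.countable_INT) (use U in auto)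
  from ann.prob_eq_0[OF this] pos have often: "\<not> (AE a in annealed P. a \<notin> (\<Inter>N. ?U N))" by linarith
  have good: "AE a in annealed P. proper a \<and> (\<forall>x m. \<exists>t. m \<le> rights (stack a x) t) \<and>
      (\<lambda>n. real_of_int (kmin_walk k a n) / real n) \<longlonglongrightarrow> v"
    using v proper_AE rights_unbounded_AE by eventually_elim (intro conjI)
  have "\<exists>a. a \<in> (\<Inter>N. ?U N) \<and> proper a \<and> (\<forall>x m. \<exists>t. m \<le> rights (stack a x) t) \<and>
      (\<lambda>n. real_of_int (kmin_walk k a n) / real n) \<longlonglongrightarrow> v" (is "\<exists>a. ?in a \<and> ?good a")
  proof (rule ccontr)
    assume "\<nexists>a. ?in a \<and> ?good a"
    then have no: "\<And>a. ?good a \<Longrightarrow> \<not> ?in a" by blast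
    have "AE a in annealed P. \<not> ?in a"
      by (rule eventually_mono[OF good]) (rule no)
    with often show False by (rule notE)
  qed
  then obtain a where a: "a \<in> (\<Inter>N. ?U N)" "proper a" "\<And>x m. \<exists>t. m \<le> rights (stack a x) t"
    "(\<lambda>n. real_of_int (kmin_walk k a n) / real n) \<longlonglongrightarrow> v"
    by (elim exE conjE) (rule that; assumption?; elim allE; assumption)
  \<comment> \<open>for \<open>n \<ge> 1\<close> the bound \<open>n k + 2 A n + 1\<close> on the hitting time is at most \<open>Q n\<close>\<close>
  define Q where "Q = real (k + 2 * A + 1)"
  have Q: "Q > 0" by (simp add: Q_def)
  have "1 / Q \<le> v"
  proof (rule ccontr)
    assume "\<not> 1 / Q \<le> v"
    then have "\<forall>\<^sub>F n in sequentially. real_of_int (kmin_walk k a n) / real n < 1 / Q"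
      using a(4) by (intro order_tendstoD(2)) auto
    then obtain T where T: "\<And>n. n \<ge> T \<Longrightarrow> real_of_int (kmin_walk k a n) / real n < 1 / Q"
      by (auto simp: eventually_sequentially)
    from a(1) have "a \<in> ?U T" by blast
    then obtain n where n: "n \<ge> Suc T" "\<And>I. (\<Sum>i<I. excursions k a n i) \<le> A * n" by auto
    obtain t where t: "t \<le> Suc (n * k + 2 * (A * n))" "int n \<le> kmin_walk k a t"
      using hitting_time_le_excursions[OF k a(2,3) n(2)] by blast
    have nt: "n \<le> t" using kmin_walk_bound[OF k a(2), of t] t(2) by linarith
    have "real t \<le> real (Suc (n * k + 2 * (A * n)))" using t(1) by (simp only: of_nat_le_iff)
    also have "\<dots> \<le> Q * real n" using n(1) by (simp add: Q_def algebra_simps)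
    finally have "1 / Q \<le> real n / real t" using Q nt n(1) by (simp add: field_simps)
    also have "\<dots> \<le> real_of_int (kmin_walk k a t) / real t" using t(2) by (intro divide_right_mono) auto
    also have "\<dots> < 1 / Q" using T[of t] nt n(1) by simp
    finally show False by simp
  qed
  then show ?thesis using Q by (meson divide_pos_pos less_le_trans zero_less_one)
qed

end

section \<open>A truncated quadratic function\<close>

text \<open>The terms increase geometrically as long as \<open>2\<^sup>j \<le> z\<close> and decrease geometrically afterwards. The
  subtracted term in the second bound is what makes the induction work: it halves with each step, which makes
  room for the next summand.\<close>

lemma dyadic_sum_aux:
  fixes z :: real
  assumes z: "z = 0 \<or> z \<ge> 1"
  shows "(\<Sum>j<L. min (z ^ 2 / 2 ^ j) (2 ^ j)) \<le> 2 ^ L \<and>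
    (z \<le> 2 ^ L \<longrightarrow> (\<Sum>j<L. min (z ^ 2 / 2 ^ j) (2 ^ j)) \<le> 4 * z - 2 * (z ^ 2 / 2 ^ L))"
proof (induction L)
  case 0
  show ?case using z by (auto simp: power2_eq_square)
next
  case (Suc L)
  let ?S = "\<Sum>j<L. min (z ^ 2 / 2 ^ j) (2 ^ j)"
  let ?m = "min (z ^ 2 / 2 ^ L) (2 ^ L)"
  have S: "(\<Sum>j<Suc L. min (z ^ 2 / 2 ^ j) (2 ^ j)) = ?S + ?m" by simp
  have m: "?m \<le> 2 ^ L" "?m \<le> z ^ 2 / 2 ^ L" by simp_all
  have half: "z ^ 2 / 2 ^ L = 2 * (z ^ 2 / 2 ^ Suc L)" by simp
  have "?S \<le> 2 ^ L" using Suc by blast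
  with m(1) have 1: "?S + ?m \<le> 2 ^ Suc L" unfolding power_Suc by linarith
  have "?S + ?m \<le> 4 * z - 2 * (z ^ 2 / 2 ^ Suc L)" if le: "z \<le> 2 ^ Suc L"
  proof (cases "z \<le> 2 ^ L")
    case True
    then have "?S \<le> 4 * z - 2 * (z ^ 2 / 2 ^ L)" using Suc by blast
    then show ?thesis using m(2) half by linarith
  next
    case False
    have z0: "0 \<le> z" using z by auto
    have "z * z \<le> z * 2 ^ Suc L" using le z0 by (rule mult_left_mono)
    then have "z ^ 2 / 2 ^ Suc L \<le> z" by (simp add: power2_eq_square divide_le_eq)
    moreover have "(2::real) ^ Suc L = 2 * 2 ^ L" by simp
    ultimately show ?thesis using 1 False by linarith
  qed
  with 1 show ?case unfolding S by blast
qed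

lemma dyadic_sum:
  fixes z :: nat
  shows "(\<Sum>j\<in>{i..<L}. min (real z ^ 2 / 2 ^ j) (2 ^ j)) \<le> min (4 * real z) (2 ^ L)"
proof -
  let ?f = "\<lambda>j. min (real z ^ 2 / 2 ^ j) (2 ^ j) :: real"
  have "(\<Sum>j\<in>{i..<L}. ?f j) \<le> (\<Sum>j<L. ?f j)" by (rule sum_mono2) auto
  moreover have z: "real z = 0 \<or> real z \<ge> 1" by (cases z) auto
  have "(\<Sum>j<L. ?f j) \<le> 2 ^ L" using dyadic_sum_aux[OF z] by blast
  moreover have "(\<Sum>j<L. ?f j) \<le> 4 * real z"
  proof (cases "real z \<le> 2 ^ L")
    case True
    then have "(\<Sum>j<L. ?f j) \<le> 4 * real z - 2 * (real z ^ 2 / 2 ^ L)" using dyadic_sum_aux[OF z] by blast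
    moreover have "0 \<le> real z ^ 2 / 2 ^ L" by simp
    ultimately show ?thesis by linarith
  next
    case False
    moreover have "(\<Sum>j<L. ?f j) \<le> 2 ^ L" using dyadic_sum_aux[OF z] by blast
    ultimately show ?thesis by linarith
  qed
  ultimately show ?thesis by simp
qed

text \<open>The cubic term bends \<open>z\<^sup>2\<close> down at scale \<open>n\<close>, and the linear term makes the drift positive for
  large \<open>z\<close>. At the critical total drift, the term \<open>- 2 r z\<close> contributes the constant \<open>2 r\<close> to the drift.\<close>

definition cubic :: "nat \<Rightarrow> real \<Rightarrow> nat \<Rightarrow> real" where
  "cubic r n z = real z ^ 2 - 2 * real r * real z - real z ^ 3 / n"

text \<open>Cutting the cubic off from below at its value in \<open>2 r + 1\<close> makes the function vanish both at small and
  at very large arguments. Wherever it vanishes it can only increase, and everywhere it lies above the shifted cubic, so that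
  a lower bound for its drift never needs more than moments of the cubic.\<close>

definition bump :: "nat \<Rightarrow> real \<Rightarrow> nat \<Rightarrow> real" where
  "bump r n z = max (cubic r n z - cubic r n (2 * r + 1)) 0"

lemma bump_level_nonneg:
  assumes n: "real (2 * r + 1) ^ 2 \<le> n"
  shows "0 \<le> cubic r n (2 * r + 1)"
proof -
  define R where "R = real (2 * r + 1)"
  have R: "R = 2 * real r + 1" "0 < R" by (simp_all add: R_def)
  have n0: "0 < n" using n by (rule less_le_trans[rotated]) simp
  have "R * R ^ 2 \<le> R * n" using n R(2) unfolding R_def[symmetric] by (intro mult_left_mono) auto
  then have "R ^ 3 / n \<le> R" using n0 by (simp add: divide_le_eq power3_eq_cube power2_eq_square)
  moreover have "R ^ 2 - 2 * real r * R = R" unfolding R(1) by (simp add: power2_eq_square algebra_simps)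
  ultimately show ?thesis unfolding cubic_def R_def[symmetric] by linarith
qed

lemma cubic_pos:
  assumes "0 < n" "cubic r n z > 0"
  shows "real z < n" "2 * r < z"
proof -
  have "real z ^ 3 / n < real z ^ 2 - 2 * real r * real z" using assms(2) by (simp add: cubic_def)
  also have "\<dots> = real z * (real z - 2 * real r)" by (simp add: power2_eq_square algebra_simps)
  finally have *: "real z ^ 3 / n < real z * (real z - 2 * real r)" .
  moreover have "0 \<le> real z ^ 3 / n" using assms(1) by simp
  ultimately have "0 < real z * (real z - 2 * real r)" by linarith
  then have "2 * real r < real z" and z0: "0 < real z" by (auto simp: zero_less_mult_iff)
  then show "2 * r < z" by linarith
  have "real z * (real z - 2 * real r) \<le> real z ^ 2" by (simp add: power2_eq_square algebra_simps)
  with * have "real z ^ 3 / n < real z ^ 2" by linarith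
  then have "real z ^ 2 * real z < real z ^ 2 * n"
    using assms(1) by (simp add: divide_less_eq power3_eq_cube power2_eq_square)
  then show "real z < n" using z0 by (simp add: mult_less_cancel_left)
qed

lemma bump_pos_less:
  assumes n: "real (2 * r + 1) ^ 2 \<le> n" and "bump r n z > 0"
  shows "real z < n"
proof -
  have n0: "0 < n" using n by (rule less_le_trans[rotated]) simp
  have "cubic r n z > 0" using assms(2) bump_level_nonneg[OF n] unfolding bump_def by linarith
  then show ?thesis by (rule cubic_pos(1)[OF n0])
qed

lemma bump_bounds:
  assumes n: "real (2 * r + 1) ^ 2 \<le> n"
  shows "0 \<le> bump r n z" "bump r n z \<le> n ^ 2"
proof -
  have n0: "0 < n" using n by (rule less_le_trans[rotated]) simp
  show "0 \<le> bump r n z" by (simp add: bump_def)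
  show "bump r n z \<le> n ^ 2"
  proof (cases "bump r n z > 0")
    case True
    have "0 \<le> 2 * real r * real z" "0 \<le> real z ^ 3 / n" using n0 by simp_all
    then have "cubic r n z \<le> real z ^ 2" unfolding cubic_def by linarith
    also have "\<dots> \<le> n ^ 2" using bump_pos_less[OF n True] by (intro power_mono) auto
    finally show ?thesis using bump_level_nonneg[OF n] True unfolding bump_def by linarith
  next
    case False
    moreover have "0 \<le> n ^ 2" by simp
    ultimately show ?thesis by linarith
  qed
qed

lemma bump_small:
  assumes n: "real (2 * r + 1) ^ 2 \<le> n" and z: "z \<le> 2 * r + 1"
  shows "bump r n z = 0"
proof (cases "z = 2 * r + 1")
  case False
  have n0: "0 < n" using n by (rule less_le_trans[rotated]) simp
  have "\<not> 2 * r < z" using False z by simp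
  then have "\<not> cubic r n z > 0" using cubic_pos(2)[OF n0] by blast
  then show ?thesis using bump_level_nonneg[OF n] unfolding bump_def by linarith
qed (simp add: bump_def)

lemma cubic_diff:
  "cubic r n z - cubic r n (2 * r + 1) =
    (real z - real (2 * r + 1)) * ((real z + 1) - (real z ^ 2 + real z * real (2 * r + 1) + real (2 * r + 1) ^ 2) / n)"
proof -
  define R where "R = real (2 * r + 1)"
  have r: "2 * real r = R - 1" by (simp add: R_def)
  show ?thesis unfolding cubic_def R_def[symmetric] r
    by (simp add: power2_eq_square power3_eq_cube algebra_simps add_divide_distrib diff_divide_distrib)
qed

lemma bump_ge_1:
  assumes z: "2 * r + 1 < z" "z \<le> Y" and Y: "real Y ^ 3 \<le> n" and n: "1 \<le> n"
  shows "1 \<le> bump r n z"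
proof -
  define R where "R = real (2 * r + 1)"
  have r: "2 * real r = R - 1" by (simp add: R_def)
  have R: "1 \<le> real z - R" "0 \<le> R" "3 \<le> real z + 1" using z(1) by (auto simp: R_def)
  have "real z ^ 3 \<le> real Y ^ 3" using z(2) by (intro power_mono) auto
  from order_trans[OF this Y] have z3: "real z ^ 3 / n \<le> 1" using n by (simp add: divide_le_eq)
  have R3: "0 \<le> R ^ 3 / n" using n R by simp
  have "1 * 3 \<le> (real z - R) * (real z + 1)" using R by (intro mult_mono) auto
  moreover have "cubic r n z - cubic r n (2 * r + 1) = (real z - R) * (real z + 1) - real z ^ 3 / n + R ^ 3 / n"
    unfolding cubic_def R_def[symmetric] r by (simp add: power2_eq_square algebra_simps)
  ultimately show ?thesis using z3 R3 unfolding bump_def by linarith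
qed

text \<open>Beyond \<open>2 r + 1\<close> the function can vanish only at scale \<open>n\<close>, where the loss term is not small.\<close>

lemma bump_zero_far:
  assumes n: "real (2 * r + 1) ^ 2 \<le> n" and z: "2 * r + 1 < z" "bump r n z = 0"
  shows "1 \<le> 3 * min (real z ^ 2 / n) n"
proof -
  define R where "R = real (2 * r + 1)"
  have R: "1 \<le> R" "R < real z" using z(1) by (auto simp: R_def)
  have "1 \<le> R ^ 2" using R(1) by simp
  then have n1: "1 \<le> n" using n unfolding R_def[symmetric] by linarith
  have "cubic r n z - cubic r n (2 * r + 1) \<le> 0" using z(2) unfolding bump_def by linarith
  then have "(real z - R) * ((real z + 1) - (real z ^ 2 + real z * R + R ^ 2) / n) \<le> 0"
    unfolding cubic_diff R_def .
  then have "(real z + 1) - (real z ^ 2 + real z * R + R ^ 2) / n \<le> 0"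
    using R(2) by (simp add: mult_le_0_iff)
  moreover have "(real z ^ 2 + real z * R + R ^ 2) / n \<le> 3 * (real z ^ 2 / n)"
  proof -
    have "real z * R \<le> real z ^ 2" using R unfolding power2_eq_square by (intro mult_mono) auto
    moreover have "R ^ 2 \<le> real z ^ 2" using R by (intro power_mono) auto
    ultimately have "real z ^ 2 + real z * R + R ^ 2 \<le> 3 * real z ^ 2" by linarith
    then have "(real z ^ 2 + real z * R + R ^ 2) / n \<le> (3 * real z ^ 2) / n" using n1 by (intro divide_right_mono) auto
    then show ?thesis by simp
  qed
  ultimately have "1 \<le> 3 * (real z ^ 2 / n)" using R by linarith
  then show ?thesis using n1 by (simp add: min_def)
qed

lemma cube_growth:
  assumes z: "1 \<le> real z" and K3: "0 \<le> K3"
  shows "real (k + z) ^ 3 + K3 * real (k + z) ^ 2 \<le>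
    real z ^ 3 + (3 + (3 * real k + 3 * real k ^ 2 + real k ^ 3 + K3 * (real k + 1) ^ 2)) * real z ^ 2"
proof -
  have z1: "1 \<le> real z ^ 2" using z by simp
  have zz: "real z \<le> real z ^ 2" using mult_left_mono[OF z, of "real z"] by (simp add: power2_eq_square)
  have "real k * 1 \<le> real k * real z" using z by (intro mult_left_mono) auto
  then have "real (k + z) \<le> (real k + 1) * real z" by (simp add: algebra_simps)
  then have "real (k + z) ^ 2 \<le> ((real k + 1) * real z) ^ 2" by (rule power_mono) simp
  then have "K3 * real (k + z) ^ 2 \<le> K3 * ((real k + 1) * real z) ^ 2" using K3 by (rule mult_left_mono)
  then have a: "K3 * real (k + z) ^ 2 \<le> K3 * (real k + 1) ^ 2 * real z ^ 2" by (simp add: power_mult_distrib mult.assoc)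
  have b: "3 * real k ^ 2 * real z \<le> 3 * real k ^ 2 * real z ^ 2" using zz by (intro mult_left_mono) auto
  have c: "real k ^ 3 * 1 \<le> real k ^ 3 * real z ^ 2" using z1 by (intro mult_left_mono) auto
  have "real (k + z) ^ 3 = real z ^ 3 + 3 * real k * real z ^ 2 + 3 * real k ^ 2 * real z + real k ^ 3 * 1"
    by (simp add: power2_eq_square power3_eq_cube algebra_simps)
  moreover have "(3 + (3 * real k + 3 * real k ^ 2 + real k ^ 3 + K3 * (real k + 1) ^ 2)) * real z ^ 2 =
      3 * real z ^ 2 + 3 * real k * real z ^ 2 + 3 * real k ^ 2 * real z ^ 2 + real k ^ 3 * real z ^ 2 + K3 * (real k + 1) ^ 2 * real z ^ 2"
    by (simp add: algebra_simps)
  moreover have "0 \<le> 3 * real z ^ 2" by simp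
  ultimately show ?thesis using a b c by linarith
qed

lemma ennreal_le_diff_add:
  assumes "0 \<le> y"
  shows "ennreal x \<le> ennreal (x - y) + ennreal y"
proof (cases "0 \<le> x - y")
  case True
  have "ennreal (x - y) + ennreal y = ennreal (x - y + y)" using True assms by (intro ennreal_plus[symmetric])
  then show ?thesis by simp
next
  case False
  then have "ennreal x \<le> ennreal y" by (intro ennreal_leI) simp
  then show ?thesis by (simp add: add_increasing)
qed

context bounded_environment
begin

section \<open>Superlinear growth for a total drift of at most k + 1\<close>

lemma offspring_jump:
  "ennreal (f y) * ennreal (ann.prob {a \<in> space (annealed P). fails (arrow_stack 0 a) m = y}) \<le> offspring (\<lambda>z. ennreal (f z)) m"
proof -
  have "ennreal (f y) * ennreal (ann.prob {a \<in> space (annealed P). fails (arrow_stack 0 a) m = y}) =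
      (\<integral>\<^sup>+a. ennreal (f y) * indicator {a \<in> space (annealed P). fails (arrow_stack 0 a) m = y} a \<partial>annealed P)"
    using fails_event[of 0 m y] by (simp add: nn_integral_cmult_indicator ann.emeasure_eq_measure)
  also have "\<dots> \<le> offspring (\<lambda>z. ennreal (f z)) m"
    unfolding offspring_def by (rule nn_integral_mono) (auto simp: indicator_def)
  finally show ?thesis .
qed

text \<open>A maximum is at least the cubic, whose mean is computed from the first three moments. The subtraction is
  avoided by moving the negative terms to the other side, which makes all integrands nonnegative.\<close>

lemma offspring_truncated_cubic:
  fixes N R0 h :: real
  assumes K3: "\<And>m. m > M \<Longrightarrow> offspring (\<lambda>z. ennreal (real z ^ 3)) m \<le> ennreal (real m ^ 3 + K3 * real m ^ 2)"
    and K30: "K3 \<ge> 0" and m: "m > M" and dm: "total_drift P \<le> real m"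
    and N: "N > 0" and R0: "R0 \<ge> 0" and h: "h \<ge> 0"
  shows "ennreal (real m ^ 2 + 2 * real m * (1 - total_drift P) + var_defect
      - 2 * R0 * (real m - total_drift P) - (real m ^ 3 + K3 * real m ^ 2) / N - h)
    \<le> offspring (\<lambda>z. ennreal (max (real z ^ 2 - 2 * R0 * real z - real z ^ 3 / N - h) 0)) m"
proof -
  let ?\<psi> = "\<lambda>z::nat. max (real z ^ 2 - 2 * R0 * real z - real z ^ 3 / N - h) 0"
  define E where "E = real m ^ 2 + 2 * real m * (1 - total_drift P) + var_defect"
  define F where "F = 2 * R0 * (real m - total_drift P) + 1 / N * (real m ^ 3 + K3 * real m ^ 2) + h"
  have F: "0 \<le> F" "0 \<le> 2 * R0 * (real m - total_drift P)" "0 \<le> 1 / N * (real m ^ 3 + K3 * real m ^ 2)"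
    using R0 N K30 dm h by (auto simp: F_def)
  have "ennreal E = offspring sq m" by (simp only: offspring_second[OF m] E_def)
  also have "\<dots> \<le> offspring (\<lambda>z. ennreal (?\<psi> z) + (ennreal (2 * R0) * ennreal (real z) + (ennreal (1 / N) * ennreal (real z ^ 3) + ennreal h))) m"
  proof (rule offspring_le)
    fix z :: nat
    have "real z ^ 2 \<le> ?\<psi> z + (2 * R0 * real z + (1 / N * real z ^ 3 + h))" by simp
    then have "sq z \<le> ennreal (?\<psi> z + (2 * R0 * real z + (1 / N * real z ^ 3 + h)))" by (rule ennreal_leI)
    also have "\<dots> = ennreal (?\<psi> z) + (ennreal (2 * R0) * ennreal (real z) + (ennreal (1 / N) * ennreal (real z ^ 3) + ennreal h))"
    proof -
      have nn: "0 \<le> ?\<psi> z" "0 \<le> 2 * R0 * real z" "0 \<le> 1 / N * real z ^ 3" using R0 N by auto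
      have "ennreal (?\<psi> z + (2 * R0 * real z + (1 / N * real z ^ 3 + h))) =
          ennreal (?\<psi> z) + (ennreal (2 * R0 * real z) + (ennreal (1 / N * real z ^ 3) + ennreal h))"
        using nn h by (subst ennreal_plus; (subst ennreal_plus)?; (subst ennreal_plus)?) (auto intro: add_nonneg_nonneg)
      then show ?thesis using R0 N by (subst ennreal_mult[symmetric]; (subst ennreal_mult[symmetric])?) auto
    qed
    finally show "sq z \<le> ennreal (?\<psi> z) + (ennreal (2 * R0) * ennreal (real z) + (ennreal (1 / N) * ennreal (real z ^ 3) + ennreal h))" .
  qed
  also have "\<dots> = offspring (\<lambda>z. ennreal (?\<psi> z)) m + (ennreal (2 * R0) * ennreal (real m - total_drift P)
      + (ennreal (1 / N) * offspring (\<lambda>z. ennreal (real z ^ 3)) m + ennreal h))"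
    by (simp only: offspring_add offspring_cmult offspring_const offspring_mean[OF m])
  also have "\<dots> \<le> offspring (\<lambda>z. ennreal (?\<psi> z)) m + (ennreal (2 * R0) * ennreal (real m - total_drift P)
      + (ennreal (1 / N) * ennreal (real m ^ 3 + K3 * real m ^ 2) + ennreal h))"
    by (intro add_left_mono add_right_mono mult_left_mono K3 m) simp
  also have "\<dots> = offspring (\<lambda>z. ennreal (?\<psi> z)) m + ennreal F"
  proof -
    have "ennreal F = ennreal (2 * R0 * (real m - total_drift P)) + ennreal (1 / N * (real m ^ 3 + K3 * real m ^ 2)) + ennreal h"
      unfolding F_def using F(2,3) h by (simp only: ennreal_plus add_nonneg_nonneg)
    also have "ennreal (2 * R0 * (real m - total_drift P)) = ennreal (2 * R0) * ennreal (real m - total_drift P)"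
      using R0 dm by (intro ennreal_mult) auto
    also have "ennreal (1 / N * (real m ^ 3 + K3 * real m ^ 2)) = ennreal (1 / N) * ennreal (real m ^ 3 + K3 * real m ^ 2)"
      using N K30 by (intro ennreal_mult) auto
    finally show ?thesis by (simp only: add.assoc)
  qed
  finally have le: "ennreal E \<le> offspring (\<lambda>z. ennreal (?\<psi> z)) m + ennreal F" .
  have "ennreal (E - F) = ennreal E - ennreal F" using F(1) by (simp add: ennreal_minus)
  also have "\<dots> \<le> offspring (\<lambda>z. ennreal (?\<psi> z)) m"
    using le by (simp add: ennreal_minus_le_iff add.commute)
  finally show ?thesis unfolding E_def F_def by (simp add: algebra_simps add_divide_distrib)
qed

text \<open>For \<open>\<delta> \<le> k + 1\<close> the quadratic part gains at least \<open>2 (k + 1 - \<delta>) (z - r) + 2 r\<close> up to a constant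
  that is compensated by the choice of \<open>r\<close>; the third moment costs a multiple of \<open>z\<^sup>2 / n\<close>.\<close>

lemma bump_drift:
  assumes K3: "\<And>m. m > M \<Longrightarrow> offspring (\<lambda>z. ennreal (real z ^ 3)) m \<le> ennreal (real m ^ 3 + K3 * real m ^ 2)"
    and K30: "K3 \<ge> 0" and d: "total_drift P \<le> real k + 1"
    and r: "real M + \<bar>real k ^ 2 + 2 * real k * (1 - total_drift P) + var_defect\<bar> + 1 \<le> real r"
    and n: "real (2 * r + 1) ^ 2 \<le> n" and z: "2 * r + 1 < z" "bump r n z > 0"
  shows "ennreal (bump r n z + 1 - (3 + (3 * real k + 3 * real k ^ 2 + real k ^ 3 + K3 * (real k + 1) ^ 2)) * (real z ^ 2 / n))
    \<le> offspring (\<lambda>z. ennreal (bump r n z)) (k + z)"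
proof -
  define \<delta> where "\<delta> = total_drift P"
  define \<kappa> where "\<kappa> = real k ^ 2 + 2 * real k * (1 - \<delta>) + var_defect"
  define K where "K = 3 + (3 * real k + 3 * real k ^ 2 + real k ^ 3 + K3 * (real k + 1) ^ 2)"
  have n0: "0 < n" using n by (rule less_le_trans[rotated]) simp
  have z1: "1 \<le> real z" "real r \<le> real z" using z(1) by auto
  have mM: "k + z > M"
  proof -
    have "real M \<le> real r" using r by linarith
    then show ?thesis using z(1) by simp
  qed
  have dm: "total_drift P \<le> real (k + z)" using d z1 by simp
  note lower = offspring_truncated_cubic[OF K3 K30 mM dm n0 _ bump_level_nonneg[OF n], of "real r"]
  have "bump r n z + 1 - K * (real z ^ 2 / n) \<le> real (k + z) ^ 2 + 2 * real (k + z) * (1 - total_drift P) + var_defect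
      - 2 * real r * (real (k + z) - total_drift P) - (real (k + z) ^ 3 + K3 * real (k + z) ^ 2) / n - cubic r n (2 * r + 1)"
  proof -
    have "(real (k + z) ^ 3 + K3 * real (k + z) ^ 2) / n \<le> (real z ^ 3 + K * real z ^ 2) / n"
      unfolding K_def by (intro divide_right_mono cube_growth) (use n0 z1 K30 in auto)
    then have cube: "(real (k + z) ^ 3 + K3 * real (k + z) ^ 2) / n \<le> real z ^ 3 / n + K * (real z ^ 2 / n)"
      by (simp add: add_divide_distrib)
    have "real (k + z) ^ 2 + 2 * real (k + z) * (1 - \<delta>) + var_defect - 2 * real r * (real (k + z) - \<delta>) =
        (real z ^ 2 - 2 * real r * real z) + 2 * (real k + 1 - \<delta>) * (real z - real r) + (2 * real r + \<kappa>)"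
      by (simp add: \<kappa>_def power2_eq_square algebra_simps)
    moreover have "0 \<le> 2 * (real k + 1 - \<delta>) * (real z - real r)" using d z1(2) by (simp add: \<delta>_def)
    moreover have "1 \<le> 2 * real r + \<kappa>" using r unfolding \<kappa>_def \<delta>_def by linarith
    moreover have "bump r n z = cubic r n z - cubic r n (2 * r + 1)" using z(2) unfolding bump_def by linarith
    moreover have "cubic r n z = real z ^ 2 - 2 * real r * real z - real z ^ 3 / n" by (simp add: cubic_def)
    ultimately show ?thesis using cube unfolding \<delta>_def[symmetric] by linarith
  qed
  then have "ennreal (bump r n z + 1 - K * (real z ^ 2 / n)) \<le> ennreal (real (k + z) ^ 2 + 2 * real (k + z) * (1 - total_drift P) + var_defect
      - 2 * real r * (real (k + z) - total_drift P) - (real (k + z) ^ 3 + K3 * real (k + z) ^ 2) / n - cubic r n (2 * r + 1))"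
    by (rule ennreal_leI)
  also have "\<dots> \<le> offspring (\<lambda>z. ennreal (bump r n z)) (k + z)"
    using lower unfolding bump_def cubic_def[of r n "z" for z] by simp
  finally show ?thesis unfolding K_def .
qed

text \<open>Only finitely many starting values are involved, so the jump probabilities have a positive minimum and the
  targets a common bound.\<close>

lemma uniform_jump:
  assumes k: "k \<ge> 1"
  shows "\<exists>p Y. 0 < p \<and> p \<le> 1 \<and> (\<forall>z\<le>R. \<exists>y. R < y \<and> y \<le> Y \<and>
    p \<le> ann.prob {a \<in> space (annealed P). fails (arrow_stack 0 a) (k + z) = y})"
proof -
  have "\<forall>z. \<exists>y\<ge>R + 1. ann.prob {a \<in> space (annealed P). fails (arrow_stack 0 a) (k + z) = y} > 0"
  proof
    fix z
    have "k + z \<ge> 1" using k by simp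
    then show "\<exists>y\<ge>R + 1. ann.prob {a \<in> space (annealed P). fails (arrow_stack 0 a) (k + z) = y} > 0"
      by (rule large_jump_positive)
  qed
  from choice[OF this] obtain y where "\<forall>z. y z \<ge> R + 1 \<and> ann.prob {a \<in> space (annealed P). fails (arrow_stack 0 a) (k + z) = y z} > 0" ..
  then have y: "\<And>z. y z \<ge> R + 1" "\<And>z. ann.prob {a \<in> space (annealed P). fails (arrow_stack 0 a) (k + z) = y z} > 0"
    by blast+
  define q where "q z = ann.prob {a \<in> space (annealed P). fails (arrow_stack 0 a) (k + z) = y z}" for z
  define p where "p = min 1 (Min (q ` {..R}))"
  have "Min (q ` {..R}) \<in> q ` {..R}" by (intro Min_in) auto
  then have "Min (q ` {..R}) > 0" using y(2) by (auto simp: q_def)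
  then have p: "0 < p" "p \<le> 1" by (simp_all add: p_def)
  show ?thesis
  proof (rule exI[of _ p], rule exI[of _ "Max (y ` {..R})"], intro conjI p allI impI)
    fix z assume z: "z \<le> R"
    then have "Min (q ` {..R}) \<le> q z" by (intro Min_le) auto
    then have "p \<le> q z" by (simp add: p_def)
    moreover have "R < y z" using y(1)[of z] by simp
    moreover have "y z \<le> Max (y ` {..R})" using z by simp
    ultimately show "\<exists>x. R < x \<and> x \<le> Max (y ` {..R}) \<and>
        p \<le> ann.prob {a \<in> space (annealed P). fails (arrow_stack 0 a) (k + z) = x}"
      unfolding q_def by (intro exI[of _ "y z"] conjI)
  qed
qed

text \<open>At small \<open>z\<close> the function vanishes and gains by the positive probability of a jump to a
  place where it is at least one; at intermediate \<open>z\<close> the drift of the cubic is used; where the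
  function vanishes again, the loss term alone is at least \<open>p\<close>.\<close>

lemma truncated_quadratic_lyapunov:
  assumes k: "k \<ge> 1" and d: "total_drift P \<le> real k + 1"
  shows "\<exists>p K N0. p > 0 \<and> K > 0 \<and> (\<forall>N::nat. N \<ge> N0 \<longrightarrow> (\<exists>\<psi>::nat \<Rightarrow> real.
      (\<forall>z. 0 \<le> \<psi> z \<and> \<psi> z \<le> real N ^ 2) \<and>
      (\<forall>z. ennreal (\<psi> z + p) \<le> offspring (\<lambda>z. ennreal (\<psi> z)) (k + z)
          + ennreal (K * min (real z ^ 2 / real N) (real N)))))"
proof -
  obtain K3 where K3: "K3 \<ge> 0" "\<And>m. m > M \<Longrightarrow>
      offspring (\<lambda>z. ennreal (real z ^ 3)) m \<le> ennreal (real m ^ 3 + K3 * real m ^ 2)"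
    using offspring_third by blast
  \<comment> \<open>\<open>r\<close> exceeds the constant term of the drift of \<open>z\<^sup>2\<close>, and beyond \<open>M\<close> the moments are explicit\<close>
  obtain r :: nat where r: "real M + \<bar>real k ^ 2 + 2 * real k * (1 - total_drift P) + var_defect\<bar> + 1 \<le> real r"
    using real_arch_simple by blast
  define R where "R = 2 * r + 1"
  define K where "K = 3 + (3 * real k + 3 * real k ^ 2 + real k ^ 3 + K3 * (real k + 1) ^ 2)"
  have K: "K \<ge> 3" using K3(1) by (simp add: K_def)
  from uniform_jump[OF k, of R] obtain p Y where p: "0 < p" "p \<le> 1" and
    jump: "\<forall>z\<le>R. \<exists>y. R < y \<and> y \<le> Y \<and> p \<le> ann.prob {a \<in> space (annealed P). fails (arrow_stack 0 a) (k + z) = y}"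
    by (elim exE conjE) (rule that)
  \<comment> \<open>\<open>R\<^sup>2 \<le> N\<close> makes the cut-off level nonnegative, \<open>Y\<^sup>3 \<le> N\<close> keeps the function above one at the jump targets\<close>
  define N0 where "N0 = R ^ 2 + Y ^ 3 + 1"
  have main: "ennreal (bump r (real N) z + p) \<le> offspring (\<lambda>z. ennreal (bump r (real N) z)) (k + z)
      + ennreal (K * min (real z ^ 2 / real N) (real N))" if N: "N \<ge> N0" for N z
  proof -
    define n where "n = real N"
    have "N \<ge> R ^ 2" "N \<ge> Y ^ 3" "N \<ge> 1" using N by (auto simp: N0_def)
    then have "real (R ^ 2) \<le> real N" "real (Y ^ 3) \<le> real N" "real 1 \<le> real N" by (simp_all only: of_nat_le_iff)
    then have n: "real R ^ 2 \<le> n" "real Y ^ 3 \<le> n" "1 \<le> n" by (simp_all add: n_def)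
    note nR = n(1)[unfolded R_def]
    let ?\<psi> = "bump r n" and ?l = "min (real z ^ 2 / n) n"
    have l: "0 \<le> ?l" using n by simp
    have \<psi>0: "0 \<le> ?\<psi> x" for x by (simp add: bump_def)
    consider "z \<le> R" | "R < z" "?\<psi> z = 0" | "R < z" "?\<psi> z > 0" using \<psi>0[of z] by linarith
    then have "ennreal (?\<psi> z + p) \<le> offspring (\<lambda>z. ennreal (?\<psi> z)) (k + z) + ennreal (K * ?l)"
    proof cases
      case 1
      from jump[rule_format, OF 1] obtain y where y: "R < y" "y \<le> Y"
        "p \<le> ann.prob {a \<in> space (annealed P). fails (arrow_stack 0 a) (k + z) = y}" by (elim exE conjE) (rule that)
      have b: "1 \<le> ?\<psi> y" using bump_ge_1[of r y Y n] y(1,2) n unfolding R_def by simp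
      have "ennreal p \<le> ennreal (ann.prob {a \<in> space (annealed P). fails (arrow_stack 0 a) (k + z) = y})"
        using y(3) by (rule ennreal_leI)
      also have "\<dots> = 1 * ennreal (ann.prob {a \<in> space (annealed P). fails (arrow_stack 0 a) (k + z) = y})" by simp
      also have "\<dots> \<le> ennreal (?\<psi> y) * ennreal (ann.prob {a \<in> space (annealed P). fails (arrow_stack 0 a) (k + z) = y})"
        using b by (intro mult_right_mono) simp_all
      also have "\<dots> \<le> offspring (\<lambda>z. ennreal (?\<psi> z)) (k + z)" by (rule offspring_jump)
      finally show ?thesis using bump_small[OF nR, of z] 1 by (simp add: R_def add_increasing2)
    next
      case 2
      have "1 \<le> 3 * ?l" using bump_zero_far[OF nR, of z] 2 unfolding R_def by blast
      then have "1 \<le> K * ?l" using mult_right_mono[OF K l] by linarith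
      then have "?\<psi> z + p \<le> K * ?l" using 2 p(2) by simp
      then show ?thesis by (simp add: add_increasing ennreal_leI)
    next
      case 3
      have l_eq: "?l = real z ^ 2 / n" using bump_pos_less[OF nR 3(2)] n by (simp add: min_def divide_le_eq power2_eq_square mult_mono)
      have "ennreal (?\<psi> z + p - K * ?l) \<le> ennreal (?\<psi> z + 1 - K * (real z ^ 2 / n))"
        using p(2) unfolding l_eq by (intro ennreal_leI) simp
      also have "\<dots> \<le> offspring (\<lambda>z. ennreal (?\<psi> z)) (k + z)"
        unfolding K_def using bump_drift[OF K3(2) K3(1) d r nR, of z] 3 unfolding R_def by simp
      finally have "ennreal (?\<psi> z + p - K * ?l) + ennreal (K * ?l) \<le> offspring (\<lambda>z. ennreal (?\<psi> z)) (k + z) + ennreal (K * ?l)"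
        by (rule add_right_mono)
      moreover have "ennreal (?\<psi> z + p) \<le> ennreal (?\<psi> z + p - K * ?l) + ennreal (K * ?l)"
        by (rule ennreal_le_diff_add) (use K l in simp)
      ultimately show ?thesis by (rule order_trans[rotated])
    qed
    then show ?thesis unfolding n_def .
  qed
  have bounds: "0 \<le> bump r (real N) z \<and> bump r (real N) z \<le> real N ^ 2" if "N \<ge> N0" for N z
  proof -
    have "R ^ 2 \<le> N" using that by (simp add: N0_def)
    then have "real (R ^ 2) \<le> real N" by (simp only: of_nat_le_iff)
    then have "real (2 * r + 1) ^ 2 \<le> real N" by (simp only: R_def of_nat_power)
    from bump_bounds[OF this] show ?thesis by blast
  qed
  show ?thesis
  proof (rule exI[of _ p], rule exI[of _ K], rule exI[of _ N0], intro conjI allI impI)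
    show "p > 0" by (rule p(1))
    show "K > 0" using K by simp
    fix N assume N: "N \<ge> N0"
    show "\<exists>\<psi>::nat \<Rightarrow> real. (\<forall>z. 0 \<le> \<psi> z \<and> \<psi> z \<le> real N ^ 2) \<and>
      (\<forall>z. ennreal (\<psi> z + p) \<le> offspring (\<lambda>z. ennreal (\<psi> z)) (k + z)
          + ennreal (K * min (real z ^ 2 / real N) (real N)))"
      by (rule exI[of _ "bump r (real N)"]) (intro conjI allI main[OF N] conjunct1[OF bounds[OF N]] conjunct2[OF bounds[OF N]])
  qed
qed

lemma lyapunov_telescoped:
  assumes p: "0 \<le> p" and \<psi>: "\<And>z. 0 \<le> \<psi> z"
    and step: "\<And>z. ennreal (\<psi> z + p) \<le> offspring (\<lambda>z. ennreal (\<psi> z)) (k + z) + ennreal (l z)"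
    and i: "i \<le> n"
  shows "ennreal (real i * p) \<le> (\<integral>\<^sup>+a. ennreal (\<psi> (excursions k a n i)) \<partial>annealed P)
    + (\<Sum>j<i. \<integral>\<^sup>+a. ennreal (l (excursions k a n j)) \<partial>annealed P)"
  using i
proof (induction i)
  case 0
  then show ?case by simp
next
  case (Suc i)
  let ?I = "\<lambda>i. \<integral>\<^sup>+a. ennreal (\<psi> (excursions k a n i)) \<partial>annealed P"
  let ?S = "\<Sum>j<i. \<integral>\<^sup>+a. ennreal (l (excursions k a n j)) \<partial>annealed P"
  let ?l = "\<integral>\<^sup>+a. ennreal (l (excursions k a n i)) \<partial>annealed P"
  have "?I i + ennreal p = (\<integral>\<^sup>+a. ennreal (\<psi> (excursions k a n i)) + ennreal p \<partial>annealed P)"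
    by (subst nn_integral_add) (simp_all add: ann.emeasure_space_1 excursions_comp_measurable[of "\<lambda>z. ennreal (\<psi> z)"])
  also have "\<dots> \<le> (\<integral>\<^sup>+a. offspring (\<lambda>z. ennreal (\<psi> z)) (k + excursions k a n i) + ennreal (l (excursions k a n i)) \<partial>annealed P)"
  proof (rule nn_integral_mono)
    fix a
    show "ennreal (\<psi> (excursions k a n i)) + ennreal p \<le>
      offspring (\<lambda>z. ennreal (\<psi> z)) (k + excursions k a n i) + ennreal (l (excursions k a n i))"
      using step[of "excursions k a n i"] \<psi>[of "excursions k a n i"] p by (simp only: ennreal_plus)
  qed
  also have "\<dots> = (\<integral>\<^sup>+a. offspring (\<lambda>z. ennreal (\<psi> z)) (k + excursions k a n i) \<partial>annealed P) + ?l"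
    by (rule nn_integral_add)
      (rule excursions_comp_measurable[of "\<lambda>z. offspring (\<lambda>z. ennreal (\<psi> z)) (k + z)"] excursions_comp_measurable[of "\<lambda>z. ennreal (l z)"])+
  also have "(\<integral>\<^sup>+a. offspring (\<lambda>z. ennreal (\<psi> z)) (k + excursions k a n i) \<partial>annealed P) = ?I (Suc i)"
    using markov_step[of "\<lambda>z. ennreal (\<psi> z)" k n i] Suc.prems by (simp only: Suc_le_eq if_True)
  finally have le: "?I i + ennreal p \<le> ?I (Suc i) + ?l" .
  have "ennreal (real (Suc i) * p) = ennreal (real i * p) + ennreal p"
    using p by (subst ennreal_plus[symmetric]) (auto simp: algebra_simps)
  also have "\<dots> \<le> (?I i + ?S) + ennreal p" using Suc by (intro add_right_mono) simp
  also have "\<dots> = (?I i + ennreal p) + ?S" by (simp only: ac_simps)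
  also have "\<dots> \<le> (?I (Suc i) + ?l) + ?S" by (rule add_right_mono[OF le])
  also have "\<dots> = ?I (Suc i) + (\<Sum>j<Suc i. \<integral>\<^sup>+a. ennreal (l (excursions k a n j)) \<partial>annealed P)"
    by (simp only: sum.lessThan_Suc ac_simps)
  finally show ?case .
qed

text \<open>At each dyadic scale the bounded function gains at least \<open>n p\<close> minus the losses in \<open>n\<close> steps. Summing
  over the scales adds up the gains, whereas the losses stay comparable with \<open>z\<close>.\<close>

lemma truncated_mean_growth:
  assumes k: "k \<ge> 1" and d: "total_drift P \<le> real k + 1"
  shows "\<exists>p K J0. p > 0 \<and> K > 0 \<and> (\<forall>L\<ge>J0. \<forall>n.
    ennreal (real (L - J0) * (real n * p)) \<le> ennreal (real (L - J0) * 4 ^ L)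
      + (\<Sum>i<n. \<integral>\<^sup>+a. ennreal (K * min (4 * real (excursions k a n i)) (2 ^ L)) \<partial>annealed P))"
proof -
  from truncated_quadratic_lyapunov[OF k d] obtain p K N0 where pK: "p > 0" "K > 0" and
    lyap: "\<forall>N::nat. N \<ge> N0 \<longrightarrow> (\<exists>\<psi>::nat \<Rightarrow> real.
      (\<forall>z. 0 \<le> \<psi> z \<and> \<psi> z \<le> real N ^ 2) \<and>
      (\<forall>z. ennreal (\<psi> z + p) \<le> offspring (\<lambda>z. ennreal (\<psi> z)) (k + z)
          + ennreal (K * min (real z ^ 2 / real N) (real N))))"
    by (elim exE conjE) (rule that)
  let ?l = "\<lambda>j z. min (real z ^ 2 / 2 ^ j) (2 ^ j) :: real"
  have scale: "ennreal (real n * p) \<le> ennreal (4 ^ j) + (\<Sum>i<n. \<integral>\<^sup>+a. ennreal (K * ?l j (excursions k a n i)) \<partial>annealed P)"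
    if j: "N0 \<le> j" for j n
  proof -
    have "j < 2 ^ j" by simp
    then have "N0 \<le> 2 ^ j" using j by linarith
    from lyap[rule_format, OF this] obtain \<psi> :: "nat \<Rightarrow> real" where
      \<psi>: "\<forall>z. 0 \<le> \<psi> z \<and> \<psi> z \<le> real (2 ^ j) ^ 2" and
      step: "\<forall>z. ennreal (\<psi> z + p) \<le> offspring (\<lambda>z. ennreal (\<psi> z)) (k + z)
          + ennreal (K * min (real z ^ 2 / real (2 ^ j)) (real (2 ^ j)))"
      by (elim exE conjE) (rule that)
    have step': "ennreal (\<psi> z + p) \<le> offspring (\<lambda>z. ennreal (\<psi> z)) (k + z) + ennreal (K * ?l j z)" for z
      using spec[OF step, of z] by simp
    have "ennreal (real n * p) \<le> (\<integral>\<^sup>+a. ennreal (\<psi> (excursions k a n n)) \<partial>annealed P)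
        + (\<Sum>i<n. \<integral>\<^sup>+a. ennreal (K * ?l j (excursions k a n i)) \<partial>annealed P)"
      using lyapunov_telescoped[of p \<psi> k "\<lambda>z. K * ?l j z" n n] step' \<psi> pK(1) by simp
    also have "(\<integral>\<^sup>+a. ennreal (\<psi> (excursions k a n n)) \<partial>annealed P) \<le> (\<integral>\<^sup>+a. ennreal (4 ^ j) \<partial>annealed P)"
    proof (rule nn_integral_mono, rule ennreal_leI)
      fix a
      have "real (2 ^ j) ^ 2 = 4 ^ j" by (simp add: power_mult[symmetric] mult.commute[of j] power_mult)
      then show "\<psi> (excursions k a n n) \<le> 4 ^ j" using \<psi> by metis
    qed
    also have "\<dots> = ennreal (4 ^ j)" by (simp add: ann.emeasure_space_1)
    finally show ?thesis by (simp add: add_right_mono)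
  qed
  have "ennreal (real (L - N0) * (real n * p)) \<le> ennreal (real (L - N0) * 4 ^ L)
      + (\<Sum>i<n. \<integral>\<^sup>+a. ennreal (K * min (4 * real (excursions k a n i)) (2 ^ L)) \<partial>annealed P)" if L: "L \<ge> N0" for L n
  proof -
    have "ennreal (real (L - N0) * (real n * p)) = (\<Sum>j\<in>{N0..<L}. ennreal (real n * p))"
      using pK(1) by (subst sum_ennreal) auto
    also have "\<dots> \<le> (\<Sum>j\<in>{N0..<L}. ennreal (4 ^ L) + (\<Sum>i<n. \<integral>\<^sup>+a. ennreal (K * ?l j (excursions k a n i)) \<partial>annealed P))"
    proof (rule sum_mono)
      fix j assume j: "j \<in> {N0..<L}"
      have "ennreal (4 ^ j) \<le> ennreal (4 ^ L)" using j by (intro ennreal_leI power_increasing) auto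
      then show "ennreal (real n * p) \<le> ennreal (4 ^ L) + (\<Sum>i<n. \<integral>\<^sup>+a. ennreal (K * ?l j (excursions k a n i)) \<partial>annealed P)"
        using scale[of j n] j by (meson add_right_mono atLeastLessThan_iff order_trans)
    qed
    also have "\<dots> = (\<Sum>j\<in>{N0..<L}. ennreal (4 ^ L)) + (\<Sum>j\<in>{N0..<L}. \<Sum>i<n. \<integral>\<^sup>+a. ennreal (K * ?l j (excursions k a n i)) \<partial>annealed P)"
      by (rule sum.distrib)
    also have "(\<Sum>j\<in>{N0..<L}. ennreal (4 ^ L)) = ennreal (real (L - N0) * 4 ^ L)"
      by (subst sum_ennreal) auto
    also have "(\<Sum>j\<in>{N0..<L}. \<Sum>i<n. \<integral>\<^sup>+a. ennreal (K * ?l j (excursions k a n i)) \<partial>annealed P) =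
        (\<Sum>i<n. \<Sum>j\<in>{N0..<L}. \<integral>\<^sup>+a. ennreal (K * ?l j (excursions k a n i)) \<partial>annealed P)"
      by (rule sum.swap)
    also have "\<dots> \<le> (\<Sum>i<n. \<integral>\<^sup>+a. ennreal (K * min (4 * real (excursions k a n i)) (2 ^ L)) \<partial>annealed P)"
    proof (rule sum_mono)
      fix i
      have "(\<Sum>j\<in>{N0..<L}. \<integral>\<^sup>+a. ennreal (K * ?l j (excursions k a n i)) \<partial>annealed P) =
          (\<integral>\<^sup>+a. (\<Sum>j\<in>{N0..<L}. ennreal (K * ?l j (excursions k a n i))) \<partial>annealed P)"
        by (rule nn_integral_sum[symmetric]) (rule excursions_comp_measurable)
      also have "\<dots> \<le> (\<integral>\<^sup>+a. ennreal (K * min (4 * real (excursions k a n i)) (2 ^ L)) \<partial>annealed P)"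
      proof (rule nn_integral_mono)
        fix a
        let ?z = "excursions k a n i"
        have "(\<Sum>j\<in>{N0..<L}. ennreal (K * ?l j ?z)) = ennreal (\<Sum>j\<in>{N0..<L}. K * ?l j ?z)"
          using pK(2) by (intro sum_ennreal) auto
        also have "\<dots> = ennreal (K * (\<Sum>j\<in>{N0..<L}. ?l j ?z))" by (simp only: sum_distrib_left)
        also have "\<dots> \<le> ennreal (K * min (4 * real ?z) (2 ^ L))"
          using pK(2) by (intro ennreal_leI mult_left_mono dyadic_sum) auto
        finally show "(\<Sum>j\<in>{N0..<L}. ennreal (K * ?l j ?z)) \<le> ennreal (K * min (4 * real ?z) (2 ^ L))" .
      qed
      finally show "(\<Sum>j\<in>{N0..<L}. \<integral>\<^sup>+a. ennreal (K * ?l j (excursions k a n i)) \<partial>annealed P)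
          \<le> (\<integral>\<^sup>+a. ennreal (K * min (4 * real (excursions k a n i)) (2 ^ L)) \<partial>annealed P)" .
    qed
    finally show ?thesis by (simp add: add_left_mono)
  qed
  then show ?thesis using pK by (intro exI[of _ N0] exI conjI allI impI)
qed

text \<open>If the sum were at most \<open>C n\<close> with probability close to one, the truncated means would be bounded by
  about \<open>4 C\<close>, independently of the truncation level \<open>2\<^sup>L\<close>.\<close>

lemma linear_excursions_unlikely:
  assumes k: "k \<ge> 1" and d: "total_drift P \<le> real k + 1"
  shows "\<exists>\<eta>>0. \<exists>n0. \<forall>n\<ge>n0. ann.prob {a \<in> space (annealed P). (\<Sum>i\<le>n. excursions k a n i) \<le> C * n} \<le> 1 - \<eta>"
proof -
  from truncated_mean_growth[OF k d] obtain p K J0 where p: "p > 0" and K: "K > 0" and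
    growth: "\<forall>L\<ge>J0. \<forall>n. ennreal (real (L - J0) * (real n * p)) \<le> ennreal (real (L - J0) * 4 ^ L)
      + (\<Sum>i<n. \<integral>\<^sup>+a. ennreal (K * min (4 * real (excursions k a n i)) (2 ^ L)) \<partial>annealed P)"
    by (elim exE conjE) (rule that)
  \<comment> \<open>so many scales that their joint gain per step exceeds \<open>4 K C\<close> by two\<close>
  obtain J :: nat where "(K * (4 * real C) + 2) / p \<le> real J" using real_arch_simple by blast
  then have J: "K * (4 * real C) + 2 \<le> real J * p" using p by (simp add: divide_le_eq)
  define L where "L = J0 + J"
  \<comment> \<open>on an event of probability \<open>\<eta>\<close> the truncated sum contributes at most \<open>n / 2\<close>\<close>
  define \<eta> where "\<eta> = 1 / (2 * (K * 2 ^ L))"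
  have \<eta>: "\<eta> > 0" using K by (simp add: \<eta>_def)
  obtain n0 :: nat where n0: "real J * 4 ^ L + 1 \<le> real n0" using real_arch_simple by blast
  let ?E = "\<lambda>n. {a \<in> space (annealed P). (\<Sum>i\<le>n. excursions k a n i) \<le> C * n}"
  have X: "(\<lambda>a. \<Sum>i\<le>m. excursions k a n i) \<in> measurable (annealed P) (count_space UNIV)" for n m
    by (induction m) (simp_all del: excursions.simps, measurable)
  have E: "?E n \<in> ann.events" for n
  proof -
    note [measurable] = X[of n n]
    show ?thesis by measurable
  qed
  have "ann.prob (?E n) \<le> 1 - \<eta>" if n: "n \<ge> n0" for n
  proof (rule ccontr)
    assume contra: "\<not> ?thesis"
    define B where "B = space (annealed P) - ?E n"
    have B: "B \<in> ann.events" unfolding B_def by (rule sets.compl_sets[OF E])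
    have pB: "ann.prob B < \<eta>" using contra ann.prob_compl[OF E[of n]] unfolding B_def by linarith
    have n_pos: "0 < real n" using n n0 by (smt (verit) of_nat_le_iff mult_nonneg_nonneg of_nat_0_le_iff zero_le_power)
    have "(\<Sum>i<n. \<integral>\<^sup>+a. ennreal (K * min (4 * real (excursions k a n i)) (2 ^ L)) \<partial>annealed P) =
        (\<integral>\<^sup>+a. (\<Sum>i<n. ennreal (K * min (4 * real (excursions k a n i)) (2 ^ L))) \<partial>annealed P)"
      by (rule nn_integral_sum[symmetric]) (rule excursions_comp_measurable)
    also have "\<dots> \<le> (\<integral>\<^sup>+a. ennreal (K * (4 * real C) * real n) + ennreal (K * 2 ^ L * real n) * indicator B a \<partial>annealed P)"
    proof (rule nn_integral_mono)
      fix a assume a: "a \<in> space (annealed P)"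
      let ?z = "\<lambda>i. excursions k a n i"
      have "(\<Sum>i<n. ennreal (K * min (4 * real (?z i)) (2 ^ L))) = ennreal (\<Sum>i<n. K * min (4 * real (?z i)) (2 ^ L))"
        using K by (intro sum_ennreal) auto
      also have "\<dots> \<le> ennreal (K * (4 * real C) * real n) + ennreal (K * 2 ^ L * real n) * indicator B a"
      proof (cases "a \<in> B")
        case True
        have "(\<Sum>i<n. K * min (4 * real (?z i)) (2 ^ L)) \<le> (\<Sum>i<n. K * 2 ^ L)"
          using K by (intro sum_mono mult_left_mono) auto
        also have "\<dots> = K * 2 ^ L * real n" by simp
        finally have "ennreal (\<Sum>i<n. K * min (4 * real (?z i)) (2 ^ L)) \<le> ennreal (K * 2 ^ L * real n)" by (rule ennreal_leI)
        then show ?thesis using True by (simp add: add_increasing)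
      next
        case False
        then have "(\<Sum>i\<le>n. ?z i) \<le> C * n" using a by (simp add: B_def)
        moreover have "(\<Sum>i<n. ?z i) \<le> (\<Sum>i\<le>n. ?z i)" by (rule sum_mono2) auto
        ultimately have "(\<Sum>i<n. ?z i) \<le> C * n" by linarith
        then have z: "real (\<Sum>i<n. ?z i) \<le> real C * real n" by (metis of_nat_le_iff of_nat_mult)
        have "(\<Sum>i<n. K * min (4 * real (?z i)) (2 ^ L)) \<le> (\<Sum>i<n. K * 4 * real (?z i))"
          using K by (intro sum_mono) simp
        also have "\<dots> = K * 4 * real (\<Sum>i<n. ?z i)" by (simp add: sum_distrib_left)
        also have "\<dots> \<le> K * 4 * (real C * real n)" using K z by (intro mult_left_mono) auto
        finally have "ennreal (\<Sum>i<n. K * min (4 * real (?z i)) (2 ^ L)) \<le> ennreal (K * (4 * real C) * real n)"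
          by (intro ennreal_leI) (simp add: mult.assoc)
        then show ?thesis by (simp add: add_increasing2)
      qed
      finally show "(\<Sum>i<n. ennreal (K * min (4 * real (?z i)) (2 ^ L))) \<le>
          ennreal (K * (4 * real C) * real n) + ennreal (K * 2 ^ L * real n) * indicator B a" .
    qed
    also have "\<dots> = ennreal (K * (4 * real C) * real n) + ennreal (K * 2 ^ L * real n) * ennreal (ann.prob B)"
      using B by (subst nn_integral_add) (simp_all add: ann.emeasure_space_1 nn_integral_cmult_indicator ann.emeasure_eq_measure ann.prob_space)
    also have "\<dots> = ennreal (K * (4 * real C) * real n + K * 2 ^ L * real n * ann.prob B)"
      using K by (simp add: ennreal_plus ennreal_mult)
    finally have upper: "(\<Sum>i<n. \<integral>\<^sup>+a. ennreal (K * min (4 * real (excursions k a n i)) (2 ^ L)) \<partial>annealed P)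
        \<le> ennreal (K * (4 * real C) * real n + K * 2 ^ L * real n * ann.prob B)" .
    have "ennreal (real J * (real n * p)) \<le> ennreal (real J * 4 ^ L)
        + (\<Sum>i<n. \<integral>\<^sup>+a. ennreal (K * min (4 * real (excursions k a n i)) (2 ^ L)) \<partial>annealed P)"
      using growth[rule_format, of L n] by (simp add: L_def)
    also have "\<dots> \<le> ennreal (real J * 4 ^ L) + ennreal (K * (4 * real C) * real n + K * 2 ^ L * real n * ann.prob B)"
      by (rule add_left_mono[OF upper])
    also have "\<dots> = ennreal (real J * 4 ^ L + (K * (4 * real C) * real n + K * 2 ^ L * real n * ann.prob B))"
      using K by (intro ennreal_plus[symmetric]) auto
    finally have le: "real J * (real n * p) \<le> real J * 4 ^ L + (K * (4 * real C) * real n + K * 2 ^ L * real n * ann.prob B)"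
      using K by (subst (asm) ennreal_le_iff) auto
    have "K * 2 ^ L * real n * ann.prob B \<le> K * 2 ^ L * real n * \<eta>"
      using pB K by (intro mult_left_mono) auto
    also have "\<dots> = real n / 2" using K by (simp add: \<eta>_def)
    finally have b: "K * 2 ^ L * real n * ann.prob B \<le> real n / 2" .
    have c: "real J * 4 ^ L + 1 \<le> real n" using n n0 by (meson of_nat_le_iff order_trans)
    have "(K * (4 * real C) + 2) * real n \<le> (real J * p) * real n" using J n_pos by (intro mult_right_mono) auto
    then have "K * (4 * real C) * real n + 2 * real n \<le> real J * (real n * p)" by (simp add: algebra_simps)
    with le b c n_pos show False by linarith
  qed
  then show ?thesis using \<eta> by blast
qed

text \<open>Positive speed means that level \<open>n\<close> is reached in time \<open>C n\<close> for all large \<open>n\<close>, so the sums of the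
  excursion numbers would be at most \<open>C n\<close> with probability tending to one.\<close>

lemma positive_speed_imp_drift:
  assumes k: "k \<ge> 1" and v: "v > 0"
    and lim: "AE a in annealed P. (\<lambda>n. real_of_int (kmin_walk k a n) / real n) \<longlonglongrightarrow> v"
  shows "total_drift P > real k + 1"
proof (rule ccontr)
  assume "\<not> ?thesis"
  then have d: "total_drift P \<le> real k + 1" by simp
  obtain C :: nat where C: "2 / v \<le> real C" using real_arch_simple by blast
  have Cv: "1 \<le> v / 2 * real C" using C v by (simp add: field_simps)
  have C1: "C \<ge> 1" using Cv v by (cases C) auto
  let ?E = "\<lambda>n. {a \<in> space (annealed P). (\<Sum>i\<le>n. excursions k a n i) \<le> C * n}"
  have X: "(\<lambda>a. \<Sum>i\<le>m. excursions k a n i) \<in> measurable (annealed P) (count_space UNIV)" for n m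
    by (induction m) (simp_all del: excursions.simps, measurable)
  have E: "?E n \<in> ann.events" for n
  proof -
    note [measurable] = X[of n n]
    show ?thesis by measurable
  qed
  from linear_excursions_unlikely[OF k d, of C] obtain \<eta> n0 where \<eta>: "\<eta> > 0"
    "\<forall>n\<ge>n0. ann.prob (?E n) \<le> 1 - \<eta>" by (elim exE conjE) (rule that)
  let ?I = "\<lambda>N. \<Inter>n\<in>{N..}. ?E n"
  have I: "?I N \<in> ann.events" for N by (rule sets.countable_INT') (use E in auto)
  have ev: "AE a in annealed P. a \<in> (\<Union>N. ?I N)"
    using lim proper_AE AE_space
  proof eventually_elim
    case (elim a)
    have "\<forall>\<^sub>F t in sequentially. v / 2 < real_of_int (kmin_walk k a t) / real t"
      using elim(1) v by (intro order_tendstoD(1)) auto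
    then obtain T where T: "\<And>t. t \<ge> T \<Longrightarrow> v / 2 < real_of_int (kmin_walk k a t) / real t"
      by (auto simp: eventually_sequentially)
    have "(\<Sum>i\<le>n. excursions k a n i) \<le> C * n" if n: "n \<ge> max T 1" for n
    proof (rule excursions_sum_le_time[OF k elim(2)])
      have nC: "n \<le> C * n" using C1 by simp
      then have t: "C * n \<ge> T" "C * n \<ge> 1" using n by linarith+
      have "v / 2 * real (C * n) < real_of_int (kmin_walk k a (C * n))"
        using T[OF t(1)] t(2) by (simp add: less_divide_eq)
      moreover have "1 * real n \<le> v / 2 * real C * real n" using Cv by (intro mult_right_mono) auto
      ultimately have "real n < real_of_int (kmin_walk k a (C * n))" by (simp add: mult.assoc)
      then show "int n \<le> kmin_walk k a (C * n)" by linarith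
    qed
    then have "a \<in> ?I (max T 1)" using elim(3) by auto
    then show ?case by blast
  qed
  have "(\<Union>N. ?I N) \<in> ann.events" by (rule sets.countable_UN) (use I in auto)
  then have "ann.prob (\<Union>N. ?I N) = 1" using ev ann.prob_eq_1 by blast
  moreover have "(\<lambda>N. ann.prob (?I N)) \<longlonglongrightarrow> ann.prob (\<Union>N. ?I N)"
  proof (rule ann.finite_Lim_measure_incseq)
    show "range ?I \<subseteq> ann.events" using I by blast
    show "incseq ?I" by (intro incseq_SucI INT_anti_mono) auto
  qed
  moreover have "ann.prob (\<Union>N. ?I N) \<le> 1 - \<eta>"
  proof (rule LIMSEQ_le_const2)
    show "(\<lambda>N. ann.prob (?I N)) \<longlonglongrightarrow> ann.prob (\<Union>N. ?I N)" by fact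
    show "\<exists>N. \<forall>n\<ge>N. ann.prob (?I n) \<le> 1 - \<eta>"
    proof (intro exI allI impI)
      fix n assume "n \<ge> n0"
      have "ann.prob (?I n) \<le> ann.prob (?E n)" by (rule ann.finite_measure_mono[OF _ E]) auto
      also have "\<dots> \<le> 1 - \<eta>" using \<eta>(2) \<open>n \<ge> n0\<close> by blast
      finally show "ann.prob (?I n) \<le> 1 - \<eta>" .
    qed
  qed
  ultimately show False using \<eta>(1) by linarith
qed

end

theorem theorem7p2:
  fixes P :: "cookie_env measure" and k :: nat and v :: real
  assumes "prob_space P" and "sets P = sets cookie_space"
    and "IID P" and "BD P" and "WEL P"
    and "k \<ge> 1"
    and "AE a in annealed P. k_right_transient k a"
    and "AE a in annealed P. (\<lambda>n. real_of_int (kmin_walk k a n) / real n) \<longlonglongrightarrow> v"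
  shows "v > 0 \<longleftrightarrow> total_drift P > real k + 1"
proof -
  from \<open>BD P\<close> obtain M where "AE \<omega> in P. \<forall>x. \<forall>n>M. \<omega> (x, n) = 1 / 2"
    unfolding BD_def ..
  with assms interpret bounded_environment P M
    by (intro bounded_environment.intro iid_environment.intro iid_environment_axioms.intro bounded_environment_axioms.intro)
  show ?thesis
    using positive_speed[OF assms(6) _ assms(8)] positive_speed_imp_drift[OF assms(6) _ assms(8)] by blast
qed

end
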